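(* Let $M$ be a proper quasi bi-slant submanifold of a cosymplectic manifold $(\bar M,\varphi,\xi,\eta,g)$, with $TM=\mathcal{D}\oplus\mathcal{D}_1\oplus\mathcal{D}_2\oplus\langle\xi\rangle$. The invariant distribution $\mathcal{D}$ is integrable if and only if $$g\big(\mathcal{T}(\nabla_X\mathcal{T}Y-\nabla_Y\mathcal{T}X),Z\big)=g\big(h(X,\mathcal{T}Y)-h(Y,\mathcal{T}X),\varphi\mathcal{Q}Z+\varphi\mathcal{R}Z\big)$$ for all $X,Y\in\Gamma(\mathcal{D})$ and $Z\in\Gamma(\mathcal{D}_1\oplus\mathcal{D}_2)$.
   Context: An almost contact metric manifold $(\bar M,\varphi,\xi,\eta,g)$ is an odd-dimensional smooth manifold with a $(1,1)$-tensor $\varphi$, a vector field $\xi$, a 1-form $\eta$ and a Riemannian metric $g$ such that $\varphi^2=-I+\eta\otimes\xi$, $\varphi\xi=0$, $\eta\circ\varphi=0$, $\eta(\xi)=1$, $g(\varphi X,\varphi Y)=g(X,Y)-\eta(X)\eta(Y)$, $\eta(X)=g(X,\xi)$. It is cosymplectic if $\bar\nabla\varphi=0$, where $\bar\nabla$ is the Levi-Civita connection of $g$; then also $\bar\nabla\xi=0$. Let $M$ be a Riemannian manifold isometrically immersed in $\bar M$ (induced metric also denoted $g$). The induced connection $\nabla$ and the second fundamental form $h$ are given by $\bar\nabla_XY=\nabla_XY+h(X,Y)$ for $X,Y\in\Gamma(TM)$. $M$ is a quasi bi-slant submanifold if $\xi$ is tangent to $M$ and there is an orthogonal decomposition $TM=\mathcal{D}\oplus\mathcal{D}_1\oplus\mathcal{D}_2\oplus\langle\xi\rangle$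 into distributions such that: $\varphi\mathcal{D}=\mathcal{D}$ ($\mathcal{D}$ is invariant); $\varphi\mathcal{D}_1\perp\mathcal{D}_2$ and $\varphi\mathcal{D}_2\perp\mathcal{D}_1$; and for $i=1,2$ the distribution $\mathcal{D}_i$ is slant with slant angle $\theta_i$, i.e. for every $p\in M$ and every nonzero $X\in(\mathcal{D}_i)_p$ the angle between $\varphi X$ and $(\mathcal{D}_i)_p$ equals the constant $\theta_i$. It is proper if $\mathcal{D},\mathcal{D}_1,\mathcal{D}_2$ all have nonzero rank and $\theta_1,\theta_2\notin\{0,\frac{\pi}{2}\}$. $\mathcal{P},\mathcal{Q},\mathcal{R}$ denote the orthogonal projections of $TM$ onto $\mathcal{D},\mathcal{D}_1,\mathcal{D}_2$. For $X\in\Gamma(TM)$ write $\varphi X=\mathcal{T}X+\mathcal{F}X$ with $\mathcal{T}X$ tangent and $\mathcal{F}X$ normal to $M$. *)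

theory Defs
  imports "HOL-Analysis.Analysis" "HOL-Library.Function_Algebras"
begin

section \<open>Pointwise real vector space structure on functions\<close>

instantiation "fun" :: (type, scaleR) scaleR
begin
definition "scaleR_fun r f = (\<lambda>x. r *\<^sub>R f x)"
instance ..
end

lemma scaleR_fun_apply [simp]: "(r *\<^sub>R f) x = r *\<^sub>R f x"
  by (simp add: scaleR_fun_def)

instance "fun" :: (type, real_vector) real_vector
  by standard (simp_all add: fun_eq_iff scaleR_add_right scaleR_add_left)

text \<open>Linearity of a map on a linear subspace of its domain type.\<close>

definition linear_on_subspace ::
    "'v::real_vector set \<Rightarrow> ('v \<Rightarrow> 'w::real_vector) \<Rightarrow> bool" where
  "linear_on_subspace S L \<longleftrightarrow>
     (\<forall>v\<in>S. \<forall>w\<in>S. L (v + w) = L v + L w) \<and> (\<forall>r. \<forall>v\<in>S. L (r *\<^sub>R v) = r *\<^sub>R L v)"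


section \<open>Smooth manifolds\<close>

text \<open>\<open>C_k_on\<close> and \<open>smooth_on\<close> are used on open sets only, so derivatives are full derivatives.\<close>

primrec C_k_on ::
    "nat \<Rightarrow> ('e::euclidean_space \<Rightarrow> 'b::real_normed_vector) \<Rightarrow> 'e set \<Rightarrow> bool" where
  "C_k_on 0 f S \<longleftrightarrow> continuous_on S f"
| "C_k_on (Suc k) f S \<longleftrightarrow> (\<forall>x\<in>S. f differentiable (at x)) \<and>
     (\<forall>v. C_k_on k (\<lambda>x. frechet_derivative f (at x) v) S)"

definition smooth_on ::
    "'e::euclidean_space set \<Rightarrow> ('e \<Rightarrow> 'b::real_normed_vector) \<Rightarrow> bool" where
  "smooth_on S f \<longleftrightarrow> (\<forall>k. C_k_on k f S)"

text \<open>A manifold is a whole Hausdorff second countable type with an atlas, not necessarily maximal.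
  A chart is a pair of its domain and its coordinate map; the dimension is \<open>DIM('e)\<close>.\<close>

type_synonym ('a, 'e) chart = "'a set \<times> ('a \<Rightarrow> 'e)"

definition is_chart :: "('a::topological_space, 'e::euclidean_space) chart \<Rightarrow> bool" where
  "is_chart K \<longleftrightarrow> (case K of (U, c) \<Rightarrow>
     open U \<and> open (c ` U) \<and> homeomorphism U (c ` U) c (inv_into U c))"

definition smooth_manifold ::
    "('a::{t2_space, second_countable_topology}, 'e::euclidean_space) chart set \<Rightarrow> bool" where
  "smooth_manifold A \<longleftrightarrow>
     (\<forall>K\<in>A. is_chart K) \<and> \<Union> (fst ` A) = UNIV \<and>
     (\<forall>(U, c)\<in>A. \<forall>(V, d)\<in>A. smooth_on (c ` (U \<inter> V)) (d \<circ> inv_into U c))"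

text \<open>Functions on an open set \<open>W\<close> are total functions whose values outside \<open>W\<close> are irrelevant.\<close>

definition smooth_fun ::
    "('a::topological_space, 'e::euclidean_space) chart set \<Rightarrow> 'a set \<Rightarrow> ('a \<Rightarrow> real) \<Rightarrow> bool" where
  "smooth_fun A W f \<longleftrightarrow> (\<forall>(U, c)\<in>A. smooth_on (c ` (U \<inter> W)) (f \<circ> inv_into U c))"

definition smooth_near ::
    "('a::topological_space, 'e::euclidean_space) chart set \<Rightarrow> 'a \<Rightarrow> ('a \<Rightarrow> real) \<Rightarrow> bool" where
  "smooth_near A p f \<longleftrightarrow> (\<exists>W. open W \<and> p \<in> W \<and> smooth_fun A W f)"

definition smooth_map ::
    "('a::topological_space, 'e::euclidean_space) chart set \<Rightarrow>
     ('b::topological_space, 'd::euclidean_space) chart set \<Rightarrow> ('a \<Rightarrow> 'b) \<Rightarrow> bool" where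
  "smooth_map A B f \<longleftrightarrow> continuous_on UNIV f \<and>
     (\<forall>(U, c)\<in>A. \<forall>(V, d)\<in>B. smooth_on (c ` (U \<inter> f -` V)) (d \<circ> f \<circ> inv_into U c))"


section \<open>Tangent vectors and vector fields\<close>

text \<open>A tangent vector at \<open>p\<close> is a derivation on germs at \<open>p\<close> of smooth functions. The value on
  functions that are not smooth near \<open>p\<close> is fixed to \<open>0\<close>, so that equality of tangent
  vectors is equality of HOL functions.\<close>

type_synonym 'a tvec = "('a \<Rightarrow> real) \<Rightarrow> real"

type_synonym 'a field = "'a \<Rightarrow> 'a tvec"

definition tangent_space ::
    "('a::topological_space, 'e::euclidean_space) chart set \<Rightarrow> 'a \<Rightarrow> 'a tvec set" where
  "tangent_space A p = {v.
     (\<forall>f g. smooth_near A p f \<and> smooth_near A p g \<longrightarrow>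
        v (\<lambda>x. f x + g x) = v f + v g \<and> v (\<lambda>x. f x * g x) = v f * g p + f p * v g) \<and>
     (\<forall>f r. smooth_near A p f \<longrightarrow> v (\<lambda>x. r * f x) = r * v f) \<and>
     (\<forall>f g. smooth_near A p f \<and> (\<forall>\<^sub>F x in nhds p. f x = g x) \<longrightarrow> v f = v g) \<and>
     (\<forall>f. \<not> smooth_near A p f \<longrightarrow> v f = 0)}"

definition vector_field ::
    "('a::topological_space, 'e::euclidean_space) chart set \<Rightarrow> 'a set \<Rightarrow> 'a field \<Rightarrow> bool" where
  "vector_field A W X \<longleftrightarrow> (\<forall>p\<in>W. X p \<in> tangent_space A p) \<and>
     (\<forall>V f. open V \<and> V \<subseteq> W \<and> smooth_fun A V f \<longrightarrow> smooth_fun A V (\<lambda>p. X p f))"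

definition lie_bracket ::
    "('a::topological_space, 'e::euclidean_space) chart set \<Rightarrow> 'a field \<Rightarrow> 'a field \<Rightarrow> 'a field" where
  "lie_bracket A X Y p = (\<lambda>f. if smooth_near A p f
     then X p (\<lambda>q. Y q f) - Y p (\<lambda>q. X q f) else 0)"

definition coord_field ::
    "('a::topological_space, 'e::euclidean_space) chart set \<Rightarrow> ('a, 'e) chart \<Rightarrow> 'e \<Rightarrow> 'a field" where
  "coord_field A K b p = (\<lambda>f. if smooth_near A p f
     then frechet_derivative (f \<circ> inv_into (fst K) (snd K)) (at (snd K p)) b else 0)"

definition differential ::
    "('b::topological_space, 'd::euclidean_space) chart set \<Rightarrow> ('a \<Rightarrow> 'b) \<Rightarrow> 'a \<Rightarrow> 'a tvec \<Rightarrow> 'b tvec" where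
  "differential B f p v = (\<lambda>h. if smooth_near B (f p) h then v (h \<circ> f) else 0)"


section \<open>Riemannian metrics and the Levi-Civita connection\<close>

type_synonym 'a metric = "'a \<Rightarrow> 'a tvec \<Rightarrow> 'a tvec \<Rightarrow> real"

definition riemannian_metric ::
    "('a::topological_space, 'e::euclidean_space) chart set \<Rightarrow> 'a metric \<Rightarrow> bool" where
  "riemannian_metric A g \<longleftrightarrow>
     (\<forall>p. \<forall>v\<in>tangent_space A p.
        linear_on_subspace (tangent_space A p) (g p v) \<and>
        (\<forall>w\<in>tangent_space A p. g p v w = g p w v) \<and>
        (v \<noteq> 0 \<longrightarrow> g p v v > 0)) \<and>
     (\<forall>W X Y. open W \<and> vector_field A W X \<and> vector_field A W Y \<longrightarrow>
        smooth_fun A W (\<lambda>p. g p (X p) (Y p)))"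

text \<open>A connection is applied to a tangent vector \<open>v\<close> at \<open>p\<close> and to a vector field that is smooth
  on an open neighbourhood of \<open>p\<close>, so \<open>(\<nabla>\<^sub>X Y)\<^sub>p = nab p (X p) Y\<close>.\<close>

type_synonym 'a connection = "'a \<Rightarrow> 'a tvec \<Rightarrow> 'a field \<Rightarrow> 'a tvec"

definition affine_connection ::
    "('a::topological_space, 'e::euclidean_space) chart set \<Rightarrow> 'a connection \<Rightarrow> bool" where
  "affine_connection A nab \<longleftrightarrow>
     (\<forall>W Y. open W \<and> vector_field A W Y \<longrightarrow>
        (\<forall>X. vector_field A W X \<longrightarrow> vector_field A W (\<lambda>p. nab p (X p) Y)) \<and>
        (\<forall>p\<in>W. linear_on_subspace (tangent_space A p) (\<lambda>v. nab p v Y) \<and>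
           (\<forall>v\<in>tangent_space A p.
              nab p v Y \<in> tangent_space A p \<and>
              (\<forall>Z. vector_field A W Z \<longrightarrow> nab p v (Y + Z) = nab p v Y + nab p v Z) \<and>
              (\<forall>f. smooth_fun A W f \<longrightarrow>
                 nab p v (\<lambda>q. f q *\<^sub>R Y q) = v f *\<^sub>R Y p + f p *\<^sub>R nab p v Y) \<and>
              (\<forall>Z. (\<forall>\<^sub>F q in nhds p. Y q = Z q) \<longrightarrow> nab p v Y = nab p v Z))))"

definition levi_civita ::
    "('a::topological_space, 'e::euclidean_space) chart set \<Rightarrow> 'a metric \<Rightarrow> 'a connection \<Rightarrow> bool" where
  "levi_civita A g nab \<longleftrightarrow> affine_connection A nab \<and>
     (\<forall>W X Y. open W \<and> vector_field A W X \<and> vector_field A W Y \<longrightarrow>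
        (\<forall>p\<in>W. nab p (X p) Y - nab p (Y p) X = lie_bracket A X Y p)) \<and>
     (\<forall>W Y Z. open W \<and> vector_field A W Y \<and> vector_field A W Z \<longrightarrow>
        (\<forall>p\<in>W. \<forall>v\<in>tangent_space A p.
           v (\<lambda>q. g q (Y q) (Z q)) = g p (nab p v Y) (Z p) + g p (Y p) (nab p v Z)))"


section \<open>Cosymplectic manifolds\<close>

text \<open>A \<open>(1,1)\<close>-tensor and a 1-form are smooth when they take smooth local vector fields to smooth
  local vector fields and functions.\<close>

definition endo_tensor ::
    "('a::topological_space, 'e::euclidean_space) chart set \<Rightarrow> ('a \<Rightarrow> 'a tvec \<Rightarrow> 'a tvec) \<Rightarrow> bool" where
  "endo_tensor A \<phi> \<longleftrightarrow>
     (\<forall>p. linear_on_subspace (tangent_space A p) (\<phi> p) \<and>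
          \<phi> p ` tangent_space A p \<subseteq> tangent_space A p) \<and>
     (\<forall>W X. open W \<and> vector_field A W X \<longrightarrow> vector_field A W (\<lambda>p. \<phi> p (X p)))"

definition one_form ::
    "('a::topological_space, 'e::euclidean_space) chart set \<Rightarrow> ('a \<Rightarrow> 'a tvec \<Rightarrow> real) \<Rightarrow> bool" where
  "one_form A \<eta> \<longleftrightarrow>
     (\<forall>p. linear_on_subspace (tangent_space A p) (\<eta> p)) \<and>
     (\<forall>W X. open W \<and> vector_field A W X \<longrightarrow> smooth_fun A W (\<lambda>p. \<eta> p (X p)))"

definition almost_contact_metric_manifold ::
    "('a::{t2_space, second_countable_topology}, 'e::euclidean_space) chart set \<Rightarrow>
     ('a \<Rightarrow> 'a tvec \<Rightarrow> 'a tvec) \<Rightarrow> 'a field \<Rightarrow> ('a \<Rightarrow> 'a tvec \<Rightarrow> real) \<Rightarrow> 'a metric \<Rightarrow> bool" where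
  "almost_contact_metric_manifold A \<phi> \<xi> \<eta> g \<longleftrightarrow>
     smooth_manifold A \<and> odd DIM('e) \<and>
     endo_tensor A \<phi> \<and> vector_field A UNIV \<xi> \<and> one_form A \<eta> \<and> riemannian_metric A g \<and>
     (\<forall>p. \<phi> p (\<xi> p) = 0 \<and> \<eta> p (\<xi> p) = 1 \<and>
        (\<forall>v\<in>tangent_space A p.
           \<phi> p (\<phi> p v) = - v + \<eta> p v *\<^sub>R \<xi> p \<and>
           \<eta> p (\<phi> p v) = 0 \<and>
           \<eta> p v = g p v (\<xi> p) \<and>
           (\<forall>w\<in>tangent_space A p. g p (\<phi> p v) (\<phi> p w) = g p v w - \<eta> p v * \<eta> p w)))"

text \<open>The last condition is \<open>(\<nabla>\<^sub>v \<phi>) Y = \<nabla>\<^sub>v (\<phi> Y) - \<phi> (\<nabla>\<^sub>v Y) = 0\<close>.\<close>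

definition cosymplectic_manifold ::
    "('a::{t2_space, second_countable_topology}, 'e::euclidean_space) chart set \<Rightarrow>
     ('a \<Rightarrow> 'a tvec \<Rightarrow> 'a tvec) \<Rightarrow> 'a field \<Rightarrow> ('a \<Rightarrow> 'a tvec \<Rightarrow> real) \<Rightarrow> 'a metric \<Rightarrow>
     'a connection \<Rightarrow> bool" where
  "cosymplectic_manifold A \<phi> \<xi> \<eta> g nab \<longleftrightarrow>
     almost_contact_metric_manifold A \<phi> \<xi> \<eta> g \<and> levi_civita A g nab \<and>
     (\<forall>W Y. open W \<and> vector_field A W Y \<longrightarrow>
        (\<forall>p\<in>W. \<forall>v\<in>tangent_space A p. nab p v (\<lambda>q. \<phi> q (Y q)) = \<phi> p (nab p v Y)))"


section \<open>Isometric immersions and the Gauss formula\<close>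

text \<open>The submanifold has atlas \<open>A\<close> and metric \<open>gM\<close>, the ambient manifold has atlas \<open>B\<close> and
  metric \<open>g\<close>.\<close>

definition isometric_immersion ::
    "('a::topological_space, 'e::euclidean_space) chart set \<Rightarrow> 'a metric \<Rightarrow>
     ('b::topological_space, 'd::euclidean_space) chart set \<Rightarrow> 'b metric \<Rightarrow> ('a \<Rightarrow> 'b) \<Rightarrow> bool" where
  "isometric_immersion A gM B g f \<longleftrightarrow> smooth_map A B f \<and>
     (\<forall>p. inj_on (differential B f p) (tangent_space A p) \<and>
        (\<forall>v\<in>tangent_space A p. \<forall>w\<in>tangent_space A p.
           gM p v w = g (f p) (differential B f p v) (differential B f p w)))"

definition normal_space ::
    "('a::topological_space, 'e::euclidean_space) chart set \<Rightarrow>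
     ('b::topological_space, 'd::euclidean_space) chart set \<Rightarrow> 'b metric \<Rightarrow> ('a \<Rightarrow> 'b) \<Rightarrow>
     'a \<Rightarrow> 'b tvec set" where
  "normal_space A B g f p = {w \<in> tangent_space B (f p).
     \<forall>v\<in>tangent_space A p. g (f p) w (differential B f p v) = 0}"

definition tan_part ::
    "('a::topological_space, 'e::euclidean_space) chart set \<Rightarrow>
     ('b::topological_space, 'd::euclidean_space) chart set \<Rightarrow> 'b metric \<Rightarrow> ('a \<Rightarrow> 'b) \<Rightarrow>
     'a \<Rightarrow> 'b tvec \<Rightarrow> 'a tvec" where
  "tan_part A B g f p w =
     (THE v. v \<in> tangent_space A p \<and> w - differential B f p v \<in> normal_space A B g f p)"

definition nor_part ::
    "('a::topological_space, 'e::euclidean_space) chart set \<Rightarrow>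
     ('b::topological_space, 'd::euclidean_space) chart set \<Rightarrow> 'b metric \<Rightarrow> ('a \<Rightarrow> 'b) \<Rightarrow>
     'a \<Rightarrow> 'b tvec \<Rightarrow> 'b tvec" where
  "nor_part A B g f p w = w - differential B f p (tan_part A B g f p w)"

text \<open>The ambient connection acts on sections \<open>V\<close> of the pulled back tangent bundle, that is, on
  vector fields along \<open>f\<close>. Near \<open>p\<close> such a section is \<open>\<Sum>\<^sub>b V\<^sup>b (\<partial>\<^sub>b \<circ> f)\<close> in a chart of the ambient
  manifold, with \<open>V\<^sup>b = V (y\<^sup>b)\<close> for the coordinate functions \<open>y\<^sup>b\<close>. The Leibniz rule gives
  \<open>\<Sum>\<^sub>b v(V\<^sup>b) \<partial>\<^sub>b + V\<^sup>b \<nabla>\<^bsub>df v\<^esub> \<partial>\<^sub>b\<close>, which does not depend on the chart and equals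
  \<open>\<nabla>\<^bsub>df v\<^esub> Y\<close> for every local extension \<open>Y\<close> of \<open>V\<close>.\<close>

definition connection_along ::
    "('b::topological_space, 'd::euclidean_space) chart set \<Rightarrow> 'b connection \<Rightarrow> ('a \<Rightarrow> 'b) \<Rightarrow>
     'a \<Rightarrow> 'a tvec \<Rightarrow> ('a \<Rightarrow> 'b tvec) \<Rightarrow> 'b tvec" where
  "connection_along B nab f p v V =
     (let K = (SOME K. K \<in> B \<and> f p \<in> fst K); y = (\<lambda>b x. snd K x \<bullet> b) in
      \<Sum>b\<in>Basis. v (\<lambda>q. V q (y b)) *\<^sub>R coord_field B K b (f p) +
        V p (y b) *\<^sub>R nab (f p) (differential B f p v) (coord_field B K b))"

definition induced_connection ::
    "('a::topological_space, 'e::euclidean_space) chart set \<Rightarrow>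
     ('b::topological_space, 'd::euclidean_space) chart set \<Rightarrow> 'b metric \<Rightarrow> 'b connection \<Rightarrow>
     ('a \<Rightarrow> 'b) \<Rightarrow> 'a field \<Rightarrow> 'a field \<Rightarrow> 'a field" where
  "induced_connection A B g nab f X Y p =
     tan_part A B g f p (connection_along B nab f p (X p) (\<lambda>q. differential B f q (Y q)))"

definition second_fundamental_form ::
    "('a::topological_space, 'e::euclidean_space) chart set \<Rightarrow>
     ('b::topological_space, 'd::euclidean_space) chart set \<Rightarrow> 'b metric \<Rightarrow> 'b connection \<Rightarrow>
     ('a \<Rightarrow> 'b) \<Rightarrow> 'a field \<Rightarrow> 'a field \<Rightarrow> 'a \<Rightarrow> 'b tvec" where
  "second_fundamental_form A B g nab f X Y p =
     nor_part A B g f p (connection_along B nab f p (X p) (\<lambda>q. differential B f q (Y q)))"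

text \<open>The tangential part \<open>\<T>\<close> of \<open>\<phi>\<close> in \<open>\<phi> X = \<T> X + \<F> X\<close>.\<close>

definition T_tensor ::
    "('a::topological_space, 'e::euclidean_space) chart set \<Rightarrow>
     ('b::topological_space, 'd::euclidean_space) chart set \<Rightarrow> 'b metric \<Rightarrow>
     ('b \<Rightarrow> 'b tvec \<Rightarrow> 'b tvec) \<Rightarrow> ('a \<Rightarrow> 'b) \<Rightarrow> 'a \<Rightarrow> 'a tvec \<Rightarrow> 'a tvec" where
  "T_tensor A B g \<phi> f p v = tan_part A B g f p (\<phi> (f p) (differential B f p v))"


section \<open>Distributions\<close>

definition distribution ::
    "('a::topological_space, 'e::euclidean_space) chart set \<Rightarrow> nat \<Rightarrow> ('a \<Rightarrow> 'a tvec set) \<Rightarrow> bool" where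
  "distribution A k D \<longleftrightarrow>
     (\<forall>p. \<exists>W X. open W \<and> p \<in> W \<and> (\<forall>i<k. vector_field A W (X i)) \<and>
        (\<forall>q\<in>W. inj_on (\<lambda>i. X i q) {..<k} \<and> independent ((\<lambda>i. X i q) ` {..<k}) \<and>
           D q = span ((\<lambda>i. X i q) ` {..<k})))"

definition sections ::
    "('a::topological_space, 'e::euclidean_space) chart set \<Rightarrow> ('a \<Rightarrow> 'a tvec set) \<Rightarrow> 'a field set" where
  "sections A D = {X. vector_field A UNIV X \<and> (\<forall>p. X p \<in> D p)}"

text \<open>Integrability is meant in the sense of Frobenius: the sections of the distribution are closed
  under the Lie bracket.\<close>

definition integrable_distribution ::
    "('a::topological_space, 'e::euclidean_space) chart set \<Rightarrow> ('a \<Rightarrow> 'a tvec set) \<Rightarrow> bool" where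
  "integrable_distribution A D \<longleftrightarrow>
     (\<forall>X\<in>sections A D. \<forall>Y\<in>sections A D. lie_bracket A X Y \<in> sections A D)"

definition sum_distribution ::
    "('a \<Rightarrow> 'a tvec set) \<Rightarrow> ('a \<Rightarrow> 'a tvec set) \<Rightarrow> 'a \<Rightarrow> 'a tvec set" where
  "sum_distribution D E p = {u + w | u w. u \<in> D p \<and> w \<in> E p}"

definition orth_proj :: "'a metric \<Rightarrow> ('a \<Rightarrow> 'a tvec set) \<Rightarrow> 'a \<Rightarrow> 'a tvec \<Rightarrow> 'a tvec" where
  "orth_proj g D p v = (THE w. w \<in> D p \<and> (\<forall>u\<in>D p. g p (v - w) u = 0))"

definition orthogonal_distributions ::
    "'a metric \<Rightarrow> ('a \<Rightarrow> 'a tvec set) \<Rightarrow> ('a \<Rightarrow> 'a tvec set) \<Rightarrow> bool" where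
  "orthogonal_distributions g D E \<longleftrightarrow> (\<forall>p. \<forall>u\<in>D p. \<forall>w\<in>E p. g p u w = 0)"


section \<open>Quasi bi-slant submanifolds\<close>

definition vec_angle :: "('v \<Rightarrow> 'v \<Rightarrow> real) \<Rightarrow> 'v \<Rightarrow> 'v \<Rightarrow> real" where
  "vec_angle ip u w = arccos (ip u w / (sqrt (ip u u) * sqrt (ip w w)))"

definition subspace_angle :: "('v::real_vector \<Rightarrow> 'v \<Rightarrow> real) \<Rightarrow> 'v \<Rightarrow> 'v set \<Rightarrow> real" where
  "subspace_angle ip u S = Inf (vec_angle ip u ` (S - {0}))"

definition slant_distribution ::
    "('b::topological_space, 'd::euclidean_space) chart set \<Rightarrow> 'b metric \<Rightarrow>
     ('b \<Rightarrow> 'b tvec \<Rightarrow> 'b tvec) \<Rightarrow> ('a \<Rightarrow> 'b) \<Rightarrow> ('a \<Rightarrow> 'a tvec set) \<Rightarrow> real \<Rightarrow> bool" where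
  "slant_distribution B g \<phi> f D \<theta> \<longleftrightarrow>
     (\<forall>p. \<forall>v\<in>D p - {0}. subspace_angle (g (f p))
        (\<phi> (f p) (differential B f p v)) (differential B f p ` D p) = \<theta>)"

text \<open>The vector field of the submanifold that \<open>df\<close> takes to a tangent \<open>\<xi>\<close> is \<open>tan_part\<close> of \<open>\<xi>\<close>.\<close>

definition quasi_bi_slant ::
    "('a::{t2_space, second_countable_topology}, 'e::euclidean_space) chart set \<Rightarrow> 'a metric \<Rightarrow>
     ('b::{t2_space, second_countable_topology}, 'd::euclidean_space) chart set \<Rightarrow>
     ('b \<Rightarrow> 'b tvec \<Rightarrow> 'b tvec) \<Rightarrow> 'b field \<Rightarrow> 'b metric \<Rightarrow> ('a \<Rightarrow> 'b) \<Rightarrow>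
     ('a \<Rightarrow> 'a tvec set) \<Rightarrow> ('a \<Rightarrow> 'a tvec set) \<Rightarrow> ('a \<Rightarrow> 'a tvec set) \<Rightarrow>
     real \<Rightarrow> real \<Rightarrow> bool" where
  "quasi_bi_slant A gM B \<phi> \<xi> g f D D1 D2 \<theta>1 \<theta>2 \<longleftrightarrow>
     smooth_manifold A \<and> riemannian_metric A gM \<and> isometric_immersion A gM B g f \<and>
     (\<forall>p. \<xi> (f p) \<in> differential B f p ` tangent_space A p) \<and>
     (\<exists>k. distribution A k D) \<and> (\<exists>k. distribution A k D1) \<and> (\<exists>k. distribution A k D2) \<and>
     (let \<Xi> = (\<lambda>p. span {tan_part A B g f p (\<xi> (f p))}) in
        orthogonal_distributions gM D D1 \<and> orthogonal_distributions gM D D2 \<and>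
        orthogonal_distributions gM D1 D2 \<and> orthogonal_distributions gM D \<Xi> \<and>
        orthogonal_distributions gM D1 \<Xi> \<and> orthogonal_distributions gM D2 \<Xi> \<and>
        (\<forall>p. tangent_space A p =
           {a + b + c + d | a b c d. a \<in> D p \<and> b \<in> D1 p \<and> c \<in> D2 p \<and> d \<in> \<Xi> p})) \<and>
     (\<forall>p. \<phi> (f p) ` (differential B f p ` D p) = differential B f p ` D p) \<and>
     (\<forall>p. \<forall>u\<in>D1 p. \<forall>w\<in>D2 p.
        g (f p) (\<phi> (f p) (differential B f p u)) (differential B f p w) = 0 \<and>
        g (f p) (\<phi> (f p) (differential B f p w)) (differential B f p u) = 0) \<and>
     slant_distribution B g \<phi> f D1 \<theta>1 \<and> slant_distribution B g \<phi> f D2 \<theta>2"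

definition proper_quasi_bi_slant ::
    "('a::{t2_space, second_countable_topology}, 'e::euclidean_space) chart set \<Rightarrow> 'a metric \<Rightarrow>
     ('b::{t2_space, second_countable_topology}, 'd::euclidean_space) chart set \<Rightarrow>
     ('b \<Rightarrow> 'b tvec \<Rightarrow> 'b tvec) \<Rightarrow> 'b field \<Rightarrow> 'b metric \<Rightarrow> ('a \<Rightarrow> 'b) \<Rightarrow>
     ('a \<Rightarrow> 'a tvec set) \<Rightarrow> ('a \<Rightarrow> 'a tvec set) \<Rightarrow> ('a \<Rightarrow> 'a tvec set) \<Rightarrow>
     real \<Rightarrow> real \<Rightarrow> bool" where
  "proper_quasi_bi_slant A gM B \<phi> \<xi> g f D D1 D2 \<theta>1 \<theta>2 \<longleftrightarrow>
     quasi_bi_slant A gM B \<phi> \<xi> g f D D1 D2 \<theta>1 \<theta>2 \<and>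
     (\<forall>E\<in>{D, D1, D2}. \<exists>k>0. distribution A k E) \<and>
     \<theta>1 \<notin> {0, pi / 2} \<and> \<theta>2 \<notin> {0, pi / 2}"

end

theory Submission
  imports Defs
begin

text \<open>Write \<open>L X V\<close> for the ambient derivative of a field \<open>V\<close> along \<open>f\<close> and \<open>B = [X, Y]\<close> for
  sections \<open>X, Y\<close> of \<open>D\<close>. Since \<open>\<phi>\<close> is parallel and \<open>\<T> = \<phi>\<close> on \<open>D\<close>, torsion freeness gives
  \<open>L X (\<T> Y) - L Y (\<T> X) = \<phi> (L X Y - L Y X) = \<phi> B\<close>, whose tangential and normal parts are
  \<open>\<nabla>\<^sub>X \<T> Y - \<nabla>\<^sub>Y \<T> X\<close> and \<open>h(X, \<T> Y) - h(Y, \<T> X)\<close>. As \<open>\<phi>\<close> is skew, the difference of the two sides of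
  the condition is \<open>- g(\<phi> B, \<phi> Z) = - g(B, Z)\<close>. So the condition says that \<open>B\<close> is orthogonal to
  \<open>D1\<close> and \<open>D2\<close>; it is always orthogonal to \<open>\<xi>\<close>. Tangent vectors being derivations on germs,
  Hadamard's lemma is what makes the coordinate fields span each tangent space.\<close>

section \<open>Differential calculus and Hadamard's lemma\<close>

text \<open>Three obstacles shape the proof. \<open>connection_along\<close> is a coordinate formula
  for fields that live only along \<open>f\<close>, whereas parallelism and vanishing torsion are
  given for fields on open sets of the ambient manifold; both are carried over by expanding in the
  coordinate frame of one chart. Next, sections are global, so orthogonality to \<open>D1\<close>
  and \<open>D2\<close> can be tested only against global smooth fields; the test field comes from
  projecting the bracket itself, which is why orthogonal projection to a distribution has to be
  shown smooth. Finally, the definition speaks of \<phi> alone, so the derivative of \<xi> is never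
  at hand and its contribution has to be eliminated through \<phi>. In the condition, let
  \<open>u\<close> be the tangential part of \<open>\<phi> B\<close>. Both sides contain
  \<open>- g (df u) (\<phi> Z)\<close>: the left by skewness of \<phi>, the right because the
  difference of the \<open>h\<close>-terms is \<open>\<phi> B - df u\<close>. This common term
  cancels, and \<open>g (\<phi> B) (\<phi> Z)\<close> reduces to \<open>g B Z\<close> because \<eta>
  vanishes on the bracket.\<close>

lemma C_k_on_cong:
  assumes "open S" "\<And>x. x \<in> S \<Longrightarrow> f x = g x" "C_k_on k f S"
  shows "C_k_on k g S"
  using assms(2,3)
proof (induction k arbitrary: f g)
  case 0
  then show ?case by (metis C_k_on.simps(1) continuous_on_cong)
next
  case (Suc k)
  have ev: "\<forall>\<^sub>F y in nhds x. f y = g y" if "x \<in> S" for x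
    using eventually_nhds assms(1) that Suc.prems(1) by blast
  have d: "(g has_derivative frechet_derivative f (at x)) (at x)" if "x \<in> S" for x
  proof -
    have "(f has_derivative frechet_derivative f (at x)) (at x)"
      using Suc.prems(2) that by (simp add: frechet_derivative_works)
    then show ?thesis
      using has_derivative_transform_within_open[OF _ assms(1) that] Suc.prems(1) by blast
  qed
  have e: "frechet_derivative g (at x) = frechet_derivative f (at x)" if "x \<in> S" for x
    using frechet_derivative_at[OF d[OF that]] by simp
  have "C_k_on k (\<lambda>x. frechet_derivative g (at x) v) S" for v
    using Suc.IH[of "\<lambda>x. frechet_derivative f (at x) v" "\<lambda>x. frechet_derivative g (at x) v"] Suc.prems(2) e
    by simp
  moreover have "g differentiable at x" if "x \<in> S" for x
    using d[OF that] differentiableI by blast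
  ultimately show ?case by simp
qed

lemma C_k_on_subset: "C_k_on k f S \<Longrightarrow> T \<subseteq> S \<Longrightarrow> C_k_on k f T"
  by (induction k arbitrary: f) (auto intro: continuous_on_subset)

lemma C_k_on_Suc_D: "C_k_on (Suc k) f S \<Longrightarrow> C_k_on k f S"
proof (induction k arbitrary: f)
  case 0
  then show ?case
    by (auto intro!: continuous_at_imp_continuous_on differentiable_imp_continuous_within)
next
  case (Suc k)
  then show ?case by (metis C_k_on.simps(2))
qed

lemma C_k_on_continuous: "C_k_on k f S \<Longrightarrow> continuous_on S f"
proof (induction k)
  case (Suc k)
  then show ?case using C_k_on_Suc_D by blast
qed simp

text \<open>Lets an explicit derivative formula stand in for the \<open>frechet_derivative\<close>
  of the definition, so that the closure properties become inductions over the usual rules of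
  differentiation.\<close>

lemma C_k_on_SucI:
  assumes "open S" "\<And>x. x \<in> S \<Longrightarrow> (f has_derivative f' x) (at x)" "\<And>v. C_k_on k (\<lambda>x. f' x v) S"
  shows "C_k_on (Suc k) f S"
proof -
  have "frechet_derivative f (at x) = f' x" if "x \<in> S" for x
    using frechet_derivative_at[OF assms(2)[OF that]] by simp
  then have "C_k_on k (\<lambda>x. frechet_derivative f (at x) v) S" for v
    by (intro C_k_on_cong[OF assms(1) _ assms(3)[of v]]) simp
  then show ?thesis using assms(2) by (auto simp: differentiable_def)
qed

lemma C_k_on_Suc_derivative:
  "C_k_on (Suc k) f S \<Longrightarrow> x \<in> S \<Longrightarrow> (f has_derivative frechet_derivative f (at x)) (at x)"
  by (simp add: frechet_derivative_works)

text \<open>Derivatives are full derivatives at a point and hence local by themselves; only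
  continuity, the base case, is relative to a set, and there openness turns it into continuity at
  each point.\<close>

lemma C_k_on_local:
  assumes "\<And>x. x \<in> S \<Longrightarrow> \<exists>T. open T \<and> x \<in> T \<and> C_k_on k f (T \<inter> S)" "open S"
  shows "C_k_on k f S"
  using assms(1)
proof (induction k arbitrary: f)
  case 0
  have "isCont f x" if "x \<in> S" for x
    using 0[OF that] assms(2) that continuous_on_eq_continuous_at
    by (metis C_k_on.simps(1) IntI open_Int)
  then show ?case by (simp add: continuous_at_imp_continuous_on)
next
  case (Suc k)
  have "C_k_on k (\<lambda>x. frechet_derivative f (at x) v) S" for v
    by (intro Suc.IH) (use Suc.prems in \<open>auto; blast\<close>)
  then show ?case using Suc.prems by auto
qed

lemma C_k_on_const: "open S \<Longrightarrow> C_k_on k (\<lambda>x. c) S"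
proof (induction k arbitrary: c)
  case (Suc k)
  then show ?case by (intro C_k_on_SucI[where f' = "\<lambda>x v. 0"]) (auto intro!: derivative_eq_intros)
qed simp

lemma C_k_on_bounded_linear: "open S \<Longrightarrow> bounded_linear f \<Longrightarrow> C_k_on k f S"
proof (cases k)
  case 0
  assume "bounded_linear f"
  then show ?thesis using 0 linear_continuous_on by auto
next
  case (Suc k)
  assume "open S" "bounded_linear f"
  then show ?thesis unfolding Suc
    by (intro C_k_on_SucI[where f' = "\<lambda>x. f"] C_k_on_const bounded_linear_imp_has_derivative)
qed

lemma C_k_on_add:
  "open S \<Longrightarrow> C_k_on k f S \<Longrightarrow> C_k_on k g S \<Longrightarrow> C_k_on k (\<lambda>x. f x + g x) S"
proof (induction k arbitrary: f g)
  case 0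
  then show ?case by (auto intro: continuous_intros)
next
  case (Suc k)
  then show ?case
    by (intro C_k_on_SucI[where f' = "\<lambda>x v. frechet_derivative f (at x) v + frechet_derivative g (at x) v"])
       (auto intro!: has_derivative_add C_k_on_Suc_derivative)
qed

lemma C_k_on_sum:
  assumes "open S" "\<And>i. i \<in> I \<Longrightarrow> C_k_on k (f i) S"
  shows "C_k_on k (\<lambda>x. \<Sum>i\<in>I. f i x) S"
  using assms
  by (induction I rule: infinite_finite_induct) (auto intro: C_k_on_const C_k_on_add)

lemma C_k_on_bilinear:
  assumes "bounded_bilinear B" "open S"
  shows "C_k_on k f S \<Longrightarrow> C_k_on k g S \<Longrightarrow> C_k_on k (\<lambda>x. B (f x) (g x)) S"
proof (induction k arbitrary: f g)
  case 0
  then show ?case using bounded_bilinear.continuous_on[OF assms(1)] by auto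
next
  case (Suc k)
  note C_k_on_Suc_D[OF Suc.prems(1)] C_k_on_Suc_D[OF Suc.prems(2)]
  then show ?case using Suc
    by (intro C_k_on_SucI[OF assms(2),
          where f' = "\<lambda>x v. B (f x) (frechet_derivative g (at x) v) + B (frechet_derivative f (at x) v) (g x)"]
        C_k_on_add[OF assms(2)] bounded_bilinear.FDERIV[OF assms(1)] C_k_on_Suc_derivative Suc.IH) auto
qed

text \<open>\<open>C_k_on\<close> differentiates in fixed directions, but in the chain rule the
  direction \<open>?f' x v\<close> moves with \<open>x\<close>. Expanding it over the basis leaves
  products of scalar functions with derivatives of \<open>g\<close> in fixed directions
  \<open>b\<close>, and these are compositions covered by the induction hypothesis.\<close>

lemma C_k_on_compose:
  fixes f :: "'e::euclidean_space \<Rightarrow> 'd::euclidean_space" and g :: "'d \<Rightarrow> 'c::real_normed_vector"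
  assumes "open S" "open T" "f ` S \<subseteq> T"
  shows "C_k_on k f S \<Longrightarrow> C_k_on k g T \<Longrightarrow> C_k_on k (\<lambda>x. g (f x)) S"
proof (induction k arbitrary: g)
  case 0
  then show ?case using assms(3) by (auto intro: continuous_on_compose2)
next
  case (Suc k)
  let ?f' = "\<lambda>x. frechet_derivative f (at x)" and ?g' = "\<lambda>y. frechet_derivative g (at y)"
  have *: "((\<lambda>x. g (f x)) has_derivative (\<lambda>v. \<Sum>b\<in>Basis. (?f' x v \<bullet> b) *\<^sub>R ?g' (f x) b)) (at x)"
    if "x \<in> S" for x
  proof -
    have f: "(f has_derivative ?f' x) (at x)"
      using C_k_on_Suc_derivative[OF Suc.prems(1) that] .
    have "f x \<in> T" using that assms(3) by auto
    then have g: "(g has_derivative ?g' (f x)) (at (f x))"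
      using C_k_on_Suc_derivative[OF Suc.prems(2)] by blast
    have "?g' (f x) (?f' x v) = (\<Sum>b\<in>Basis. (?f' x v \<bullet> b) *\<^sub>R ?g' (f x) b)" for v
    proof -
      have "?g' (f x) (?f' x v) = ?g' (f x) (\<Sum>b\<in>Basis. (?f' x v \<bullet> b) *\<^sub>R b)"
        by (simp add: euclidean_representation)
      also have "\<dots> = (\<Sum>b\<in>Basis. (?f' x v \<bullet> b) *\<^sub>R ?g' (f x) b)"
        using has_derivative_linear[OF g] by (simp add: linear_sum linear_cmul)
      finally show ?thesis .
    qed
    then show ?thesis
      using has_derivative_compose[OF f g] by (simp add: fun_eq_iff)
  qed
  have "C_k_on k (\<lambda>x. ?f' x v \<bullet> b) S" for v b
    using Suc.prems(1) by (intro C_k_on_bilinear[OF bounded_bilinear_inner assms(1)] C_k_on_const[OF assms(1)]) auto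
  moreover have "C_k_on k (\<lambda>x. ?g' (f x) b) S" for b
    using Suc.prems(2) C_k_on_Suc_D[OF Suc.prems(1)] by (intro Suc.IH) auto
  ultimately show ?case
    by (intro C_k_on_SucI[OF assms(1) *] C_k_on_sum[OF assms(1)]
        C_k_on_bilinear[OF bounded_bilinear_scaleR assms(1)]) auto
qed

text \<open>The derivative \<open>- f' / f^2\<close> contains \<open>f\<close> only through its
  inverse, so the claim of order \<open>k\<close> feeds the claim of order
  \<open>Suc k\<close>.\<close>

lemma C_k_on_inverse:
  fixes f :: "'e::euclidean_space \<Rightarrow> real"
  assumes "open S" "\<And>x. x \<in> S \<Longrightarrow> f x \<noteq> 0"
  shows "C_k_on k f S \<Longrightarrow> C_k_on k (\<lambda>x. inverse (f x)) S"
proof (induction k)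
  case 0
  then show ?case using assms(2) by (auto intro: continuous_intros)
next
  case (Suc k)
  have "C_k_on k (\<lambda>x. inverse (f x)) S"
    using Suc C_k_on_Suc_D by blast
  moreover have "C_k_on k (\<lambda>x. - frechet_derivative f (at x) v) S" for v
    using C_k_on_bilinear[OF bounded_bilinear_mult assms(1), of k "\<lambda>x. - 1" "\<lambda>x. frechet_derivative f (at x) v"] Suc.prems
      C_k_on_const[OF assms(1)] by auto
  ultimately show ?case
    by (intro C_k_on_SucI[OF assms(1), where f' = "\<lambda>x v. - frechet_derivative f (at x) v * (inverse (f x) * inverse (f x))"]
         C_k_on_bilinear[OF bounded_bilinear_mult assms(1)])
       (use assms(2) in \<open>auto intro!: derivative_eq_intros C_k_on_Suc_derivative[OF Suc.prems]\<close>)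
qed

lemma smooth_on_cong: "open S \<Longrightarrow> (\<And>x. x \<in> S \<Longrightarrow> f x = g x) \<Longrightarrow> smooth_on S f \<Longrightarrow> smooth_on S g"
  unfolding smooth_on_def by (blast intro: C_k_on_cong[of S f g])

lemma smooth_on_subset: "smooth_on S f \<Longrightarrow> T \<subseteq> S \<Longrightarrow> smooth_on T f"
  unfolding smooth_on_def using C_k_on_subset by blast

lemma smooth_on_local:
  assumes "open S" "\<And>x. x \<in> S \<Longrightarrow> \<exists>T. open T \<and> x \<in> T \<and> smooth_on (T \<inter> S) f"
  shows "smooth_on S f"
proof -
  have "C_k_on k f S" for k
  proof (rule C_k_on_local[OF _ assms(1)])
    fix x assume "x \<in> S"
    then obtain T where "open T" "x \<in> T" "smooth_on (T \<inter> S) f" using assms(2) by metis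
    then show "\<exists>T. open T \<and> x \<in> T \<and> C_k_on k f (T \<inter> S)"
      unfolding smooth_on_def by (intro exI[of _ T]) simp
  qed
  then show ?thesis by (simp add: smooth_on_def)
qed

lemma smooth_on_const: "open S \<Longrightarrow> smooth_on S (\<lambda>x. c)"
  and smooth_on_bounded_linear: "open S \<Longrightarrow> bounded_linear f \<Longrightarrow> smooth_on S f"
  and smooth_on_add: "open S \<Longrightarrow> smooth_on S f \<Longrightarrow> smooth_on S g \<Longrightarrow> smooth_on S (\<lambda>x. f x + g x)"
  and smooth_on_bilinear: "bounded_bilinear B \<Longrightarrow> open S \<Longrightarrow> smooth_on S f \<Longrightarrow> smooth_on S h \<Longrightarrow> smooth_on S (\<lambda>x. B (f x) (h x))"
  unfolding smooth_on_def
  by (simp_all add: C_k_on_const C_k_on_add C_k_on_bounded_linear C_k_on_bilinear[of B])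

lemma smooth_on_inverse:
  fixes f :: "'e::euclidean_space \<Rightarrow> real"
  shows "open S \<Longrightarrow> (\<And>x. x \<in> S \<Longrightarrow> f x \<noteq> 0) \<Longrightarrow> smooth_on S f \<Longrightarrow> smooth_on S (\<lambda>x. inverse (f x))"
  by (auto simp: smooth_on_def intro: C_k_on_inverse)

lemma smooth_on_compose:
  fixes f :: "'e::euclidean_space \<Rightarrow> 'd::euclidean_space"
  shows "open S \<Longrightarrow> open T \<Longrightarrow> f ` S \<subseteq> T \<Longrightarrow> smooth_on S f \<Longrightarrow> smooth_on T g \<Longrightarrow> smooth_on S (\<lambda>x. g (f x))"
  unfolding smooth_on_def by (blast intro: C_k_on_compose)

lemma smooth_on_derivative:
  "smooth_on S f \<Longrightarrow> x \<in> S \<Longrightarrow> (f has_derivative frechet_derivative f (at x)) (at x)"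
  unfolding smooth_on_def by (intro C_k_on_Suc_derivative[of 0]) auto

lemma smooth_on_frechet_derivative:
  "smooth_on S f \<Longrightarrow> smooth_on S (\<lambda>x. frechet_derivative f (at x) v)"
  unfolding smooth_on_def by (metis C_k_on.simps(2))

lemma smooth_on_continuous: "smooth_on S f \<Longrightarrow> continuous_on S f"
  unfolding smooth_on_def by (metis C_k_on.simps(1))

section \<open>Averages over segments and Hadamard's lemma\<close>

lemma segment_in_ball:
  fixes p x :: "'e::real_normed_vector"
  assumes "x \<in> ball p r" "0 \<le> t" "t \<le> 1"
  shows "p + t *\<^sub>R (x - p) \<in> ball p r"
proof -
  have "norm (t *\<^sub>R (x - p)) \<le> norm (x - p)"
    using assms(2,3) by (simp add: mult_left_le_one_le)
  then show ?thesis using assms(1) by (simp add: dist_norm norm_minus_commute)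
qed

text \<open>Each differentiation under the integral replaces \<open>F\<close> by a partial
  derivative and pulls out one more factor \<open>t\<close> by the chain rule. The weight
  \<open>t ^ m\<close> with arbitrary \<open>m\<close> keeps the induction closed; the application
  has \<open>m = 0\<close>.\<close>

lemma C_k_on_segment_average:
  fixes F :: "'e::euclidean_space \<Rightarrow> real"
  shows "C_k_on k F (ball p r) \<Longrightarrow>
    C_k_on k (\<lambda>x. integral {0..1} (\<lambda>t. t ^ m * F (p + t *\<^sub>R (x - p)))) (ball p r)"
proof (induction k arbitrary: F m)
  case 0
  have cF: "continuous_on (ball p r) F" using 0 by simp
  have "continuous_on (ball p r \<times> cbox 0 1) (\<lambda>(x, t::real). t ^ m * F (p + t *\<^sub>R (x - p)))"
    unfolding split_def
    by (intro continuous_intros continuous_on_compose2[OF cF])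
       (auto simp del: mem_ball intro!: segment_in_ball)
  from integral_continuous_on_param[OF this] show ?case
    by (simp add: cbox_interval)
next
  case (Suc k)
  let ?S = "ball p r" and ?F' = "\<lambda>x. frechet_derivative F (at x)"
  \<comment> \<open>\<open>leibniz_rule\<close> wants the derivative as a continuous map into
    bounded linear functions. \<open>Blinfun\<close> packages it, and the value is meaningful only
    where \<open>F\<close> is known to be differentiable, hence the guards in
    \<open>fx\<close>.\<close>
  let ?fx = "\<lambda>x t::real. Blinfun (\<lambda>v. t ^ Suc m * ?F' (p + t *\<^sub>R (x - p)) v)"
  have dF: "(F has_derivative ?F' x) (at x)" if "x \<in> ?S" for x
    using C_k_on_Suc_derivative[OF Suc.prems that] .
  have fx: "blinfun_apply (?fx x t) = (\<lambda>v. t ^ Suc m * ?F' (p + t *\<^sub>R (x - p)) v)"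
    if "x \<in> ?S" "t \<in> cbox 0 1" for x t
  proof -
    have "bounded_linear (?F' (p + t *\<^sub>R (x - p)))"
      using dF[OF segment_in_ball[OF that(1)]] that(2) by (auto intro: has_derivative_bounded_linear)
    then show ?thesis
      by (intro bounded_linear_Blinfun_apply bounded_linear_const_mult)
  qed
  have cF: "continuous_on ?S F" "\<And>v. continuous_on ?S (\<lambda>x. ?F' x v)"
  proof -
    show "continuous_on ?S F"
      using dF by (meson continuous_at_imp_continuous_on has_derivative_continuous)
    have "C_k_on k (\<lambda>x. ?F' x v) ?S" for v using Suc.prems by simp
    then show "continuous_on ?S (\<lambda>x. ?F' x v)" for v
      using C_k_on_continuous by blast
  qed
  have der: "((\<lambda>x. integral (cbox 0 1) (\<lambda>t. t ^ m * F (p + t *\<^sub>R (x - p)))) has_derivative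
      blinfun_apply (integral (cbox 0 1) (?fx x))) (at x within ?S)" if "x \<in> ?S" for x
  proof (rule leibniz_rule[where U = ?S])
    fix x t assume xt: "x \<in> ?S" "t \<in> cbox (0::real) 1"
    have "((\<lambda>x. p + t *\<^sub>R (x - p)) has_derivative (\<lambda>v. t *\<^sub>R v)) (at x within ?S)"
      by (auto intro!: derivative_eq_intros)
    moreover have d: "(F has_derivative ?F' (p + t *\<^sub>R (x - p))) (at (p + t *\<^sub>R (x - p)))"
      using dF[OF segment_in_ball[OF xt(1)]] xt(2) by auto
    ultimately have "((\<lambda>x. F (p + t *\<^sub>R (x - p))) has_derivative (\<lambda>v. ?F' (p + t *\<^sub>R (x - p)) (t *\<^sub>R v))) (at x within ?S)"
      by (rule has_derivative_compose)
    from has_derivative_mult_right[OF this, of "t ^ m"]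
    show "((\<lambda>x. t ^ m * F (p + t *\<^sub>R (x - p))) has_derivative blinfun_apply (?fx x t)) (at x within ?S)"
      unfolding fx[OF xt] using linear_cmul[OF has_derivative_linear[OF d]] by (simp add: mult_ac)
  next
    fix x assume x: "x \<in> ?S"
    show "(\<lambda>t. t ^ m * F (p + t *\<^sub>R (x - p))) integrable_on cbox 0 1"
      by (intro integrable_continuous continuous_intros continuous_on_compose2[OF cF(1)])
         (auto simp del: mem_ball intro!: segment_in_ball[OF x])
  next
    have "continuous_on (?S \<times> cbox 0 1) (\<lambda>(x, t). t ^ Suc m * ?F' (p + t *\<^sub>R (x - p)) i)" for i
      unfolding split_def
      by (intro continuous_intros continuous_on_compose2[OF cF(2)]) (auto simp del: mem_ball intro!: segment_in_ball)
    then have "continuous_on (?S \<times> cbox 0 1) (\<lambda>xt. blinfun_apply (?fx (fst xt) (snd xt)) i)" for i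
      by (rule continuous_on_eq) (auto simp: fx split_def simp del: power_Suc)
    then show "continuous_on (?S \<times> cbox 0 1) (\<lambda>(x, t). ?fx x t)"
      unfolding split_def by (intro continuous_on_blinfun_componentwise)
  qed (use that in auto)
  \<comment> \<open>Evaluation at \<open>v\<close> commutes with the integral. This turns the
    operator-valued derivative back into a scalar average of the original shape, with weight
    exponent \<open>Suc m\<close>.\<close>
  have ev: "blinfun_apply (integral (cbox 0 1) (?fx x)) v =
      integral {0..1} (\<lambda>t. t ^ Suc m * ?F' (p + t *\<^sub>R (x - p)) v)" if x: "x \<in> ?S" for x v
  proof -
    have "continuous_on (cbox 0 1) (\<lambda>t. blinfun_apply (?fx x t) i)" for i
    proof -
      have "continuous_on (cbox 0 1) (\<lambda>t. t ^ Suc m * ?F' (p + t *\<^sub>R (x - p)) i)"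
        by (intro continuous_intros continuous_on_compose2[OF cF(2)]) (auto simp del: mem_ball intro!: segment_in_ball[OF x])
      then show ?thesis by (rule continuous_on_eq) (auto simp: fx[OF x] simp del: power_Suc)
    qed
    then have "?fx x integrable_on cbox 0 1"
      by (intro integrable_continuous continuous_on_blinfun_componentwise)
    then have "blinfun_apply (integral (cbox 0 1) (?fx x)) v = integral (cbox 0 1) (\<lambda>t. blinfun_apply (?fx x t) v)"
      by (rule blinfun_apply_integral)
    also have "\<dots> = integral {0..1} (\<lambda>t. t ^ Suc m * ?F' (p + t *\<^sub>R (x - p)) v)"
      unfolding cbox_interval by (intro integral_cong) (use fx[OF x] in auto)
    finally show ?thesis .
  qed
  show ?case
  proof (rule C_k_on_SucI[where f' = "\<lambda>x v. integral {0..1} (\<lambda>t. t ^ Suc m * ?F' (p + t *\<^sub>R (x - p)) v)"])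
    fix x assume x: "x \<in> ?S"
    have "blinfun_apply (integral (cbox 0 1) (?fx x)) = (\<lambda>v. integral {0..1} (\<lambda>t. t ^ Suc m * ?F' (p + t *\<^sub>R (x - p)) v))"
      using ev[OF x] by blast
    then show "((\<lambda>x. integral {0..1} (\<lambda>t. t ^ m * F (p + t *\<^sub>R (x - p)))) has_derivative
        (\<lambda>v. integral {0..1} (\<lambda>t. t ^ Suc m * ?F' (p + t *\<^sub>R (x - p)) v))) (at x)"
      using der[OF x] at_within_open[OF x open_ball] unfolding cbox_interval by simp
  next
    show "C_k_on k (\<lambda>x. integral {0..1} (\<lambda>t. t ^ Suc m * ?F' (p + t *\<^sub>R (x - p)) v)) ?S" for v
      using Suc.prems by (intro Suc.IH) simp
  qed simp
qed

text \<open>\<open>G b\<close> is the average of the partial derivative of \<open>F\<close> in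
  direction \<open>b\<close> over the segment from \<open>p\<close> to \<open>x\<close>. The
  expansion is the fundamental theorem of calculus on that segment; at \<open>x = p\<close> the
  integrand is constant, which gives the last claim.\<close>

lemma hadamard:
  fixes F :: "'e::euclidean_space \<Rightarrow> real"
  assumes F: "smooth_on (ball p r) F" and r: "r > 0"
  obtains G where "\<And>b. smooth_on (ball p r) (G b)"
    "\<And>x. x \<in> ball p r \<Longrightarrow> F x = F p + (\<Sum>b\<in>Basis. ((x - p) \<bullet> b) * G b x)"
    "\<And>b. G b p = frechet_derivative F (at p) b"
proof -
  let ?F' = "\<lambda>x. frechet_derivative F (at x)"
  define G where "G b x = integral {0..1} (\<lambda>t. ?F' (p + t *\<^sub>R (x - p)) b)" for b x
  have smF: "smooth_on (ball p r) (\<lambda>x. ?F' x b)" for b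
    using smooth_on_frechet_derivative[OF F] .
  have "smooth_on (ball p r) (G b)" for b
    using smF[of b] C_k_on_segment_average[of _ "\<lambda>x. ?F' x b" p r 0]
    unfolding G_def smooth_on_def by simp
  moreover have "F x = F p + (\<Sum>b\<in>Basis. ((x - p) \<bullet> b) * G b x)" if x: "x \<in> ball p r" for x
  proof -
    have int: "(\<lambda>t. ?F' (p + t *\<^sub>R (x - p)) b) integrable_on {0..1}" for b
      unfolding cbox_interval[symmetric]
      by (intro integrable_continuous continuous_intros continuous_on_compose2[OF smooth_on_continuous[OF smF]])
         (auto simp del: mem_ball intro!: segment_in_ball[OF x])
    have "((\<lambda>t. F (p + t *\<^sub>R (x - p))) has_vector_derivative ?F' (p + t *\<^sub>R (x - p)) (x - p)) (at t within {0..1})"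
      if "t \<in> {0..1}" for t
    proof -
      have d: "(F has_derivative ?F' (p + t *\<^sub>R (x - p))) (at (p + t *\<^sub>R (x - p)))"
        using smooth_on_derivative[OF F segment_in_ball[OF x]] that by auto
      have "((\<lambda>t. p + t *\<^sub>R (x - p)) has_derivative (\<lambda>s. s *\<^sub>R (x - p))) (at t within {0..1})"
        by (auto intro!: derivative_eq_intros)
      from has_derivative_compose[OF this d]
      show ?thesis
        unfolding has_vector_derivative_def using linear_cmul[OF has_derivative_linear[OF d]] by simp
    qed
    then have "((\<lambda>t. ?F' (p + t *\<^sub>R (x - p)) (x - p)) has_integral F (p + 1 *\<^sub>R (x - p)) - F (p + 0 *\<^sub>R (x - p))) {0..1}"
      by (intro fundamental_theorem_of_calculus) auto
    then have "F x - F p = integral {0..1} (\<lambda>t. ?F' (p + t *\<^sub>R (x - p)) (x - p))"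
      by (simp add: integral_unique)
    also have "\<dots> = integral {0..1} (\<lambda>t. \<Sum>b\<in>Basis. ((x - p) \<bullet> b) * ?F' (p + t *\<^sub>R (x - p)) b)"
    proof (rule integral_cong)
      fix t :: real assume "t \<in> {0..1}"
      then have l: "linear (?F' (p + t *\<^sub>R (x - p)))"
        using smooth_on_derivative[OF F segment_in_ball[OF x]] by (auto intro: has_derivative_linear)
      have "?F' (p + t *\<^sub>R (x - p)) (x - p) = ?F' (p + t *\<^sub>R (x - p)) (\<Sum>b\<in>Basis. ((x - p) \<bullet> b) *\<^sub>R b)"
        by (simp only: euclidean_representation)
      also have "\<dots> = (\<Sum>b\<in>Basis. ((x - p) \<bullet> b) * ?F' (p + t *\<^sub>R (x - p)) b)"
        by (simp only: linear_sum[OF l] linear_cmul[OF l] real_scaleR_def)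
      finally show "?F' (p + t *\<^sub>R (x - p)) (x - p) = (\<Sum>b\<in>Basis. ((x - p) \<bullet> b) * ?F' (p + t *\<^sub>R (x - p)) b)" .
    qed
    also have "\<dots> = (\<Sum>b\<in>Basis. ((x - p) \<bullet> b) * G b x)"
      unfolding G_def by (subst integral_sum) (auto intro: int integrable_on_mult_right simp: int)
    finally show ?thesis by simp
  qed
  moreover have "G b p = ?F' p b" for b
    unfolding G_def by simp
  ultimately show thesis using that by blast
qed

section \<open>Smooth functions on a manifold\<close>

locale manifold =
  fixes A :: "('a::{t2_space, second_countable_topology}, 'e::euclidean_space) chart set"
  assumes smooth_manifold: "smooth_manifold A"
begin

lemma obtain_chart:
  obtains U c where "(U, c) \<in> A" "p \<in> U"
proof -
  have "p \<in> \<Union> (fst ` A)" using smooth_manifold by (simp add: smooth_manifold_def)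
  then show ?thesis using that by fastforce
qed

lemma chart_homeomorphism:
  assumes "(U, c) \<in> A"
  shows chart_open: "open U"
    and chart_image: "open (c ` U)"
    and chart_homeo: "homeomorphism U (c ` U) c (inv_into U c)"
  using smooth_manifold assms by (auto simp: smooth_manifold_def is_chart_def)

lemma chart_inv [simp]: "(U, c) \<in> A \<Longrightarrow> x \<in> U \<Longrightarrow> inv_into U c (c x) = x"
  using chart_homeo by (auto simp: homeomorphism_def)

lemma chart_inj: "(U, c) \<in> A \<Longrightarrow> inj_on c U"
  by (metis chart_inv inj_on_def)

lemma chart_image_open:
  assumes "(U, c) \<in> A" "open W"
  shows "open (c ` (U \<inter> W))"
proof -
  have "c ` (U \<inter> W) = c ` U \<inter> inv_into U c -` W"
    using chart_inv[OF assms(1)] by force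
  then show ?thesis
    using chart_homeo[OF assms(1)] chart_image[OF assms(1)] assms(2)
    by (metis continuous_open_preimage homeomorphism_cont2)
qed

lemma transition_smooth:
  "(U, c) \<in> A \<Longrightarrow> (V, d) \<in> A \<Longrightarrow> smooth_on (c ` (U \<inter> V)) (d \<circ> inv_into U c)"
  using smooth_manifold by (auto simp: smooth_manifold_def)

lemma smooth_fun_chartD: "smooth_fun A W h \<Longrightarrow> (U, c) \<in> A \<Longrightarrow> smooth_on (c ` (U \<inter> W)) (h \<circ> inv_into U c)"
  by (auto simp: smooth_fun_def)

lemma smooth_fun_cong:
  assumes "open W" "smooth_fun A W f" "\<And>x. x \<in> W \<Longrightarrow> f x = g x"
  shows "smooth_fun A W g"
  unfolding smooth_fun_def
proof clarify
  fix U c assume c: "(U, c) \<in> A"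
  show "smooth_on (c ` (U \<inter> W)) (g \<circ> inv_into U c)"
    by (rule smooth_on_cong[OF chart_image_open[OF c assms(1)] _ smooth_fun_chartD[OF assms(2) c]])
       (use assms(3) c in auto)
qed

lemma smooth_fun_subset: "smooth_fun A W f \<Longrightarrow> V \<subseteq> W \<Longrightarrow> smooth_fun A V f"
  unfolding smooth_fun_def
proof clarify
  fix U c
  assume "\<forall>(U, c)\<in>A. smooth_on (c ` (U \<inter> W)) (f \<circ> inv_into U c)" "V \<subseteq> W" "(U, c) \<in> A"
  then show "smooth_on (c ` (U \<inter> V)) (f \<circ> inv_into U c)"
    by (auto intro: smooth_on_subset[of "c ` (U \<inter> W)" _ "c ` (U \<inter> V)"])
qed

lemma smooth_fun_local:
  assumes "open W" "\<And>p. p \<in> W \<Longrightarrow> \<exists>V. open V \<and> p \<in> V \<and> smooth_fun A (V \<inter> W) f"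
  shows "smooth_fun A W f"
  unfolding smooth_fun_def
proof clarify
  fix U c assume c: "(U, c) \<in> A"
  show "smooth_on (c ` (U \<inter> W)) (f \<circ> inv_into U c)"
  proof (rule smooth_on_local[OF chart_image_open[OF c assms(1)]])
    fix x assume "x \<in> c ` (U \<inter> W)"
    then obtain p where p: "p \<in> U" "p \<in> W" "x = c p" by auto
    then obtain V where V: "open V" "p \<in> V" "smooth_fun A (V \<inter> W) f" using assms(2) by blast
    \<comment> \<open>Injectivity of the chart map lets images commute with intersections.\<close>
    have "c ` (U \<inter> V) \<inter> c ` (U \<inter> W) = c ` (U \<inter> (V \<inter> W))"
      using inj_on_image_Int[OF chart_inj[OF c], of "U \<inter> V" "U \<inter> W"] by (simp add: Int_ac)
    then have "smooth_on (c ` (U \<inter> V) \<inter> c ` (U \<inter> W)) (f \<circ> inv_into U c)"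
      using smooth_fun_chartD[OF V(3) c] by simp
    then show "\<exists>T. open T \<and> x \<in> T \<and> smooth_on (T \<inter> c ` (U \<inter> W)) (f \<circ> inv_into U c)"
      using chart_image_open[OF c V(1)] p V(2) by (intro exI[of _ "c ` (U \<inter> V)"]) auto
  qed
qed

lemma smooth_fun_const: "open W \<Longrightarrow> smooth_fun A W (\<lambda>x. r)"
  unfolding smooth_fun_def by (auto simp: o_def intro: smooth_on_const chart_image_open)

lemma smooth_fun_add:
  assumes "open W" "smooth_fun A W f" "smooth_fun A W g"
  shows "smooth_fun A W (\<lambda>x. f x + g x)"
  unfolding smooth_fun_def o_def
proof clarify
  fix U c assume "(U, c) \<in> A"
  with assms show "smooth_on (c ` (U \<inter> W)) (\<lambda>x. f (inv_into U c x) + g (inv_into U c x))"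
    by (intro smooth_on_add[OF chart_image_open]) (auto simp: smooth_fun_def o_def)
qed

lemma smooth_fun_mult:
  assumes "open W" "smooth_fun A W f" "smooth_fun A W g"
  shows "smooth_fun A W (\<lambda>x. f x * g x)"
  unfolding smooth_fun_def o_def
proof clarify
  fix U c assume "(U, c) \<in> A"
  with assms show "smooth_on (c ` (U \<inter> W)) (\<lambda>x. f (inv_into U c x) * g (inv_into U c x))"
    by (intro smooth_on_bilinear[OF bounded_bilinear_mult chart_image_open]) (auto simp: smooth_fun_def o_def)
qed

lemma smooth_fun_diff:
  assumes "open W" "smooth_fun A W f" "smooth_fun A W g"
  shows "smooth_fun A W (\<lambda>x. f x - g x)"
  using smooth_fun_add[OF assms(1,2) smooth_fun_mult[OF assms(1) smooth_fun_const[OF assms(1), of "-1"] assms(3)]]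
  by simp

lemma smooth_fun_inverse:
  assumes "open W" "\<And>x. x \<in> W \<Longrightarrow> f x \<noteq> 0" "smooth_fun A W f"
  shows "smooth_fun A W (\<lambda>x. inverse (f x))"
  unfolding smooth_fun_def
proof clarify
  fix U c assume c: "(U, c) \<in> A"
  have "(f \<circ> inv_into U c) x \<noteq> 0" if "x \<in> c ` (U \<inter> W)" for x
    using assms(2) c that by auto
  from smooth_on_inverse[OF chart_image_open[OF c assms(1)] this smooth_fun_chartD[OF assms(3) c]]
  show "smooth_on (c ` (U \<inter> W)) ((\<lambda>x. inverse (f x)) \<circ> inv_into U c)"
    by (simp add: o_def)
qed

text \<open>Inside one chart domain a single coordinate expression decides smoothness, because any
  other one is that expression composed with a transition map.\<close>

lemma smooth_fun_chartI:
  assumes c: "(U, c) \<in> A" and W: "open W" "W \<subseteq> U" and h: "smooth_on (c ` W) (h \<circ> inv_into U c)"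
  shows "smooth_fun A W h"
  unfolding smooth_fun_def
proof clarify
  fix V d assume d: "(V, d) \<in> A"
  have UW: "U \<inter> W = W" using W by auto
  have "smooth_on (d ` (V \<inter> W)) (\<lambda>x. (h \<circ> inv_into U c) ((c \<circ> inv_into V d) x))"
  proof (rule smooth_on_compose[of _ "c ` W" "c \<circ> inv_into V d" "h \<circ> inv_into U c"])
    show "open (d ` (V \<inter> W))" using chart_image_open[OF d W(1)] .
    show "open (c ` W)" using chart_image_open[OF c W(1)] UW by simp
    show "(c \<circ> inv_into V d) ` (d ` (V \<inter> W)) \<subseteq> c ` W" using d by auto
    show "smooth_on (d ` (V \<inter> W)) (c \<circ> inv_into V d)"
      by (rule smooth_on_subset[OF transition_smooth[OF d c]]) (use W in auto)
  qed (rule h)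
  then show "smooth_on (d ` (V \<inter> W)) (h \<circ> inv_into V d)"
    by (rule smooth_on_cong[OF chart_image_open[OF d W(1)], rotated]) (use c d W in auto)
qed

lemma smooth_fun_coord:
  assumes c: "(U, c) \<in> A"
  shows "smooth_fun A U (\<lambda>x. c x \<bullet> b)"
proof (rule smooth_fun_chartI[OF c chart_open[OF c] subset_refl])
  have "smooth_on (c ` U) (\<lambda>y. y \<bullet> b)"
    by (intro smooth_on_bounded_linear bounded_linear_inner_left chart_image[OF c])
  then show "smooth_on (c ` U) ((\<lambda>x. c x \<bullet> b) \<circ> inv_into U c)"
    by (rule smooth_on_cong[OF chart_image[OF c], rotated]) (use c in auto)
qed

lemma smooth_nearI: "open W \<Longrightarrow> p \<in> W \<Longrightarrow> smooth_fun A W f \<Longrightarrow> smooth_near A p f"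
  unfolding smooth_near_def by blast

lemma smooth_near_cong:
  assumes "smooth_near A p f" "\<forall>\<^sub>F x in nhds p. f x = g x"
  shows "smooth_near A p g"
proof -
  obtain W V where "open W" "p \<in> W" "smooth_fun A W f" "open V" "p \<in> V" "\<forall>x\<in>V. f x = g x"
    using assms by (auto simp: smooth_near_def eventually_nhds)
  then have "smooth_fun A (W \<inter> V) g"
    by (intro smooth_fun_cong[of "W \<inter> V" f g] smooth_fun_subset[of W f "W \<inter> V"]) auto
  then show ?thesis using \<open>open W\<close> \<open>open V\<close> \<open>p \<in> W\<close> \<open>p \<in> V\<close> by (intro smooth_nearI[of "W \<inter> V"]) auto
qed

lemma smooth_near_const: "smooth_near A p (\<lambda>x. r)"
  using smooth_nearI[OF open_UNIV _ smooth_fun_const] by simp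

lemma smooth_near_binop:
  assumes "smooth_near A p f" "smooth_near A p g"
    and op: "\<And>W. open W \<Longrightarrow> smooth_fun A W f \<Longrightarrow> smooth_fun A W g \<Longrightarrow> smooth_fun A W h"
  shows "smooth_near A p h"
proof -
  obtain W V where "open W" "p \<in> W" "smooth_fun A W f" "open V" "p \<in> V" "smooth_fun A V g"
    using assms by (auto simp: smooth_near_def)
  then show ?thesis
    by (intro smooth_nearI[of "W \<inter> V"] op smooth_fun_subset[of W f "W \<inter> V"] smooth_fun_subset[of V g "W \<inter> V"]) auto
qed

lemma smooth_near_add: "smooth_near A p f \<Longrightarrow> smooth_near A p g \<Longrightarrow> smooth_near A p (\<lambda>x. f x + g x)"
  by (rule smooth_near_binop[of p f g]) (auto intro: smooth_fun_add)

lemma smooth_near_mult: "smooth_near A p f \<Longrightarrow> smooth_near A p g \<Longrightarrow> smooth_near A p (\<lambda>x. f x * g x)"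
  by (rule smooth_near_binop[of p f g]) (auto intro: smooth_fun_mult)

lemma smooth_near_diff: "smooth_near A p f \<Longrightarrow> smooth_near A p g \<Longrightarrow> smooth_near A p (\<lambda>x. f x - g x)"
  by (rule smooth_near_binop[of p f g]) (auto intro: smooth_fun_diff)

lemma smooth_near_sum:
  "(\<And>i. i \<in> I \<Longrightarrow> smooth_near A p (f i)) \<Longrightarrow> smooth_near A p (\<lambda>x. \<Sum>i\<in>I. f i x)"
  by (induction I rule: infinite_finite_induct) (auto intro: smooth_near_const smooth_near_add)

text \<open>Smoothness near a point is an open condition. This is what allows
  \<open>q \<mapsto> X q f\<close> to be treated as a derivation at every \<open>q\<close> close to
  \<open>p\<close>, away from the default value 0.\<close>

lemma smooth_near_eventually:
  assumes "smooth_near A p f" shows "\<forall>\<^sub>F x in nhds p. smooth_near A x f"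
proof -
  obtain W where "open W" "p \<in> W" "smooth_fun A W f" using assms by (auto simp: smooth_near_def)
  then show ?thesis unfolding eventually_nhds by (intro exI[of _ W]) (auto intro: smooth_nearI)
qed

lemma smooth_near_coord: "(U, c) \<in> A \<Longrightarrow> p \<in> U \<Longrightarrow> smooth_near A p (\<lambda>x. c x \<bullet> b)"
  by (rule smooth_nearI[OF chart_open _ smooth_fun_coord])

end

section \<open>Pullback of functions along a smooth map\<close>

lemma smooth_fun_comp:
  assumes A: "smooth_manifold A" and B: "smooth_manifold B" and f: "smooth_map A B f"
    and W: "open W" and h: "smooth_fun B W h"
  shows "smooth_fun A (f -` W) (h \<circ> f)"
proof -
  interpret A: manifold A using A by unfold_locales
  interpret B: manifold B using B by unfold_locales
  have vimage_open: "open (f -` S)" if "open S" for S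
    using f that by (auto simp: smooth_map_def intro: open_vimage)
  show ?thesis
    unfolding smooth_fun_def
  proof clarify
    fix U c assume c: "(U, c) \<in> A"
    have op: "open (c ` (U \<inter> f -` S))" if "open S" for S
      using A.chart_image_open[OF c vimage_open[OF that]] .
    show "smooth_on (c ` (U \<inter> f -` W)) (h \<circ> f \<circ> inv_into U c)"
    proof (rule smooth_on_local[OF op[OF W]])
      fix x assume "x \<in> c ` (U \<inter> f -` W)"
      then obtain p where p: "p \<in> U" "f p \<in> W" "x = c p" by auto
      obtain V d where d: "(V, d) \<in> B" "f p \<in> V" using B.obtain_chart by blast
      \<comment> \<open>On this set one chart on each side is in force, and the coordinate
        expression of \<open>h \<circ> f\<close> is the composition of those of \<open>h\<close> and
        \<open>f\<close>.\<close>
      let ?T = "c ` (U \<inter> f -` (V \<inter> W))"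
      have oT: "open ?T" using op B.chart_open[OF d(1)] W by blast
      have "smooth_on ?T (\<lambda>x. (h \<circ> inv_into V d) ((d \<circ> f \<circ> inv_into U c) x))"
      proof (rule smooth_on_compose[OF oT B.chart_image_open[OF d(1) W], of "d \<circ> f \<circ> inv_into U c" "h \<circ> inv_into V d"])
        show "(d \<circ> f \<circ> inv_into U c) ` ?T \<subseteq> d ` (V \<inter> W)" using c by auto
        have "smooth_on (c ` (U \<inter> f -` V)) (d \<circ> f \<circ> inv_into U c)"
          using f c d(1) by (auto simp: smooth_map_def)
        then show "smooth_on ?T (d \<circ> f \<circ> inv_into U c)" by (rule smooth_on_subset) auto
        show "smooth_on (d ` (V \<inter> W)) (h \<circ> inv_into V d)" by (rule B.smooth_fun_chartD[OF h d(1)])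
      qed
      then have "smooth_on ?T (h \<circ> f \<circ> inv_into U c)"
        by (rule smooth_on_cong[OF oT, rotated]) (use c d in auto)
      moreover have "?T \<inter> c ` (U \<inter> f -` W) = ?T" by auto
      ultimately show "\<exists>T. open T \<and> x \<in> T \<and> smooth_on (T \<inter> c ` (U \<inter> f -` W)) (h \<circ> f \<circ> inv_into U c)"
        using oT p d(2) by (intro exI[of _ ?T]) auto
    qed
  qed
qed

lemma smooth_near_comp:
  assumes A: "smooth_manifold A" and B: "smooth_manifold B" and f: "smooth_map A B f"
    and h: "smooth_near B (f p) h"
  shows "smooth_near A p (h \<circ> f)"
proof -
  obtain W where "open W" "f p \<in> W" "smooth_fun B W h" using h by (auto simp: smooth_near_def)
  moreover have "open (f -` W)"
    using f \<open>open W\<close> by (auto simp: smooth_map_def intro: open_vimage)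
  ultimately show ?thesis
    using smooth_fun_comp[OF A B f] unfolding smooth_near_def by (intro exI[of _ "f -` W"]) auto
qed

section \<open>Tangent vectors and vector fields\<close>

lemma sum_fun_apply: "(\<Sum>i\<in>I. f i) x = (\<Sum>i\<in>I. f i x :: 'b::comm_monoid_add)"
  by (induction I rule: infinite_finite_induct) auto

context manifold
begin

text \<open>In the locality clause both functions may be taken smooth near \<open>p\<close>, since a
  function with the germ of a smooth one is smooth near \<open>p\<close> as well.\<close>

lemma tangentI:
  assumes "\<And>f g. smooth_near A p f \<Longrightarrow> smooth_near A p g \<Longrightarrow> v (\<lambda>x. f x + g x) = v f + v g"
    "\<And>f g. smooth_near A p f \<Longrightarrow> smooth_near A p g \<Longrightarrow> v (\<lambda>x. f x * g x) = v f * g p + f p * v g"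
    "\<And>f r. smooth_near A p f \<Longrightarrow> v (\<lambda>x. r * f x) = r * v f"
    "\<And>f g. smooth_near A p f \<Longrightarrow> smooth_near A p g \<Longrightarrow> \<forall>\<^sub>F x in nhds p. f x = g x \<Longrightarrow> v f = v g"
    "\<And>f. \<not> smooth_near A p f \<Longrightarrow> v f = 0"
  shows "v \<in> tangent_space A p"
  unfolding tangent_space_def using assms smooth_near_cong by blast

lemma
  assumes "v \<in> tangent_space A p"
  shows tangent_add: "smooth_near A p f \<Longrightarrow> smooth_near A p g \<Longrightarrow> v (\<lambda>x. f x + g x) = v f + v g"
    and tangent_mult: "smooth_near A p f \<Longrightarrow> smooth_near A p g \<Longrightarrow> v (\<lambda>x. f x * g x) = v f * g p + f p * v g"
    and tangent_scale: "smooth_near A p f \<Longrightarrow> v (\<lambda>x. r * f x) = r * v f"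
    and tangent_cong: "smooth_near A p f \<Longrightarrow> \<forall>\<^sub>F x in nhds p. f x = g x \<Longrightarrow> v f = v g"
    and tangent_nonsmooth: "\<not> smooth_near A p f \<Longrightarrow> v f = 0"
  using assms unfolding tangent_space_def by blast+

lemma tangent_diff:
  assumes "v \<in> tangent_space A p" "smooth_near A p f" "smooth_near A p g"
  shows "v (\<lambda>x. f x - g x) = v f - v g"
  using tangent_add[OF assms(1,2) smooth_near_mult[OF smooth_near_const[of p "-1"] assms(3)]]
    tangent_scale[OF assms(1,3), of "-1"] by simp

text \<open>The Leibniz rule for 1 = 1 * 1 reads \<open>v 1 = v 1 + v 1\<close>; homogeneity does
  the rest.\<close>

lemma tangent_const:
  assumes "v \<in> tangent_space A p"
  shows "v (\<lambda>x. r) = 0"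
proof -
  have "v (\<lambda>x. 1) = 0"
    using tangent_mult[OF assms smooth_near_const[of p 1] smooth_near_const[of p 1]] by simp
  then show ?thesis
    using tangent_scale[OF assms smooth_near_const[of p 1], of r] by simp
qed

lemma tangent_sum:
  assumes "v \<in> tangent_space A p"
  shows "(\<And>i. i \<in> I \<Longrightarrow> smooth_near A p (f i)) \<Longrightarrow> v (\<lambda>x. \<Sum>i\<in>I. f i x) = (\<Sum>i\<in>I. v (f i))"
  by (induction I rule: infinite_finite_induct)
     (simp_all add: tangent_const[OF assms] tangent_add[OF assms] smooth_near_sum)

lemma tangent_subspace: "subspace (tangent_space A p)"
  unfolding subspace_def tangent_space_def by (simp add: algebra_simps) metis

section \<open>Coordinate fields and the expansion of tangent vectors\<close>

lemma chart_derivative: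
  assumes c: "(U, c) \<in> A" and p: "p \<in> U" and f: "smooth_near A p f"
  shows "(f \<circ> inv_into U c has_derivative frechet_derivative (f \<circ> inv_into U c) (at (c p))) (at (c p))"
proof -
  obtain W where "open W" "p \<in> W" "smooth_fun A W f" using f by (auto simp: smooth_near_def)
  then show ?thesis
    using smooth_on_derivative[OF smooth_fun_chartD[OF _ c]] p by blast
qed

lemma coord_field_apply:
  "smooth_near A p f \<Longrightarrow> coord_field A (U, c) b p f = frechet_derivative (f \<circ> inv_into U c) (at (c p)) b"
  by (simp add: coord_field_def)

lemma coord_field_eqI:
  assumes "smooth_near A p f" "(f \<circ> inv_into U c has_derivative f') (at (c p))"
  shows "coord_field A (U, c) b p f = f' b"
  using frechet_derivative_at[OF assms(2)] by (simp add: coord_field_apply[OF assms(1)])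

lemma coord_field_tangent:
  assumes c: "(U, c) \<in> A" and p: "p \<in> U"
  shows "coord_field A (U, c) b p \<in> tangent_space A p"
proof (rule tangentI)
  fix f g assume fg: "smooth_near A p f" "smooth_near A p g"
  note df = chart_derivative[OF c p fg(1)] and dg = chart_derivative[OF c p fg(2)]
  have "((\<lambda>x. f x + g x) \<circ> inv_into U c has_derivative
      (\<lambda>b. frechet_derivative (f \<circ> inv_into U c) (at (c p)) b + frechet_derivative (g \<circ> inv_into U c) (at (c p)) b)) (at (c p))"
    using has_derivative_add[OF df dg] by (simp add: o_def)
  from coord_field_eqI[OF smooth_near_add[OF fg] this]
  show "coord_field A (U, c) b p (\<lambda>x. f x + g x) = coord_field A (U, c) b p f + coord_field A (U, c) b p g"
    by (simp add: coord_field_apply fg)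
  have "((\<lambda>x. f x * g x) \<circ> inv_into U c has_derivative
      (\<lambda>b. f p * frechet_derivative (g \<circ> inv_into U c) (at (c p)) b + frechet_derivative (f \<circ> inv_into U c) (at (c p)) b * g p)) (at (c p))"
    using has_derivative_mult[OF df dg] c p by (simp add: o_def)
  from coord_field_eqI[OF smooth_near_mult[OF fg] this]
  show "coord_field A (U, c) b p (\<lambda>x. f x * g x) = coord_field A (U, c) b p f * g p + f p * coord_field A (U, c) b p g"
    by (simp add: coord_field_apply fg)
  show "coord_field A (U, c) b p (\<lambda>x. r * f x) = r * coord_field A (U, c) b p f" for r
  proof -
    have "((\<lambda>x. r * f x) \<circ> inv_into U c has_derivative
        (\<lambda>b. r * frechet_derivative (f \<circ> inv_into U c) (at (c p)) b)) (at (c p))"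
      using has_derivative_mult_right[OF df] by (simp add: o_def)
    from coord_field_eqI[OF smooth_near_mult[OF smooth_near_const fg(1)] this]
    show ?thesis by (simp add: coord_field_apply fg)
  qed
  assume "\<forall>\<^sub>F x in nhds p. f x = g x"
  then obtain W where W: "open W" "p \<in> W" "\<And>x. x \<in> W \<Longrightarrow> f x = g x" by (auto simp: eventually_nhds)
  have "(g \<circ> inv_into U c has_derivative frechet_derivative (f \<circ> inv_into U c) (at (c p))) (at (c p))"
    by (rule has_derivative_transform_within_open[OF df chart_image_open[OF c W(1)]]) (use p W c in auto)
  from coord_field_eqI[OF fg(2) this]
  show "coord_field A (U, c) b p f = coord_field A (U, c) b p g"
    by (simp add: coord_field_apply fg)
qed (auto simp: coord_field_def smooth_near_mult smooth_near_const)

lemma coord_field_coord: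
  assumes c: "(U, c) \<in> A" and p: "p \<in> U"
  shows "coord_field A (U, c) b p (\<lambda>x. c x \<bullet> i) = b \<bullet> i"
proof (rule coord_field_eqI[OF smooth_near_coord[OF c p]])
  have "((\<lambda>y. y \<bullet> i) has_derivative (\<lambda>b. b \<bullet> i)) (at (c p))" by (auto intro!: derivative_eq_intros)
  then show "((\<lambda>x. c x \<bullet> i) \<circ> inv_into U c has_derivative (\<lambda>b. b \<bullet> i)) (at (c p))"
    by (rule has_derivative_transform_within_open[OF _ chart_image[OF c]]) (use p c in auto)
qed

text \<open>Near \<open>p\<close>, Hadamard's lemma writes \<open>f\<close> as the constant
  \<open>f p\<close> plus a sum of products of \<open>c x \<bullet> b - c p \<bullet> b\<close> with
  smooth functions. The derivation kills the constant, and the first factor of each product vanishes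
  at \<open>p\<close>, so the Leibniz rule keeps only the derivative of the coordinate times a value
  that is the partial derivative of \<open>f\<close>.\<close>

lemma tangent_space_expansion:
  assumes c: "(U, c) \<in> A" and p: "p \<in> U" and v: "v \<in> tangent_space A p"
  shows "v = (\<Sum>b\<in>Basis. v (\<lambda>x. c x \<bullet> b) *\<^sub>R coord_field A (U, c) b p)"
proof
  fix f
  show "v f = (\<Sum>b\<in>Basis. v (\<lambda>x. c x \<bullet> b) *\<^sub>R coord_field A (U, c) b p) f"
  proof (cases "smooth_near A p f")
    \<comment> \<open>Both sides are 0 by the convention for functions that are not smooth near
      \<open>p\<close>.\<close>
    case False
    then show ?thesis
      by (simp add: sum_fun_apply tangent_nonsmooth[OF v] coord_field_def)
  next
    case True
    then obtain W where W: "open W" "p \<in> W" "smooth_fun A W f" by (auto simp: smooth_near_def)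
    let ?F = "f \<circ> inv_into U c"
    have "c p \<in> c ` (U \<inter> W)" using p W by auto
    then obtain r where r: "r > 0" "ball (c p) r \<subseteq> c ` (U \<inter> W)"
      using chart_image_open[OF c W(1)] open_contains_ball by blast
    have "smooth_on (ball (c p) r) ?F"
      by (rule smooth_on_subset[OF smooth_fun_chartD[OF W(3) c] r(2)])
    then obtain G where G: "\<And>b. smooth_on (ball (c p) r) (G b)"
      "\<And>x. x \<in> ball (c p) r \<Longrightarrow> ?F x = ?F (c p) + (\<Sum>b\<in>Basis. ((x - c p) \<bullet> b) * G b x)"
      "\<And>b. G b (c p) = frechet_derivative ?F (at (c p)) b"
      using hadamard[OF _ r(1)] by blast
    \<comment> \<open>The part of the chart domain that corresponds to the ball: here the expansion
      of \<open>f\<close> and the functions \<open>G b\<close> pull back to the manifold.\<close>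
    define W' where "W' = U \<inter> c -` ball (c p) r"
    have W': "open W'" "p \<in> W'" "W' \<subseteq> U"
      using continuous_open_preimage[OF homeomorphism_cont1[OF chart_homeo[OF c]] chart_open[OF c]] p r(1)
      by (auto simp: W'_def)
    have cW': "c ` W' = ball (c p) r"
      using r(2) by (auto simp: W'_def)
    have Gs: "smooth_near A p (\<lambda>x. G b (c x))" for b
    proof (rule smooth_nearI[OF W'(1,2)], rule smooth_fun_chartI[OF c W'(1,3)])
      have "smooth_on (c ` W') (G b)" using G(1) cW' by simp
      then show "smooth_on (c ` W') ((\<lambda>x. G b (c x)) \<circ> inv_into U c)"
      proof (rule smooth_on_cong[rotated 2])
        fix y assume "y \<in> c ` W'"
        then obtain q where "q \<in> U" "y = c q" using W'(3) by auto
        then show "G b y = ((\<lambda>x. G b (c x)) \<circ> inv_into U c) y" using c by simp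
      qed (simp add: cW')
    qed
    have "v f = v (\<lambda>x. f p + (\<Sum>b\<in>Basis. (c x \<bullet> b - c p \<bullet> b) * G b (c x)))"
    proof (rule tangent_cong[OF v True])
      have "f x = f p + (\<Sum>b\<in>Basis. (c x \<bullet> b - c p \<bullet> b) * G b (c x))" if "x \<in> W'" for x
      proof -
        have "x \<in> U" "c x \<in> ball (c p) r" using that W' cW' by auto
        then show ?thesis using G(2)[of "c x"] c p by (simp add: inner_diff_left del: mem_ball)
      qed
      then show "\<forall>\<^sub>F x in nhds p. f x = f p + (\<Sum>b\<in>Basis. (c x \<bullet> b - c p \<bullet> b) * G b (c x))"
        unfolding eventually_nhds using W' by blast
    qed
    also have "\<dots> = (\<Sum>b\<in>Basis. v (\<lambda>x. (c x \<bullet> b - c p \<bullet> b) * G b (c x)))"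
    proof -
      have s: "smooth_near A p (\<lambda>x. (c x \<bullet> b - c p \<bullet> b) * G b (c x))" for b
        by (intro smooth_near_mult smooth_near_diff smooth_near_const smooth_near_coord[OF c p] Gs)
      show ?thesis
        unfolding tangent_add[OF v smooth_near_const smooth_near_sum[OF s]] tangent_sum[OF v s] tangent_const[OF v]
        by simp
    qed
    also have "\<dots> = (\<Sum>b\<in>Basis. v (\<lambda>x. c x \<bullet> b) * G b (c p))"
    proof (rule sum.cong[OF refl])
      fix b
      show "v (\<lambda>x. (c x \<bullet> b - c p \<bullet> b) * G b (c x)) = v (\<lambda>x. c x \<bullet> b) * G b (c p)"
        unfolding tangent_mult[OF v smooth_near_diff[OF smooth_near_coord[OF c p] smooth_near_const] Gs]
          tangent_diff[OF v smooth_near_coord[OF c p] smooth_near_const] tangent_const[OF v] by simp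
    qed
    also have "\<dots> = (\<Sum>b\<in>Basis. v (\<lambda>x. c x \<bullet> b) *\<^sub>R coord_field A (U, c) b p) f"
      by (simp add: sum_fun_apply G(3) coord_field_apply[OF True])
    finally show ?thesis .
  qed
qed

section \<open>Smooth vector fields and the Lie bracket\<close>

lemma vector_field_tangent: "vector_field A W X \<Longrightarrow> p \<in> W \<Longrightarrow> X p \<in> tangent_space A p"
  by (simp add: vector_field_def)

lemma vector_field_smooth:
  "vector_field A W X \<Longrightarrow> open V \<Longrightarrow> V \<subseteq> W \<Longrightarrow> smooth_fun A V f \<Longrightarrow> smooth_fun A V (\<lambda>p. X p f)"
  by (simp add: vector_field_def)

lemma vector_field_smooth_near:
  assumes X: "vector_field A W X" "open W" "p \<in> W" and f: "smooth_near A p f"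
  shows "smooth_near A p (\<lambda>q. X q f)"
proof -
  obtain V where V: "open V" "p \<in> V" "smooth_fun A V f" using f by (auto simp: smooth_near_def)
  have "smooth_fun A (V \<inter> W) (\<lambda>q. X q f)"
    by (rule vector_field_smooth[OF X(1)]) (use X V in \<open>auto intro: smooth_fun_subset[OF V(3)]\<close>)
  then show ?thesis using V X by (intro smooth_nearI[of "V \<inter> W"]) auto
qed

lemma vector_field_subset: "vector_field A W X \<Longrightarrow> V \<subseteq> W \<Longrightarrow> vector_field A V X"
  unfolding vector_field_def by (meson subsetD subset_trans)

lemma vector_field_cong:
  assumes "vector_field A W X" "\<And>p. p \<in> W \<Longrightarrow> X p = Y p"
  shows "vector_field A W Y"
  unfolding vector_field_def
proof (intro conjI ballI allI impI)
  show "Y p \<in> tangent_space A p" if "p \<in> W" for p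
    using vector_field_tangent[OF assms(1) that] assms(2)[OF that] by simp
  fix V f assume V: "open V \<and> V \<subseteq> W \<and> smooth_fun A V f"
  then have "smooth_fun A V (\<lambda>p. X p f)" using vector_field_smooth[OF assms(1)] by blast
  then show "smooth_fun A V (\<lambda>p. Y p f)"
    by (rule smooth_fun_cong[rotated]) (use V assms(2) in auto)
qed

lemma vector_field_local:
  assumes "\<And>p. p \<in> W \<Longrightarrow> \<exists>V. open V \<and> p \<in> V \<and> vector_field A V X"
  shows "vector_field A W X"
  unfolding vector_field_def
proof (intro conjI ballI allI impI)
  show "X p \<in> tangent_space A p" if "p \<in> W" for p
    using assms[OF that] vector_field_tangent by metis
  fix U f assume U: "open U \<and> U \<subseteq> W \<and> smooth_fun A U f"
  show "smooth_fun A U (\<lambda>p. X p f)"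
  proof (rule smooth_fun_local)
    fix p assume "p \<in> U"
    then obtain V where V: "open V" "p \<in> V" "vector_field A V X" using assms U by blast
    have "smooth_fun A (V \<inter> U) (\<lambda>p. X p f)"
      by (rule vector_field_smooth[OF V(3)]) (use U V in \<open>auto intro: smooth_fun_subset[of U]\<close>)
    then show "\<exists>V. open V \<and> p \<in> V \<and> smooth_fun A (V \<inter> U) (\<lambda>p. X p f)" using V by blast
  qed (use U in auto)
qed

lemma vector_field_zero: "vector_field A W (\<lambda>p. 0)"
  unfolding vector_field_def
  using subspace_0[OF tangent_subspace] by (auto intro: smooth_fun_const)

lemma vector_field_add:
  assumes "vector_field A W X" "vector_field A W Y"
  shows "vector_field A W (\<lambda>p. X p + Y p)"
  unfolding vector_field_def
  using assms by (auto intro: subspace_add[OF tangent_subspace] vector_field_tangent smooth_fun_add vector_field_smooth)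

lemma vector_field_scale:
  assumes "smooth_fun A W f" "vector_field A W X"
  shows "vector_field A W (\<lambda>p. f p *\<^sub>R X p)"
  unfolding vector_field_def
  using assms by (auto intro: subspace_scale[OF tangent_subspace] vector_field_tangent smooth_fun_mult
      vector_field_smooth smooth_fun_subset)

lemma vector_field_diff:
  assumes "open W" "vector_field A W X" "vector_field A W Y"
  shows "vector_field A W (\<lambda>p. X p - Y p)"
  using vector_field_add[OF assms(2) vector_field_scale[OF smooth_fun_const[OF assms(1), of "-1"] assms(3)]]
  by simp

lemma vector_field_sum:
  "(\<And>i. i \<in> I \<Longrightarrow> vector_field A W (X i)) \<Longrightarrow> vector_field A W (\<lambda>p. \<Sum>i\<in>I. X i p)"
  by (induction I rule: infinite_finite_induct) (simp_all add: vector_field_zero vector_field_add)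

lemma coord_vector_field:
  assumes c: "(U, c) \<in> A"
  shows "vector_field A U (coord_field A (U, c) b)"
  unfolding vector_field_def
proof (intro conjI ballI allI impI)
  fix V f assume V: "open V \<and> V \<subseteq> U \<and> smooth_fun A V f"
  then have UV: "U \<inter> V = V" by auto
  show "smooth_fun A V (\<lambda>p. coord_field A (U, c) b p f)"
  proof (rule smooth_fun_chartI[OF c])
    have "smooth_on (c ` V) (\<lambda>y. frechet_derivative (f \<circ> inv_into U c) (at y) b)"
      using smooth_on_frechet_derivative[OF smooth_fun_chartD[OF _ c]] V UV by metis
    then show "smooth_on (c ` V) ((\<lambda>p. coord_field A (U, c) b p f) \<circ> inv_into U c)"
    proof (rule smooth_on_cong[rotated 2])
      show "open (c ` V)" using chart_image_open[OF c] V UV by metis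
      fix y assume "y \<in> c ` V"
      then obtain p where "p \<in> V" "p \<in> U" "y = c p" using V by auto
      moreover from this have "smooth_near A p f" using V smooth_nearI by blast
      ultimately show "frechet_derivative (f \<circ> inv_into U c) (at y) b = ((\<lambda>p. coord_field A (U, c) b p f) \<circ> inv_into U c) y"
        using c by (simp add: coord_field_apply)
    qed
  qed (use V in auto)
qed (rule coord_field_tangent[OF c])

lemma lie_bracket_apply:
  "smooth_near A p f \<Longrightarrow> lie_bracket A X Y p f = X p (\<lambda>q. Y q f) - Y p (\<lambda>q. X q f)"
  by (simp add: lie_bracket_def)

text \<open>When \<open>X\<close> and \<open>Y\<close> act in succession on a product
  \<open>f g\<close>, the mixed terms \<open>X f * Y g\<close> and \<open>Y f * X g\<close> enter
  symmetrically and cancel in the commutator, which leaves the Leibniz rule.\<close>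

lemma lie_bracket_tangent:
  assumes W: "open W" "p \<in> W" and X: "vector_field A W X" and Y: "vector_field A W Y"
  shows "lie_bracket A X Y p \<in> tangent_space A p"
proof (rule tangentI)
  have ev: "\<forall>\<^sub>F q in nhds p. q \<in> W" using W by (simp add: eventually_nhds_in_open)
  fix f g assume fg: "smooth_near A p f" "smooth_near A p g"
  have evf: "\<forall>\<^sub>F q in nhds p. q \<in> W \<and> smooth_near A q f \<and> smooth_near A q g"
    using ev smooth_near_eventually[OF fg(1)] smooth_near_eventually[OF fg(2)] by eventually_elim auto
  \<comment> \<open>The rules are proved for an arbitrary pair of fields so that they serve for both
    orders of \<open>X\<close> and \<open>Y\<close>. By \<open>evf\<close> the inner vector acts as
    a derivation on smooth germs at all \<open>q\<close> near \<open>p\<close>, so the inner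
    expression may be rewritten before the outer vector is applied.\<close>
  have add: "Z p (\<lambda>q. Z' q (\<lambda>x. f x + g x)) = Z p (\<lambda>q. Z' q f) + Z p (\<lambda>q. Z' q g)"
    and mult: "Z p (\<lambda>q. Z' q (\<lambda>x. f x * g x)) =
       Z p (\<lambda>q. Z' q f) * g p + Z' p f * Z p g + (Z p f * Z' p g + f p * Z p (\<lambda>q. Z' q g))"
    and scale: "Z p (\<lambda>q. Z' q (\<lambda>x. r * f x)) = r * Z p (\<lambda>q. Z' q f)"
    and cong: "\<forall>\<^sub>F q in nhds p. f q = g q \<Longrightarrow> Z p (\<lambda>q. Z' q f) = Z p (\<lambda>q. Z' q g)"
    if Z: "vector_field A W Z" "vector_field A W Z'" for Z Z' r
  proof -
    note t = vector_field_tangent[OF Z(1) W(2)] and s = vector_field_smooth_near[OF Z(2) W]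
    have "Z p (\<lambda>q. Z' q (\<lambda>x. f x + g x)) = Z p (\<lambda>q. Z' q f + Z' q g)"
      by (rule tangent_cong[OF t s[OF smooth_near_add[OF fg]] eventually_mono[OF evf]])
         (auto intro: tangent_add[OF vector_field_tangent[OF Z(2)]])
    then show "Z p (\<lambda>q. Z' q (\<lambda>x. f x + g x)) = Z p (\<lambda>q. Z' q f) + Z p (\<lambda>q. Z' q g)"
      using tangent_add[OF t s[OF fg(1)] s[OF fg(2)]] by simp
    have "Z p (\<lambda>q. Z' q (\<lambda>x. f x * g x)) = Z p (\<lambda>q. Z' q f * g q + f q * Z' q g)"
      by (rule tangent_cong[OF t s[OF smooth_near_mult[OF fg]] eventually_mono[OF evf]])
         (auto intro: tangent_mult[OF vector_field_tangent[OF Z(2)]])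
    also have "\<dots> = Z p (\<lambda>q. Z' q f * g q) + Z p (\<lambda>q. f q * Z' q g)"
      by (intro tangent_add[OF t] smooth_near_mult s fg)
    also have "\<dots> = Z p (\<lambda>q. Z' q f) * g p + Z' p f * Z p g + (Z p f * Z' p g + f p * Z p (\<lambda>q. Z' q g))"
      using tangent_mult[OF t s[OF fg(1)] fg(2)] tangent_mult[OF t fg(1) s[OF fg(2)]] by simp
    finally show "Z p (\<lambda>q. Z' q (\<lambda>x. f x * g x)) =
       Z p (\<lambda>q. Z' q f) * g p + Z' p f * Z p g + (Z p f * Z' p g + f p * Z p (\<lambda>q. Z' q g))" .
    have "Z p (\<lambda>q. Z' q (\<lambda>x. r * f x)) = Z p (\<lambda>q. r * Z' q f)"
      by (rule tangent_cong[OF t s[OF smooth_near_mult[OF smooth_near_const fg(1)]] eventually_mono[OF evf]])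
         (auto intro: tangent_scale[OF vector_field_tangent[OF Z(2)]])
    then show "Z p (\<lambda>q. Z' q (\<lambda>x. r * f x)) = r * Z p (\<lambda>q. Z' q f)"
      using tangent_scale[OF t s[OF fg(1)]] by simp
    assume "\<forall>\<^sub>F q in nhds p. f q = g q"
    \<comment> \<open>Functions that agree near \<open>p\<close> have equal germs at every point
      near \<open>p\<close>, so the inner derivatives agree near \<open>p\<close> too.\<close>
    then have "\<forall>\<^sub>F q in nhds p. (\<forall>\<^sub>F q in nhds q. f q = g q) \<and> q \<in> W \<and> smooth_near A q f"
      using evf by (simp add: eventually_conj_iff eventually_eventually)
    then show "Z p (\<lambda>q. Z' q f) = Z p (\<lambda>q. Z' q g)"
      by (intro tangent_cong[OF t s[OF fg(1)]]) (auto elim!: eventually_mono intro: tangent_cong[OF vector_field_tangent[OF Z(2)]])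
  qed
  note ap = lie_bracket_apply fg smooth_near_add smooth_near_mult smooth_near_const
  show "lie_bracket A X Y p (\<lambda>x. f x + g x) = lie_bracket A X Y p f + lie_bracket A X Y p g"
    using add[OF X Y] add[OF Y X] by (simp add: ap)
  show "lie_bracket A X Y p (\<lambda>x. f x * g x) = lie_bracket A X Y p f * g p + f p * lie_bracket A X Y p g"
    using mult[OF X Y] mult[OF Y X] by (simp add: ap algebra_simps)
  show "lie_bracket A X Y p (\<lambda>x. r * f x) = r * lie_bracket A X Y p f" for r
    using scale[OF X Y] scale[OF Y X] by (simp add: ap algebra_simps)
  show "\<forall>\<^sub>F q in nhds p. f q = g q \<Longrightarrow> lie_bracket A X Y p f = lie_bracket A X Y p g"
    using cong[OF X Y] cong[OF Y X] by (simp add: ap)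
qed (auto simp: lie_bracket_def)

lemma lie_bracket_vector_field:
  assumes W: "open W" and X: "vector_field A W X" and Y: "vector_field A W Y"
  shows "vector_field A W (lie_bracket A X Y)"
  unfolding vector_field_def
proof (intro conjI ballI allI impI)
  fix V f assume V: "open V \<and> V \<subseteq> W \<and> smooth_fun A V f"
  have "smooth_fun A V (\<lambda>p. X p (\<lambda>q. Y q f) - Y p (\<lambda>q. X q f))"
    using V by (intro smooth_fun_diff vector_field_smooth[OF X] vector_field_smooth[OF Y]) auto
  then show "smooth_fun A V (\<lambda>p. lie_bracket A X Y p f)"
    by (rule smooth_fun_cong[rotated]) (use V in \<open>auto intro!: lie_bracket_apply[symmetric] smooth_nearI\<close>)
qed (rule lie_bracket_tangent[OF W _ X Y])

text \<open>By the expansion, a tangent vector is determined by its values on the coordinate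
  functions. A coordinate field takes those to constants, which the second field kills.\<close>

lemma lie_bracket_coord_field:
  assumes c: "(U, c) \<in> A" and p: "p \<in> U"
  shows "lie_bracket A (coord_field A (U, c) i) (coord_field A (U, c) j) p = 0"
proof -
  have 0: "coord_field A (U, c) i p (\<lambda>q. coord_field A (U, c) j q (\<lambda>x. c x \<bullet> b)) = 0" for i j b
  proof -
    have "coord_field A (U, c) i p (\<lambda>q. coord_field A (U, c) j q (\<lambda>x. c x \<bullet> b)) = coord_field A (U, c) i p (\<lambda>q. j \<bullet> b)"
    proof (rule tangent_cong[OF coord_field_tangent[OF c p]])
      show "smooth_near A p (\<lambda>q. coord_field A (U, c) j q (\<lambda>x. c x \<bullet> b))"
        by (rule vector_field_smooth_near[OF coord_vector_field[OF c] chart_open[OF c] p smooth_near_coord[OF c p]])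
      show "\<forall>\<^sub>F q in nhds p. coord_field A (U, c) j q (\<lambda>x. c x \<bullet> b) = j \<bullet> b"
        unfolding eventually_nhds using coord_field_coord[OF c] chart_open[OF c] p by blast
    qed
    then show ?thesis using tangent_const[OF coord_field_tangent[OF c p]] by simp
  qed
  show ?thesis
    by (subst tangent_space_expansion[OF c p lie_bracket_tangent[OF chart_open[OF c] p coord_vector_field[OF c] coord_vector_field[OF c]]])
       (simp add: lie_bracket_apply[OF smooth_near_coord[OF c p]] 0)
qed

end

section \<open>The differential of a smooth map\<close>

lemma differential_add: "differential B f p (v + w) = differential B f p v + differential B f p w"
  and differential_scale: "differential B f p (r *\<^sub>R v) = r *\<^sub>R differential B f p v"
  and differential_diff: "differential B f p (v - w) = differential B f p v - differential B f p w"
  by (auto simp: differential_def fun_eq_iff)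

lemma differential_tangent:
  assumes A: "smooth_manifold A" and B: "smooth_manifold B" and f: "smooth_map A B f"
    and v: "v \<in> tangent_space A p"
  shows "differential B f p v \<in> tangent_space B (f p)"
proof -
  interpret A: manifold A using A by unfold_locales
  interpret B: manifold B using B by unfold_locales
  have s: "smooth_near A p (\<lambda>x. h (f x))" if "smooth_near B (f p) h" for h
    using smooth_near_comp[OF A B f that] by (simp add: o_def)
  show ?thesis
  proof (rule B.tangentI)
    fix g h assume gh: "smooth_near B (f p) g" "smooth_near B (f p) h"
    note ap = gh B.smooth_near_add B.smooth_near_mult B.smooth_near_const differential_def s o_def
      A.tangent_add[OF v] A.tangent_mult[OF v] A.tangent_scale[OF v]
    show "differential B f p v (\<lambda>x. g x + h x) = differential B f p v g + differential B f p v h"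
      "differential B f p v (\<lambda>x. g x * h x) = differential B f p v g * h (f p) + g (f p) * differential B f p v h"
      "differential B f p v (\<lambda>x. r * g x) = r * differential B f p v g" for r
      by (simp_all add: ap)
    assume "\<forall>\<^sub>F x in nhds (f p). g x = h x"
    \<comment> \<open>Continuity pulls an equality of germs at \<open>f p\<close> back to an
      equality of germs at \<open>p\<close>.\<close>
    moreover have "filterlim f (nhds (f p)) (nhds p)"
      using f unfolding smooth_map_def
      by (metis UNIV_I continuous_on_eq_continuous_at isCont_def open_UNIV tendsto_at_iff_tendsto_nhds)
    ultimately have "\<forall>\<^sub>F x in nhds p. g (f x) = h (f x)"
      by (rule eventually_compose_filterlim)
    then show "differential B f p v g = differential B f p v h"
      using A.tangent_cong[OF v s[OF gh(1)]] by (simp add: gh differential_def o_def)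
  qed (auto simp: differential_def)
qed

section \<open>The connection along a map\<close>

lemma linear_on_subspace_0:
  assumes "subspace S" "linear_on_subspace S L"
  shows "L 0 = 0"
  using assms subspace_0[OF assms(1)] unfolding linear_on_subspace_def by (metis scale_zero_left)

lemma linear_on_subspace_sum:
  assumes S: "subspace S" and L: "linear_on_subspace S L"
  shows "(\<And>i. i \<in> I \<Longrightarrow> x i \<in> S) \<Longrightarrow> L (\<Sum>i\<in>I. r i *\<^sub>R x i) = (\<Sum>i\<in>I. r i *\<^sub>R L (x i))"
proof (induction I rule: infinite_finite_induct)
  case (insert i I)
  then have "r i *\<^sub>R x i \<in> S" "(\<Sum>i\<in>I. r i *\<^sub>R x i) \<in> S"
    by (auto intro!: subspace_scale[OF S] subspace_sum[OF S])
  then show ?case using insert L by (simp add: linear_on_subspace_def)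
qed (simp_all add: linear_on_subspace_0[OF S L])

locale manifold_connection = manifold A
  for A :: "('a::{t2_space, second_countable_topology}, 'e::euclidean_space) chart set" +
  fixes nab :: "'a connection"
  assumes affine: "affine_connection A nab"
begin

lemma connection_linear:
  "open W \<Longrightarrow> vector_field A W Y \<Longrightarrow> p \<in> W \<Longrightarrow> linear_on_subspace (tangent_space A p) (\<lambda>v. nab p v Y)"
  using affine unfolding affine_connection_def by blast

lemma
  assumes "open W" "vector_field A W Y" "p \<in> W" "v \<in> tangent_space A p"
  shows connection_tangent: "nab p v Y \<in> tangent_space A p"
    and connection_add: "vector_field A W Z \<Longrightarrow> nab p v (\<lambda>q. Y q + Z q) = nab p v Y + nab p v Z"
    and connection_scale: "smooth_fun A W f \<Longrightarrow> nab p v (\<lambda>q. f q *\<^sub>R Y q) = v f *\<^sub>R Y p + f p *\<^sub>R nab p v Y"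
    and connection_cong: "\<forall>\<^sub>F q in nhds p. Y q = Z q \<Longrightarrow> nab p v Y = nab p v Z"
  using affine[unfolded affine_connection_def, rule_format, of W Y] assms
  by (auto simp: plus_fun_def)

lemma connection_sum:
  assumes W: "open W" "p \<in> W" and v: "v \<in> tangent_space A p"
  shows "(\<And>i. i \<in> I \<Longrightarrow> smooth_fun A W (F i) \<and> vector_field A W (Y i)) \<Longrightarrow>
    nab p v (\<lambda>q. \<Sum>i\<in>I. F i q *\<^sub>R Y i q) = (\<Sum>i\<in>I. v (F i) *\<^sub>R Y i p + F i p *\<^sub>R nab p v (Y i))"
proof -
  \<comment> \<open>Additivity with both summands zero makes this value equal to twice
    itself.\<close>
  have zero: "nab p v (\<lambda>q. 0) = 0"
    using connection_add[OF W(1) vector_field_zero W(2) v vector_field_zero]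
    unfolding add_0_left by (metis add_cancel_left_left)
  show "(\<And>i. i \<in> I \<Longrightarrow> smooth_fun A W (F i) \<and> vector_field A W (Y i)) \<Longrightarrow> ?thesis"
  proof (induction I rule: infinite_finite_induct)
    case (insert i I)
    then have 1: "vector_field A W (\<lambda>q. F i q *\<^sub>R Y i q)" and 2: "vector_field A W (\<lambda>q. \<Sum>i\<in>I. F i q *\<^sub>R Y i q)"
      by (simp_all add: vector_field_scale vector_field_sum)
    have 3: "nab p v (\<lambda>q. F i q *\<^sub>R Y i q) = v (F i) *\<^sub>R Y i p + F i p *\<^sub>R nab p v (Y i)"
      by (rule connection_scale[OF W(1) _ W(2) v]) (simp_all add: insert.prems)
    have IH: "nab p v (\<lambda>q. \<Sum>i\<in>I. F i q *\<^sub>R Y i q) = (\<Sum>i\<in>I. v (F i) *\<^sub>R Y i p + F i p *\<^sub>R nab p v (Y i))"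
      by (rule insert.IH) (simp add: insert.prems)
    show ?case
      unfolding sum.insert[OF insert.hyps] connection_add[OF W(1) 1 W(2) v 2] 3 IH ..
  qed (simp_all only: sum.empty sum.infinite zero simp_thms)
qed

end

text \<open>Smoothness near \<open>p\<close> of a section of the pulled back tangent bundle, tested
  on functions smooth near \<open>f p\<close>. Applied to coordinate functions it yields smooth
  components, on which the tangent vector in \<open>connection_along\<close> can act by its
  derivation rules.\<close>

definition field_along ::
    "('a::topological_space, 'e::euclidean_space) chart set \<Rightarrow>
     ('b::topological_space, 'd::euclidean_space) chart set \<Rightarrow> ('a \<Rightarrow> 'b) \<Rightarrow> 'a \<Rightarrow> ('a \<Rightarrow> 'b tvec) \<Rightarrow> bool" where
  "field_along A B f p V \<longleftrightarrow> (\<forall>q. V q \<in> tangent_space B (f q)) \<and>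
     (\<forall>h. smooth_near B (f p) h \<longrightarrow> smooth_near A p (\<lambda>q. V q h))"

locale map_into_manifold = A: manifold A + B: manifold_connection B nab
  for A :: "('a::{t2_space, second_countable_topology}, 'e::euclidean_space) chart set"
    and B :: "('b::{t2_space, second_countable_topology}, 'd::euclidean_space) chart set"
    and nab :: "'b connection" +
  fixes f :: "'a \<Rightarrow> 'b"
  assumes smooth: "smooth_map A B f"
begin

lemma open_vimage_map: "open W \<Longrightarrow> open (f -` W)"
  using smooth by (auto simp: smooth_map_def intro: open_vimage)

lemma differential_tangent_space: "v \<in> tangent_space A p \<Longrightarrow> differential B f p v \<in> tangent_space B (f p)"
  by (rule differential_tangent[OF A.smooth_manifold B.smooth_manifold smooth])

lemma smooth_near_map: "smooth_near B (f p) h \<Longrightarrow> smooth_near A p (\<lambda>x. h (f x))"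
  using smooth_near_comp[OF A.smooth_manifold B.smooth_manifold smooth] by (simp add: o_def)

text \<open>The chart selected by \<open>SOME\<close> depends on \<open>p\<close> alone. Naming it
  once for all \<open>v\<close> and \<open>V\<close> lets different derivatives at \<open>p\<close>
  be compared term by term in the same frame.\<close>

lemma connection_along_chart:
  obtains U c where "(U, c) \<in> B" "f p \<in> U"
    "\<And>v V. connection_along B nab f p v V =
      (\<Sum>b\<in>Basis. v (\<lambda>q. V q (\<lambda>x. c x \<bullet> b)) *\<^sub>R coord_field B (U, c) b (f p) +
        V p (\<lambda>x. c x \<bullet> b) *\<^sub>R nab (f p) (differential B f p v) (coord_field B (U, c) b))"
proof -
  let ?K = "SOME K. K \<in> B \<and> f p \<in> fst K"
  obtain U0 c0 where "(U0, c0) \<in> B" "f p \<in> U0" using B.obtain_chart by blast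
  then have "?K \<in> B \<and> f p \<in> fst ?K" using someI[of "\<lambda>K. K \<in> B \<and> f p \<in> fst K" "(U0, c0)"] by simp
  moreover obtain U c where K: "?K = (U, c)" by fastforce
  ultimately have "(U, c) \<in> B" "f p \<in> U" by auto
  then show ?thesis
    by (rule that) (simp only: connection_along_def Let_def K fst_conv snd_conv)
qed

text \<open>For \<open>q\<close> near \<open>p\<close> the function \<open>h\<close> is still smooth
  near \<open>f q\<close>, so the default value in \<open>differential\<close> is not taken
  there.\<close>

lemma eventually_differential_apply:
  assumes h: "smooth_near B (f p) h"
  shows "\<forall>\<^sub>F q in nhds p. \<forall>v. differential B f q v h = v (\<lambda>x. h (f x))"
proof -
  obtain W where W: "open W" "f p \<in> W" "smooth_fun B W h" using h by (auto simp: smooth_near_def)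
  show ?thesis
    unfolding eventually_nhds
    by (intro exI[of _ "f -` W"])
       (use W B.smooth_nearI in \<open>auto simp: open_vimage_map differential_def o_def\<close>)
qed

lemma field_along_differential:
  assumes Y: "vector_field A UNIV Y"
  shows "field_along A B f p (\<lambda>q. differential B f q (Y q))"
  unfolding field_along_def
proof (intro conjI allI impI)
  show "differential B f q (Y q) \<in> tangent_space B (f q)" for q
    using differential_tangent_space A.vector_field_tangent[OF Y] by simp
  fix h assume h: "smooth_near B (f p) h"
  have "smooth_near A p (\<lambda>q. Y q (\<lambda>x. h (f x)))"
    by (rule A.vector_field_smooth_near[OF Y open_UNIV UNIV_I smooth_near_map[OF h]])
  then show "smooth_near A p (\<lambda>q. differential B f q (Y q) h)"
    by (rule A.smooth_near_cong) (use eventually_differential_apply[OF h] in eventually_elim, simp)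
qed

lemma endo_tensor_linear:
  assumes "endo_tensor B \<phi>"
  shows "linear_on_subspace (tangent_space B q) (\<phi> q)"
    "v \<in> tangent_space B q \<Longrightarrow> \<phi> q v \<in> tangent_space B q"
  using assms unfolding endo_tensor_def by auto

lemma endo_tensor_expansion:
  assumes \<phi>: "endo_tensor B \<phi>" and c: "(U, c) \<in> B" "q \<in> U" and v: "v \<in> tangent_space B q"
  shows "\<phi> q v = (\<Sum>b\<in>Basis. v (\<lambda>x. c x \<bullet> b) *\<^sub>R \<phi> q (coord_field B (U, c) b q))"
proof -
  have "\<phi> q v = \<phi> q (\<Sum>b\<in>Basis. v (\<lambda>x. c x \<bullet> b) *\<^sub>R coord_field B (U, c) b q)"
    using B.tangent_space_expansion[OF c v] by simp
  also have "\<dots> = (\<Sum>b\<in>Basis. v (\<lambda>x. c x \<bullet> b) *\<^sub>R \<phi> q (coord_field B (U, c) b q))"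
    by (intro linear_on_subspace_sum[OF B.tangent_subspace endo_tensor_linear(1)[OF \<phi>]] B.coord_field_tangent[OF c])
  finally show ?thesis .
qed

text \<open>Smoothness of \<phi> is stated for vector fields on the ambient manifold, and
  \<open>V\<close> is not one. Expanding \<open>V\<close> in the coordinate frame reduces the claim
  to the images of the frame fields, which are smooth and pull back along \<open>f\<close>.\<close>

lemma field_along_endo:
  assumes \<phi>: "endo_tensor B \<phi>" and V: "field_along A B f p V"
  shows "field_along A B f p (\<lambda>q. \<phi> (f q) (V q))"
  unfolding field_along_def
proof (intro conjI allI impI)
  have Vt: "V q \<in> tangent_space B (f q)" for q using V by (simp add: field_along_def)
  then show "\<phi> (f q) (V q) \<in> tangent_space B (f q)" for q
    using endo_tensor_linear(2)[OF \<phi>] by blast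
  fix h assume h: "smooth_near B (f p) h"
  obtain U c where c: "(U, c) \<in> B" "f p \<in> U" using B.obtain_chart by blast
  have "vector_field B U (\<lambda>q. \<phi> q (coord_field B (U, c) b q))" for b
    using \<phi> B.coord_vector_field[OF c(1)] B.chart_open[OF c(1)] by (simp add: endo_tensor_def)
  then have "smooth_near A p (\<lambda>q. \<phi> (f q) (coord_field B (U, c) b (f q)) h)" for b
    using smooth_near_map[OF B.vector_field_smooth_near[OF _ B.chart_open[OF c(1)] c(2) h]] by blast
  then have "smooth_near A p (\<lambda>q. \<Sum>b\<in>Basis. V q (\<lambda>x. c x \<bullet> b) * \<phi> (f q) (coord_field B (U, c) b (f q)) h)"
    using V B.smooth_near_coord[OF c]
    by (intro A.smooth_near_sum A.smooth_near_mult) (auto simp: field_along_def)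
  moreover have "\<forall>\<^sub>F q in nhds p. f q \<in> U"
    unfolding eventually_nhds using open_vimage_map[OF B.chart_open[OF c(1)]] c(2) by blast
  then have "\<forall>\<^sub>F q in nhds p. (\<Sum>b\<in>Basis. V q (\<lambda>x. c x \<bullet> b) * \<phi> (f q) (coord_field B (U, c) b (f q)) h)
      = \<phi> (f q) (V q) h"
    by eventually_elim (simp add: endo_tensor_expansion[OF \<phi> c(1) _ Vt] sum_fun_apply)
  ultimately show "smooth_near A p (\<lambda>q. \<phi> (f q) (V q) h)"
    by (rule A.smooth_near_cong)
qed

lemma connection_along_tangent:
  assumes "v \<in> tangent_space A p"
  shows "connection_along B nab f p v V \<in> tangent_space B (f p)"
proof -
  obtain U c where c: "(U, c) \<in> B" "f p \<in> U"
    and L: "\<And>v V. connection_along B nab f p v V =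
      (\<Sum>b\<in>Basis. v (\<lambda>q. V q (\<lambda>x. c x \<bullet> b)) *\<^sub>R coord_field B (U, c) b (f p) +
        V p (\<lambda>x. c x \<bullet> b) *\<^sub>R nab (f p) (differential B f p v) (coord_field B (U, c) b))"
    using connection_along_chart[of p] by blast
  show ?thesis
    unfolding L
    by (intro subspace_sum subspace_add subspace_scale B.tangent_subspace B.coord_field_tangent[OF c]
        B.connection_tangent[OF B.chart_open[OF c(1)] B.coord_vector_field[OF c(1)] c(2)]
        differential_tangent_space assms)
qed

lemma connection_along_minus:
  assumes v: "v \<in> tangent_space A p" and V: "field_along A B f p V"
  shows "connection_along B nab f p v (\<lambda>q. - V q) = - connection_along B nab f p v V"
proof -
  obtain U c where c: "(U, c) \<in> B" "f p \<in> U"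
    and L: "\<And>v V. connection_along B nab f p v V =
      (\<Sum>b\<in>Basis. v (\<lambda>q. V q (\<lambda>x. c x \<bullet> b)) *\<^sub>R coord_field B (U, c) b (f p) +
        V p (\<lambda>x. c x \<bullet> b) *\<^sub>R nab (f p) (differential B f p v) (coord_field B (U, c) b))"
    using connection_along_chart[of p] by blast
  have "v (\<lambda>q. - V q (\<lambda>x. c x \<bullet> b)) = - v (\<lambda>q. V q (\<lambda>x. c x \<bullet> b))" for b
    using A.tangent_scale[OF v, of "\<lambda>q. V q (\<lambda>x. c x \<bullet> b)" "-1"] V B.smooth_near_coord[OF c]
    by (simp add: field_along_def)
  then show ?thesis
    unfolding L by (simp add: sum_negf[symmetric])
qed

text \<open>Let \<open>\<Phi>\<close> be the matrix of \<phi> in the coordinate frame. Parallelism,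
  applied to each frame field, expresses \<phi> of its derivative through derivatives of
  \<open>\<Phi>\<close> (\<open>nabE\<close>). The Leibniz rule for the components of
  \<open>\<phi> V\<close>, which are sums of components of \<open>V\<close> times
  \<open>\<Phi> \<circ> f\<close>, produces the same terms.\<close>

lemma connection_along_parallel_endo:
  assumes \<phi>: "endo_tensor B \<phi>"
    and par: "\<And>W Y q w. open W \<Longrightarrow> vector_field B W Y \<Longrightarrow> q \<in> W \<Longrightarrow> w \<in> tangent_space B q \<Longrightarrow>
      nab q w (\<lambda>x. \<phi> x (Y x)) = \<phi> q (nab q w Y)"
    and v: "v \<in> tangent_space A p" and V: "field_along A B f p V"
  shows "connection_along B nab f p v (\<lambda>q. \<phi> (f q) (V q)) = \<phi> (f p) (connection_along B nab f p v V)"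
proof -
  obtain U c where c: "(U, c) \<in> B" "f p \<in> U"
    and L: "\<And>v V. connection_along B nab f p v V =
      (\<Sum>b\<in>Basis. v (\<lambda>q. V q (\<lambda>x. c x \<bullet> b)) *\<^sub>R coord_field B (U, c) b (f p) +
        V p (\<lambda>x. c x \<bullet> b) *\<^sub>R nab (f p) (differential B f p v) (coord_field B (U, c) b))"
    using connection_along_chart[of p] by blast
  let ?y = "\<lambda>b x. c x \<bullet> b"
  define E where "E = coord_field B (U, c)"
  define w where "w = differential B f p v"
  define \<Phi> where "\<Phi> b i q = \<phi> q (E b q) (?y i)" for b i q
  have U: "open U" using B.chart_open[OF c(1)] .
  have w: "w \<in> tangent_space B (f p)" unfolding w_def by (rule differential_tangent_space[OF v])
  have E: "vector_field B U (E b)" for b unfolding E_def by (rule B.coord_vector_field[OF c(1)])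
  have Et: "E b q \<in> tangent_space B q" if "q \<in> U" for b q
    using B.vector_field_tangent[OF E that] .
  have \<phi>E: "vector_field B U (\<lambda>q. \<phi> q (E b q))" for b
    using \<phi> E U by (simp add: endo_tensor_def)
  have \<Phi>_smooth: "smooth_fun B U (\<Phi> b i)" for b i
    unfolding \<Phi>_def by (rule B.vector_field_smooth[OF \<phi>E U subset_refl B.smooth_fun_coord[OF c(1)]])
  have \<Phi>_expand: "\<phi> q (E b q) = (\<Sum>i\<in>Basis. \<Phi> b i q *\<^sub>R E i q)" if "q \<in> U" for b q
    using B.tangent_space_expansion[OF c(1) that B.vector_field_tangent[OF \<phi>E that]]
    unfolding \<Phi>_def E_def .
  have nabE: "\<phi> (f p) (nab (f p) w (E b)) = (\<Sum>i\<in>Basis. w (\<Phi> b i) *\<^sub>R E i (f p) + \<Phi> b i (f p) *\<^sub>R nab (f p) w (E i))" for b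
  proof -
    have "\<phi> (f p) (nab (f p) w (E b)) = nab (f p) w (\<lambda>q. \<phi> q (E b q))"
      using par[OF U E c(2) w] by simp
    also have "\<dots> = nab (f p) w (\<lambda>q. \<Sum>i\<in>Basis. \<Phi> b i q *\<^sub>R E i q)"
    proof (rule B.connection_cong[OF U \<phi>E c(2) w])
      show "\<forall>\<^sub>F q in nhds (f p). \<phi> q (E b q) = (\<Sum>i\<in>Basis. \<Phi> b i q *\<^sub>R E i q)"
        unfolding eventually_nhds using U c(2) \<Phi>_expand by blast
    qed
    also have "\<dots> = (\<Sum>i\<in>Basis. w (\<Phi> b i) *\<^sub>R E i (f p) + \<Phi> b i (f p) *\<^sub>R nab (f p) w (E i))"
      by (rule B.connection_sum[OF U c(2) w]) (simp add: \<Phi>_smooth E)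
    finally show ?thesis .
  qed
  have Vt: "V q \<in> tangent_space B (f q)" for q using V by (simp add: field_along_def)
  have Vs: "smooth_near A p (\<lambda>q. V q (?y b))" for b
    using V B.smooth_near_coord[OF c] by (simp add: field_along_def)
  have \<phi>V: "\<phi> (f q) (V q) (?y i) = (\<Sum>b\<in>Basis. V q (?y b) * \<Phi> b i (f q))" if "f q \<in> U" for q i
    using endo_tensor_expansion[OF \<phi> c(1) that Vt] by (simp add: sum_fun_apply \<Phi>_def E_def)
  have \<Phi>f: "smooth_near A p (\<lambda>q. \<Phi> b i (f q))" for b i
    by (rule smooth_near_map[OF B.smooth_nearI[OF U c(2) \<Phi>_smooth]])
  \<comment> \<open>The chain rule \<open>v (\<Phi> b i \<circ> f) = w (\<Phi> b i)\<close> used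
    here is the definition of the differential, since \<open>\<Phi> b i\<close> is smooth near
    \<open>f p\<close>.\<close>
  have v\<phi>V: "v (\<lambda>q. \<phi> (f q) (V q) (?y i)) = (\<Sum>b\<in>Basis. v (\<lambda>q. V q (?y b)) * \<Phi> b i (f p) + V p (?y b) * w (\<Phi> b i))" for i
  proof -
    have "\<forall>\<^sub>F q in nhds p. f q \<in> U"
      unfolding eventually_nhds using open_vimage_map[OF U] c(2) by blast
    then have "\<forall>\<^sub>F q in nhds p. \<phi> (f q) (V q) (?y i) = (\<Sum>b\<in>Basis. V q (?y b) * \<Phi> b i (f q))"
      by eventually_elim (rule \<phi>V)
    moreover have "smooth_near A p (\<lambda>q. \<phi> (f q) (V q) (?y i))"
      using field_along_endo[OF \<phi> V] B.smooth_near_coord[OF c] by (simp add: field_along_def)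
    ultimately have "v (\<lambda>q. \<phi> (f q) (V q) (?y i)) = v (\<lambda>q. \<Sum>b\<in>Basis. V q (?y b) * \<Phi> b i (f q))"
      by (intro A.tangent_cong[OF v])
    also have "\<dots> = (\<Sum>b\<in>Basis. v (\<lambda>q. V q (?y b) * \<Phi> b i (f q)))"
      by (intro A.tangent_sum[OF v] A.smooth_near_mult Vs \<Phi>f)
    also have "\<dots> = (\<Sum>b\<in>Basis. v (\<lambda>q. V q (?y b)) * \<Phi> b i (f p) + V p (?y b) * w (\<Phi> b i))"
      using B.smooth_nearI[OF U c(2) \<Phi>_smooth]
      by (simp add: A.tangent_mult[OF v Vs \<Phi>f] w_def differential_def o_def)
    finally show ?thesis .
  qed
  have "connection_along B nab f p v (\<lambda>q. \<phi> (f q) (V q)) =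
     (\<Sum>i\<in>Basis. v (\<lambda>q. \<phi> (f q) (V q) (?y i)) *\<^sub>R E i (f p) + \<phi> (f p) (V p) (?y i) *\<^sub>R nab (f p) w (E i))"
    unfolding L w_def E_def ..
  also have "\<dots> = (\<Sum>i\<in>Basis. \<Sum>b\<in>Basis. v (\<lambda>q. V q (?y b)) *\<^sub>R \<Phi> b i (f p) *\<^sub>R E i (f p) +
      V p (?y b) *\<^sub>R (w (\<Phi> b i) *\<^sub>R E i (f p) + \<Phi> b i (f p) *\<^sub>R nab (f p) w (E i)))"
    by (simp add: v\<phi>V \<phi>V[OF c(2)] scaleR_sum_left sum.distrib[symmetric] scaleR_add_left scaleR_add_right add_ac)
  \<comment> \<open>Regrouped by the frame index \<open>b\<close> of \<open>V\<close>, the inner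
    sums over \<open>i\<close> become \<phi> of \<open>E b\<close> and \<phi> of its covariant
    derivative.\<close>
  also have "\<dots> = (\<Sum>b\<in>Basis. \<Sum>i\<in>Basis. v (\<lambda>q. V q (?y b)) *\<^sub>R \<Phi> b i (f p) *\<^sub>R E i (f p) +
      V p (?y b) *\<^sub>R (w (\<Phi> b i) *\<^sub>R E i (f p) + \<Phi> b i (f p) *\<^sub>R nab (f p) w (E i)))"
    by (rule sum.swap)
  also have "\<dots> = (\<Sum>b\<in>Basis. v (\<lambda>q. V q (?y b)) *\<^sub>R \<phi> (f p) (E b (f p)) + V p (?y b) *\<^sub>R \<phi> (f p) (nab (f p) w (E b)))"
    by (simp only: nabE \<Phi>_expand[OF c(2)] sum.distrib scaleR_sum_right scaleR_add_right)
  also have "\<dots> = \<phi> (f p) (\<Sum>b\<in>Basis. v (\<lambda>q. V q (?y b)) *\<^sub>R E b (f p)) + \<phi> (f p) (\<Sum>b\<in>Basis. V p (?y b) *\<^sub>R nab (f p) w (E b))"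
    unfolding sum.distrib
    by (intro arg_cong2[where f = "(+)"] linear_on_subspace_sum[OF B.tangent_subspace endo_tensor_linear(1)[OF \<phi>], symmetric]
        Et[OF c(2)] B.connection_tangent[OF U E c(2) w])
  also have "\<dots> = \<phi> (f p) (\<Sum>b\<in>Basis. v (\<lambda>q. V q (?y b)) *\<^sub>R E b (f p) + V p (?y b) *\<^sub>R nab (f p) w (E b))"
  proof -
    have "(\<Sum>b\<in>Basis. v (\<lambda>q. V q (?y b)) *\<^sub>R E b (f p)) \<in> tangent_space B (f p)"
      "(\<Sum>b\<in>Basis. V p (?y b) *\<^sub>R nab (f p) w (E b)) \<in> tangent_space B (f p)"
      by (intro subspace_sum subspace_scale B.tangent_subspace Et[OF c(2)] B.connection_tangent[OF U E c(2) w])+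
    then show ?thesis
      using endo_tensor_linear(1)[OF \<phi>] by (simp add: linear_on_subspace_def sum.distrib)
  qed
  also have "\<dots> = \<phi> (f p) (connection_along B nab f p v V)"
    unfolding L w_def E_def ..
  finally show ?thesis .
qed

text \<open>The vectors \<open>\<Gamma> i j\<close>, whose components are the Christoffel symbols,
  are symmetric in \<open>i\<close> and \<open>j\<close> because coordinate fields commute. Hence
  the terms with \<open>\<Gamma>\<close> cancel, and the derivatives of components that remain are
  the components of the image of the bracket.\<close>

lemma connection_along_torsion_free:
  assumes tor: "\<And>W X Y q. open W \<Longrightarrow> vector_field B W X \<Longrightarrow> vector_field B W Y \<Longrightarrow> q \<in> W \<Longrightarrow>
      nab q (X q) Y - nab q (Y q) X = lie_bracket B X Y q"
    and X: "vector_field A UNIV X" and Y: "vector_field A UNIV Y"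
  shows "connection_along B nab f p (X p) (\<lambda>q. differential B f q (Y q)) -
    connection_along B nab f p (Y p) (\<lambda>q. differential B f q (X q)) =
    differential B f p (lie_bracket A X Y p)"
proof -
  obtain U c where c: "(U, c) \<in> B" "f p \<in> U"
    and L: "\<And>v V. connection_along B nab f p v V =
      (\<Sum>b\<in>Basis. v (\<lambda>q. V q (\<lambda>x. c x \<bullet> b)) *\<^sub>R coord_field B (U, c) b (f p) +
        V p (\<lambda>x. c x \<bullet> b) *\<^sub>R nab (f p) (differential B f p v) (coord_field B (U, c) b))"
    using connection_along_chart[of p] by blast
  let ?y = "\<lambda>b x. c x \<bullet> b" and ?d = "differential B f"
  define E where "E = coord_field B (U, c)"
  define \<Gamma> where "\<Gamma> i j = nab (f p) (E i (f p)) (E j)" for i j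
  have U: "open U" using B.chart_open[OF c(1)] .
  have E: "vector_field B U (E b)" for b unfolding E_def by (rule B.coord_vector_field[OF c(1)])
  have \<Gamma>_sym: "\<Gamma> i j = \<Gamma> j i" for i j
    using tor[OF U E E c(2), of i j] B.lie_bracket_coord_field[OF c] by (simp add: \<Gamma>_def E_def)
  have Xt: "X q \<in> tangent_space A q" and Yt: "Y q \<in> tangent_space A q" for q
    using A.vector_field_tangent[OF X] A.vector_field_tangent[OF Y] by auto
  have ys: "smooth_near B (f p) (?y b)" for b by (rule B.smooth_near_coord[OF c])
  have nabE: "nab (f p) (?d p v) (E b) = (\<Sum>i\<in>Basis. ?d p v (?y i) *\<^sub>R \<Gamma> i b)" if v: "v \<in> tangent_space A p" for v b
  proof -
    have "nab (f p) (?d p v) (E b) = nab (f p) (\<Sum>i\<in>Basis. ?d p v (?y i) *\<^sub>R E i (f p)) (E b)"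
      using B.tangent_space_expansion[OF c differential_tangent_space[OF v]] by (simp add: E_def)
    also have "\<dots> = (\<Sum>i\<in>Basis. ?d p v (?y i) *\<^sub>R \<Gamma> i b)"
      unfolding \<Gamma>_def
      by (rule linear_on_subspace_sum[OF B.tangent_subspace B.connection_linear[OF U E c(2)]])
         (simp add: E_def B.coord_field_tangent[OF c])
    finally show ?thesis .
  qed
  \<comment> \<open>The components of the pushed forward field agree with derivatives of the pulled
    back coordinates only near \<open>p\<close>; locality of \<open>v\<close> makes this
    enough.\<close>
  have der: "v (\<lambda>q. ?d q (Z q) (?y b)) = v (\<lambda>q. Z q (\<lambda>x. ?y b (f x)))"
    if "v \<in> tangent_space A p" "vector_field A UNIV Z" for v Z b
  proof (rule A.tangent_cong[OF that(1)])
    show "smooth_near A p (\<lambda>q. ?d q (Z q) (?y b))"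
      using field_along_differential[OF that(2)] ys by (simp add: field_along_def)
    show "\<forall>\<^sub>F q in nhds p. ?d q (Z q) (?y b) = Z q (\<lambda>x. ?y b (f x))"
      using eventually_differential_apply[OF ys[of b]] by eventually_elim simp
  qed
  have "(\<Sum>b\<in>Basis. ?d p (Y p) (?y b) *\<^sub>R nab (f p) (?d p (X p)) (E b)) =
      (\<Sum>b\<in>Basis. \<Sum>i\<in>Basis. (?d p (Y p) (?y b) * ?d p (X p) (?y i)) *\<^sub>R \<Gamma> i b)"
    by (simp add: nabE[OF Xt] scaleR_sum_right)
  also have "\<dots> = (\<Sum>i\<in>Basis. \<Sum>b\<in>Basis. (?d p (Y p) (?y b) * ?d p (X p) (?y i)) *\<^sub>R \<Gamma> i b)"
    by (rule sum.swap)
  also have "\<dots> = (\<Sum>b\<in>Basis. ?d p (X p) (?y b) *\<^sub>R nab (f p) (?d p (Y p)) (E b))"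
    by (simp add: nabE[OF Yt] scaleR_sum_right \<Gamma>_sym mult_ac)
  finally have \<Gamma>: "(\<Sum>b\<in>Basis. ?d p (Y p) (?y b) *\<^sub>R nab (f p) (?d p (X p)) (E b)) =
      (\<Sum>b\<in>Basis. ?d p (X p) (?y b) *\<^sub>R nab (f p) (?d p (Y p)) (E b))" .
  have "connection_along B nab f p (X p) (\<lambda>q. ?d q (Y q)) - connection_along B nab f p (Y p) (\<lambda>q. ?d q (X q)) =
     (\<Sum>b\<in>Basis. X p (\<lambda>q. Y q (\<lambda>x. ?y b (f x))) *\<^sub>R E b (f p)) - (\<Sum>b\<in>Basis. Y p (\<lambda>q. X q (\<lambda>x. ?y b (f x))) *\<^sub>R E b (f p))"
    using \<Gamma> unfolding L E_def[symmetric] by (simp add: sum.distrib der[OF Xt Y] der[OF Yt X])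
  also have "\<dots> = (\<Sum>b\<in>Basis. ?d p (lie_bracket A X Y p) (?y b) *\<^sub>R E b (f p))"
    by (simp add: sum_subtractf[symmetric] scaleR_diff_left[symmetric] differential_def ys o_def
        A.lie_bracket_apply[OF smooth_near_map[OF ys]])
  also have "\<dots> = ?d p (lie_bracket A X Y p)"
    using B.tangent_space_expansion[OF c differential_tangent_space[OF A.lie_bracket_tangent[OF open_UNIV UNIV_I X Y]]]
    by (simp add: E_def)
  finally show ?thesis .
qed

end

section \<open>Orthogonal projections\<close>

text \<open>Tangent spaces are subspaces of the function type \<open>'a tvec\<close>, and a metric
  is constrained only on vectors of the tangent space. An inner product relative to a carrier
  subspace fits this; every rule asks for membership.\<close>

locale inner_on_subspace =
  fixes S :: "'v::real_vector set" and ip :: "'v \<Rightarrow> 'v \<Rightarrow> real"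
  assumes subspace: "subspace S"
    and linear: "v \<in> S \<Longrightarrow> linear_on_subspace S (ip v)"
    and sym: "v \<in> S \<Longrightarrow> w \<in> S \<Longrightarrow> ip v w = ip w v"
    and pos: "v \<in> S \<Longrightarrow> v \<noteq> 0 \<Longrightarrow> ip v v > 0"
begin

lemma add_right: "u \<in> S \<Longrightarrow> v \<in> S \<Longrightarrow> w \<in> S \<Longrightarrow> ip u (v + w) = ip u v + ip u w"
  and scale_right: "u \<in> S \<Longrightarrow> v \<in> S \<Longrightarrow> ip u (r *\<^sub>R v) = r * ip u v"
  using linear[of u] by (auto simp: linear_on_subspace_def)

lemma add_left: "u \<in> S \<Longrightarrow> v \<in> S \<Longrightarrow> w \<in> S \<Longrightarrow> ip (u + v) w = ip u w + ip v w"
  and scale_left: "u \<in> S \<Longrightarrow> v \<in> S \<Longrightarrow> ip (r *\<^sub>R u) v = r * ip u v"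
  using add_right[of w u v] scale_right[of v u r] sym subspace_add[OF subspace] subspace_scale[OF subspace]
  by metis+

lemma diff_left: "u \<in> S \<Longrightarrow> v \<in> S \<Longrightarrow> w \<in> S \<Longrightarrow> ip (u - v) w = ip u w - ip v w"
  using add_left[of u "-1 *\<^sub>R v" w] scale_left[of v w "-1"] subspace_scale[OF subspace, of v "-1"] by simp

lemma zero_left: "v \<in> S \<Longrightarrow> ip 0 v = 0"
  using scale_left[of v v 0] by simp

lemma zero_right: "v \<in> S \<Longrightarrow> ip v 0 = 0"
  using scale_right[of v v 0] by simp

lemma eq_0_iff: "v \<in> S \<Longrightarrow> ip v v = 0 \<longleftrightarrow> v = 0"
  using pos zero_left by fastforce

lemma orthogonal_span:
  assumes "u \<in> S" "F \<subseteq> S" "\<And>x. x \<in> F \<Longrightarrow> ip u x = 0" "x \<in> span F"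
  shows "ip u x = 0"
proof -
  have "subspace {x \<in> S. ip u x = 0}"
    unfolding subspace_def
    using assms(1) subspace by (auto simp: zero_right add_right scale_right subspace_0 subspace_add subspace_scale)
  then have "span F \<subseteq> {x \<in> S. ip u x = 0}" using assms by (intro span_minimal) auto
  then show ?thesis using assms(4) by blast
qed

text \<open>Gram-Schmidt by induction: \<open>e\<close> is the part of the new vector
  \<open>a\<close> orthogonal to \<open>span F\<close>, and the projection of \<open>w\<close> to
  the larger span gains its component along \<open>e\<close>.\<close>

lemma projection_exists:
  assumes "finite F" "F \<subseteq> S"
  shows "w \<in> S \<Longrightarrow> \<exists>u\<in>span F. \<forall>x\<in>span F. ip (w - u) x = 0"
  using assms
proof (induction F arbitrary: w rule: finite_induct)
  case empty
  then show ?case by (auto simp: zero_right)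
next
  case (insert a F)
  have F: "F \<subseteq> S" "a \<in> S" using insert.prems by auto
  have FS: "span F \<subseteq> S" by (rule span_minimal[OF F(1) subspace])
  obtain u0 where u0: "u0 \<in> span F" "\<forall>x\<in>span F. ip (a - u0) x = 0" using insert.IH F by blast
  obtain u where u: "u \<in> span F" "\<forall>x\<in>span F. ip (w - u) x = 0" using insert.IH insert.prems F by blast
  define e where "e = a - u0"
  have e: "e \<in> S" and uS: "u \<in> S" "u0 \<in> S"
    using u0 u FS F subspace_diff[OF subspace] by (auto simp: e_def)
  \<comment> \<open>The set \<open>F\<close> may be dependent. If \<open>a\<close> already lies in
    \<open>span F\<close>, then \<open>e = 0\<close> and the added term vanishes whatever the
    quotient is.\<close>
  define u' where "u' = u + (ip w e / ip e e) *\<^sub>R e"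
  have u'S: "w - u' \<in> S"
    unfolding u'_def by (intro subspace_diff subspace_add subspace_scale subspace insert.prems e uS)
  have wu': "ip (w - u') x = ip (w - u) x - (ip w e / ip e e) * ip e x" if "x \<in> S" for x
    unfolding u'_def diff_diff_eq[symmetric]
    using that e uS insert.prems subspace subspace_diff subspace_scale by (subst diff_left) (auto simp: scale_left)
  have ox: "ip (w - u') x = 0" if "x \<in> span F" for x
    using wu'[of x] that FS u u0 by (auto simp: e_def)
  have "ip (w - u') e = 0"
  proof (cases "e = 0")
    case False
    then have "ip u e = 0" "ip e e \<noteq> 0"
      using u(1) u0(2) sym[OF uS(1) e] pos[OF e] by (auto simp: e_def)
    then show ?thesis using wu'[OF e] diff_left[OF insert.prems(1) uS(1) e] by simp
  qed (simp add: zero_right u'S)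
  \<comment> \<open>\<open>a = e + u0\<close> with \<open>u0\<close> in \<open>span F\<close>, so
    orthogonality to both summands suffices.\<close>
  then have "ip (w - u') a = 0"
    using ox[OF u0(1)] add_right[OF u'S e uS(2)] by (simp add: e_def)
  then have "ip (w - u') x = 0" if "x \<in> span (insert a F)" for x
    by (intro orthogonal_span[OF u'S insert.prems(2) _ that]) (use ox span_base in blast)
  moreover have "u' \<in> span (insert a F)"
    unfolding u'_def e_def using u(1) u0(1) span_mono[of F "insert a F"]
    by (intro span_add span_scale span_diff span_base[of a]) auto
  ultimately show ?case by blast
qed

end

section \<open>Distributions and smoothness of orthogonal projection\<close>

context manifold
begin

lemma riemannian_inner:
  "riemannian_metric A g \<Longrightarrow> inner_on_subspace (tangent_space A p) (g p)"
  by (simp add: riemannian_metric_def inner_on_subspace_def tangent_subspace)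

lemma distributionE:
  assumes "distribution A k D"
  obtains W X where "open W" "p \<in> W" "\<And>i. i < k \<Longrightarrow> vector_field A W (X i)"
    "\<And>q. q \<in> W \<Longrightarrow> inj_on (\<lambda>i. X i q) {..<k} \<and> independent ((\<lambda>i. X i q) ` {..<k})"
    "\<And>q. q \<in> W \<Longrightarrow> D q = span ((\<lambda>i. X i q) ` {..<k})"
proof -
  have "\<exists>W X. open W \<and> p \<in> W \<and> (\<forall>i<k. vector_field A W (X i)) \<and>
        (\<forall>q\<in>W. inj_on (\<lambda>i. X i q) {..<k} \<and> independent ((\<lambda>i. X i q) ` {..<k}) \<and>
           D q = span ((\<lambda>i. X i q) ` {..<k}))"
    using assms[unfolded distribution_def] by (rule spec)
  then obtain W X where "open W \<and> p \<in> W \<and> (\<forall>i<k. vector_field A W (X i)) \<and>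
        (\<forall>q\<in>W. inj_on (\<lambda>i. X i q) {..<k} \<and> independent ((\<lambda>i. X i q) ` {..<k}) \<and>
           D q = span ((\<lambda>i. X i q) ` {..<k}))"
    by (elim exE)
  then show ?thesis by (intro that[of W X]) simp_all
qed

lemma distribution_subspace:
  assumes "distribution A k D"
  shows "subspace (D p)" "D p \<subseteq> tangent_space A p"
proof -
  obtain W X where W: "p \<in> W" "\<And>i. i < k \<Longrightarrow> vector_field A W (X i)" "D p = span ((\<lambda>i. X i p) ` {..<k})"
    using distributionE[OF assms, of p] by metis
  show "subspace (D p)" by (simp add: W(3))
  show "D p \<subseteq> tangent_space A p"
    unfolding W(3) by (intro span_minimal tangent_subspace) (use W(1,2) vector_field_tangent in auto)
qed

text \<open>Unnormalised Gram--Schmidt, one frame field at a time.\<close>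

lemma smooth_projection:
  fixes X :: "nat \<Rightarrow> 'a field"
  assumes g: "riemannian_metric A g" and W: "open W"
  shows "(\<And>i. i < k \<Longrightarrow> vector_field A W (X i)) \<Longrightarrow>
    (\<And>q. q \<in> W \<Longrightarrow> inj_on (\<lambda>i. X i q) {..<k} \<and> independent ((\<lambda>i. X i q) ` {..<k})) \<Longrightarrow>
    vector_field A W V \<Longrightarrow>
    \<exists>P. vector_field A W P \<and> (\<forall>q\<in>W. P q \<in> span ((\<lambda>i. X i q) ` {..<k}) \<and>
      (\<forall>x\<in>span ((\<lambda>i. X i q) ` {..<k}). g q (V q - P q) x = 0))"
proof (induction k arbitrary: V)
  case 0
  show ?case
  proof (intro exI[of _ "\<lambda>p. 0"] conjI ballI)
    fix q x assume q: "q \<in> W" and "x \<in> span ((\<lambda>i. X i q) ` {..<0})"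
    then have "x = 0" by simp
    then show "g q (V q - 0) x = 0"
      unfolding diff_zero
      using inner_on_subspace.zero_right[OF riemannian_inner[OF g] vector_field_tangent[OF 0(3) q]] by simp
  qed (rule vector_field_zero span_zero)+
next
  case (Suc k)
  let ?F = "\<lambda>k q. (\<lambda>i. X i q) ` {..<k}"
  have ind: "inj_on (\<lambda>i. X i q) {..<k} \<and> independent (?F k q)" if "q \<in> W" for q
    using Suc.prems(2)[OF that] inj_on_subset[of "\<lambda>i. X i q" "{..<Suc k}" "{..<k}"]
      independent_mono[of "?F (Suc k) q" "?F k q"] by (simp add: image_mono)
  have ins: "?F (Suc k) q = insert (X k q) (?F k q)" for q by (simp add: lessThan_Suc)
  have Xk: "vector_field A W (X k)" using Suc.prems(1) by simp
  obtain P0 where P0: "vector_field A W P0" "\<And>q. q \<in> W \<Longrightarrow> P0 q \<in> span (?F k q)"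
    "\<And>q x. q \<in> W \<Longrightarrow> x \<in> span (?F k q) \<Longrightarrow> g q (X k q - P0 q) x = 0"
    using Suc.IH[OF _ ind Xk] Suc.prems(1) less_Suc_eq by metis
  obtain P where P: "vector_field A W P" "\<And>q. q \<in> W \<Longrightarrow> P q \<in> span (?F k q)"
    "\<And>q x. q \<in> W \<Longrightarrow> x \<in> span (?F k q) \<Longrightarrow> g q (V q - P q) x = 0"
    using Suc.IH[OF _ ind Suc.prems(3)] Suc.prems(1) less_Suc_eq by metis
  define E where "E q = X k q - P0 q" for q
  have E: "vector_field A W E" unfolding E_def by (rule vector_field_diff[OF W Xk P0(1)])
  \<comment> \<open>Independence of the frame keeps \<open>E\<close> away from zero on all of
    \<open>W\<close>; this makes the division by \<open>g q (E q) (E q)\<close> below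
    smooth.\<close>
  have E0: "E q \<noteq> 0" if "q \<in> W" for q
  proof
    assume "E q = 0"
    then have "X k q \<in> span (?F k q)" using P0(2)[OF that] by (simp add: E_def)
    \<comment> \<open>Independence concerns the image set and would not notice a repeated frame
      field. Injectivity of the indexing rules that out, so that \<open>X k q\<close> is a genuinely
      new element.\<close>
    moreover have "X k q \<notin> ?F k q"
      using Suc.prems(2)[OF that] inj_onD[of "\<lambda>i. X i q" "{..<Suc k}" k] by fastforce
    ultimately show False
      using Suc.prems(2)[OF that] unfolding ins by (simp add: independent_insert)
  qed
  have EE: "g q (E q) (E q) \<noteq> 0" if "q \<in> W" for q
    using inner_on_subspace.eq_0_iff[OF riemannian_inner[OF g] vector_field_tangent[OF E that]] E0[OF that] by simp
  have gs: "smooth_fun A W (\<lambda>q. g q (Y q) (Z q))" if "vector_field A W Y" "vector_field A W Z" for Y Z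
    using g W that unfolding riemannian_metric_def by blast
  define r where "r q = g q (V q) (E q) * inverse (g q (E q) (E q))" for q
  have r: "smooth_fun A W r"
    unfolding r_def by (intro smooth_fun_mult smooth_fun_inverse gs W E Suc.prems(3) EE)
  let ?P = "\<lambda>q. P q + r q *\<^sub>R E q"
  have "vector_field A W ?P" by (intro vector_field_add vector_field_scale P(1) r E)
  moreover have "?P q \<in> span (?F (Suc k) q) \<and> (\<forall>x\<in>span (?F (Suc k) q). g q (V q - ?P q) x = 0)" if q: "q \<in> W" for q
  proof -
    interpret inner_on_subspace "tangent_space A q" "g q" by (rule riemannian_inner[OF g])
    have t: "V q \<in> tangent_space A q" "P q \<in> tangent_space A q" "E q \<in> tangent_space A q"
        "P0 q \<in> tangent_space A q" "X k q \<in> tangent_space A q" "?F (Suc k) q \<subseteq> tangent_space A q"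
      using q Suc.prems by (auto intro: vector_field_tangent[OF P(1)] vector_field_tangent[OF E]
          vector_field_tangent[OF P0(1)] vector_field_tangent)
    have FS: "span (?F k q) \<subseteq> tangent_space A q"
      using t(6) unfolding ins by (intro span_minimal subspace) auto
    have D: "V q - ?P q \<in> tangent_space A q" "r q *\<^sub>R E q \<in> tangent_space A q" "V q - P q \<in> tangent_space A q"
      by (intro subspace_diff subspace_add subspace_scale subspace t)+
    have split: "g q (V q - ?P q) x = g q (V q - P q) x - r q * g q (E q) x" if "x \<in> tangent_space A q" for x
      unfolding diff_diff_eq[symmetric] using that t D by (simp add: diff_left scale_left)
    have ox: "g q (V q - ?P q) x = 0" if "x \<in> span (?F k q)" for x
      using split[of x] that FS P(3)[OF q that] P0(3)[OF q that] by (auto simp: E_def)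
    have "g q (P q) (E q) = 0"
      using P0(3)[OF q P(2)[OF q]] sym[OF t(2,3)] by (simp add: E_def)
    then have "g q (V q - ?P q) (E q) = 0"
      unfolding split[OF t(3)] diff_left[OF t(1,2,3)] using EE[OF q] by (simp add: r_def)
    then have oX: "g q (V q - ?P q) (X k q) = 0"
      using ox[OF P0(2)[OF q]] add_right[OF D(1) t(3,4)] by (simp add: E_def)
    have "g q (V q - ?P q) x = 0" if "x \<in> span (?F (Suc k) q)" for x
    proof (rule orthogonal_span[OF D(1) t(6) _ that])
      show "g q (V q - ?P q) y = 0" if "y \<in> ?F (Suc k) q" for y
        using that oX ox[OF span_base, of y] unfolding ins by blast
    qed
    moreover have "?P q \<in> span (?F (Suc k) q)"
      unfolding ins E_def using P(2)[OF q] P0(2)[OF q] span_mono[of "?F k q" "insert (X k q) (?F k q)"]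
      by (intro span_add span_scale span_diff span_base[of "X k q"]) auto
    ultimately show ?thesis by blast
  qed
  ultimately show ?case by blast
qed

text \<open>Uniqueness for the description in \<open>orth_proj\<close>: two candidates differ by a
  vector of \<open>D p\<close> that is orthogonal to all of \<open>D p\<close>, in particular to
  itself.\<close>

lemma orth_proj_eqI:
  assumes g: "riemannian_metric A g" and D: "subspace (D p)" "D p \<subseteq> tangent_space A p"
    and v: "v \<in> tangent_space A p" and w: "w \<in> D p" "\<And>u. u \<in> D p \<Longrightarrow> g p (v - w) u = 0"
  shows "orth_proj g D p v = w"
  unfolding orth_proj_def
proof (rule the_equality)
  interpret inner_on_subspace "tangent_space A p" "g p" by (rule riemannian_inner[OF g])
  fix w' assume w': "w' \<in> D p \<and> (\<forall>u\<in>D p. g p (v - w') u = 0)"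
  have d: "w - w' \<in> D p" using w w' subspace_diff[OF D(1)] by blast
  have t: "v - w' \<in> tangent_space A p" "v - w \<in> tangent_space A p" "w - w' \<in> tangent_space A p"
    using v w w' D(2) d subspace_diff[OF subspace] by blast+
  have "g p (w - w') (w - w') = g p ((v - w') - (v - w)) (w - w')" by simp
  also have "\<dots> = 0" using diff_left[OF t] d w w' by simp
  finally show "w' = w" using eq_0_iff[OF t(3)] by simp
qed (use w in blast)

text \<open>The projection is defined point by point, without reference to a frame. Near each point
  it agrees with the smooth field built from a local frame, and smoothness is local.\<close>

lemma orth_proj_smooth:
  assumes g: "riemannian_metric A g" and D: "distribution A k D" and V: "vector_field A UNIV V"
  shows "vector_field A UNIV (\<lambda>p. orth_proj g D p (V p))"
proof (rule vector_field_local)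
  fix p
  obtain W X where W: "open W" "p \<in> W" "\<And>i. i < k \<Longrightarrow> vector_field A W (X i)"
    "\<And>q. q \<in> W \<Longrightarrow> inj_on (\<lambda>i. X i q) {..<k} \<and> independent ((\<lambda>i. X i q) ` {..<k})"
    "\<And>q. q \<in> W \<Longrightarrow> D q = span ((\<lambda>i. X i q) ` {..<k})"
    using distributionE[OF D, of p] by metis
  obtain P where P: "vector_field A W P"
    "\<And>q. q \<in> W \<Longrightarrow> P q \<in> D q \<and> (\<forall>x\<in>D q. g q (V q - P q) x = 0)"
    using smooth_projection[OF g W(1,3,4) vector_field_subset[OF V subset_UNIV]] W(5) by auto
  have "P q = orth_proj g D q (V q)" if "q \<in> W" for q
    using P(2)[OF that] vector_field_tangent[OF V UNIV_I]
    by (intro orth_proj_eqI[OF g distribution_subspace[OF D], symmetric]) auto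
  then have "vector_field A W (\<lambda>p. orth_proj g D p (V p))"
    by (rule vector_field_cong[OF P(1)])
  then show "\<exists>V'. open V' \<and> p \<in> V' \<and> vector_field A V' (\<lambda>p. orth_proj g D p (V p))"
    using W by blast
qed

end

section \<open>Tangential parts along an immersion\<close>

context map_into_manifold
begin

text \<open>The images of two candidates differ by a vector that is both tangential and normal,
  hence zero; injectivity of the differential then identifies the candidates.\<close>

lemma tan_part_eqI:
  assumes g: "riemannian_metric B g" and inj: "inj_on (differential B f p) (tangent_space A p)"
    and v: "v \<in> tangent_space A p" "w - differential B f p v \<in> normal_space A B g f p"
  shows "tan_part A B g f p w = v"
  unfolding tan_part_def
proof (rule the_equality)
  interpret inner_on_subspace "tangent_space B (f p)" "g (f p)" by (rule B.riemannian_inner[OF g])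
  let ?d = "differential B f p"
  fix v' assume v': "v' \<in> tangent_space A p \<and> w - ?d v' \<in> normal_space A B g f p"
  have vv: "v - v' \<in> tangent_space A p" using v v' subspace_diff[OF A.tangent_subspace] by blast
  then have dvv: "?d (v - v') \<in> tangent_space B (f p)" by (rule differential_tangent_space)
  have "g (f p) (?d (v - v')) (?d (v - v')) = g (f p) ((w - ?d v') - (w - ?d v)) (?d (v - v'))"
    by (simp add: differential_diff)
  also have "\<dots> = 0"
    using diff_left[OF _ _ dvv, of "w - ?d v'" "w - ?d v"] v v' vv by (simp add: normal_space_def)
  finally have "?d v = ?d v'" using eq_0_iff[OF dvv] by (simp add: differential_diff)
  then show "v' = v" using inj v v' by (simp add: inj_on_def)
qed (use v in blast)

text \<open>The coordinate vectors of a chart form a finite spanning set, so the image of the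
  tangent space is finitely spanned and \<open>w\<close> can be projected to it
  orthogonally.\<close>

lemma tan_part_exists:
  assumes g: "riemannian_metric B g" and w: "w \<in> tangent_space B (f p)"
  obtains v where "v \<in> tangent_space A p" "w - differential B f p v \<in> normal_space A B g f p"
proof -
  interpret inner_on_subspace "tangent_space B (f p)" "g (f p)" by (rule B.riemannian_inner[OF g])
  let ?d = "differential B f p"
  obtain U c where c: "(U, c) \<in> A" "p \<in> U" using A.obtain_chart by blast
  define F where "F = (\<lambda>b. coord_field A (U, c) b p) ` Basis"
  have F: "F \<subseteq> tangent_space A p" "finite F"
    using A.coord_field_tangent[OF c] by (auto simp: F_def)
  have span: "span F = tangent_space A p"
  proof
    show "span F \<subseteq> tangent_space A p" by (rule span_minimal[OF F(1) A.tangent_subspace])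
    show "tangent_space A p \<subseteq> span F"
    proof
      fix v assume "v \<in> tangent_space A p"
      from A.tangent_space_expansion[OF c this]
      show "v \<in> span F"
        by (rule ssubst) (intro span_sum span_scale span_base, simp add: F_def)
    qed
  qed
  have lin: "Vector_Spaces.linear (*\<^sub>R) (*\<^sub>R) ?d"
    by unfold_locales (simp_all add: differential_add differential_scale scaleR_add_right scaleR_add_left)
  have dspan: "span (?d ` F) = ?d ` tangent_space A p"
    using linear_span_image[of ?d F] lin span by (simp add: linear_def)
  obtain u where u: "u \<in> span (?d ` F)" "\<forall>x\<in>span (?d ` F). g (f p) (w - u) x = 0"
    using projection_exists[of "?d ` F" w] F w differential_tangent_space by blast
  then obtain v where v: "v \<in> tangent_space A p" "u = ?d v" unfolding dspan by blast
  have "w - ?d v \<in> normal_space A B g f p"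
    unfolding normal_space_def using u w v differential_tangent_space subspace_diff[OF subspace]
    by (auto simp: dspan)
  then show ?thesis using that v by blast
qed

lemma
  assumes g: "riemannian_metric B g" and inj: "inj_on (differential B f p) (tangent_space A p)"
    and w: "w \<in> tangent_space B (f p)"
  shows tan_part_tangent: "tan_part A B g f p w \<in> tangent_space A p"
    and tan_part_normal: "w - differential B f p (tan_part A B g f p w) \<in> normal_space A B g f p"
  using tan_part_exists[OF g w] tan_part_eqI[OF g inj] by metis+

lemma tan_part_diff:
  assumes g: "riemannian_metric B g" and inj: "inj_on (differential B f p) (tangent_space A p)"
    and w: "w \<in> tangent_space B (f p)" "w' \<in> tangent_space B (f p)"
  shows "tan_part A B g f p (w - w') = tan_part A B g f p w - tan_part A B g f p w'"
proof (rule tan_part_eqI[OF g inj])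
  interpret inner_on_subspace "tangent_space B (f p)" "g (f p)" by (rule B.riemannian_inner[OF g])
  let ?t = "tan_part A B g f p" and ?d = "differential B f p"
  note t = tan_part_tangent[OF g inj] and n = tan_part_normal[OF g inj]
  show "?t w - ?t w' \<in> tangent_space A p"
    using subspace_diff[OF A.tangent_subspace] t w by blast
  have eq: "w - w' - ?d (?t w - ?t w') = (w - ?d (?t w)) - (w' - ?d (?t w'))"
    by (simp add: differential_diff)
  show "w - w' - ?d (?t w - ?t w') \<in> normal_space A B g f p"
    using n[OF w(1)] n[OF w(2)] unfolding eq normal_space_def
    by (auto simp: diff_left differential_tangent_space subspace_diff[OF subspace])
qed

end

section \<open>The invariant distribution\<close>

locale quasi_bi_slant_in_cosymplectic =
  fixes A :: "('a::{t2_space, second_countable_topology}, 'e::euclidean_space) chart set"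
    and gM :: "'a metric"
    and B :: "('b::{t2_space, second_countable_topology}, 'd::euclidean_space) chart set"
    and \<phi> :: "'b \<Rightarrow> 'b tvec \<Rightarrow> 'b tvec"
    and \<xi> :: "'b field"
    and \<eta> :: "'b \<Rightarrow> 'b tvec \<Rightarrow> real"
    and g :: "'b metric"
    and nab :: "'b connection"
    and f :: "'a \<Rightarrow> 'b"
    and D D1 D2 :: "'a \<Rightarrow> 'a tvec set"
    and \<theta>1 \<theta>2 :: real
  assumes ambient: "cosymplectic_manifold B \<phi> \<xi> \<eta> g nab"
    and submanifold: "quasi_bi_slant A gM B \<phi> \<xi> g f D D1 D2 \<theta>1 \<theta>2"
begin

lemma almost_contact: "almost_contact_metric_manifold B \<phi> \<xi> \<eta> g"
  and levi_civita: "levi_civita B g nab"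
  using ambient by (auto simp: cosymplectic_manifold_def)

lemma parallel:
  "open W \<Longrightarrow> vector_field B W Y \<Longrightarrow> q \<in> W \<Longrightarrow> w \<in> tangent_space B q \<Longrightarrow>
    nab q w (\<lambda>x. \<phi> x (Y x)) = \<phi> q (nab q w Y)"
  using ambient by (simp add: cosymplectic_manifold_def)

lemma torsion_free:
  "open W \<Longrightarrow> vector_field B W X \<Longrightarrow> vector_field B W Y \<Longrightarrow> q \<in> W \<Longrightarrow>
    nab q (X q) Y - nab q (Y q) X = lie_bracket B X Y q"
  using levi_civita by (simp add: levi_civita_def)

lemma smooth_manifold_B: "smooth_manifold B"
  and endo: "endo_tensor B \<phi>"
  and form: "one_form B \<eta>"
  and metric_B: "riemannian_metric B g"
  and \<xi>_field: "vector_field B UNIV \<xi>"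
  using almost_contact by (simp_all add: almost_contact_metric_manifold_def)

lemma
  shows \<eta>_\<xi>: "\<eta> q (\<xi> q) = 1"
    and \<phi>\<phi>: "v \<in> tangent_space B q \<Longrightarrow> \<phi> q (\<phi> q v) = - v + \<eta> q v *\<^sub>R \<xi> q"
    and \<eta>_\<phi>: "v \<in> tangent_space B q \<Longrightarrow> \<eta> q (\<phi> q v) = 0"
    and \<eta>_eq: "v \<in> tangent_space B q \<Longrightarrow> \<eta> q v = g q v (\<xi> q)"
    and g_\<phi>\<phi>: "v \<in> tangent_space B q \<Longrightarrow> w \<in> tangent_space B q \<Longrightarrow> g q (\<phi> q v) (\<phi> q w) = g q v w - \<eta> q v * \<eta> q w"
  using almost_contact by (simp_all add: almost_contact_metric_manifold_def)

lemmas submanifold_facts = submanifold[unfolded quasi_bi_slant_def Let_def orthogonal_distributions_def]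

lemma smooth_manifold_A: "smooth_manifold A"
  and metric_A: "riemannian_metric A gM"
  and immersion: "isometric_immersion A gM B g f"
  and \<xi>_tangent: "\<forall>p. \<xi> (f p) \<in> differential B f p ` tangent_space A p"
  and distributions: "\<exists>k. distribution A k D" "\<exists>k. distribution A k D1" "\<exists>k. distribution A k D2"
  and D_invariant: "\<forall>p. \<phi> (f p) ` (differential B f p ` D p) = differential B f p ` D p"
  using submanifold_facts by - (elim conjE, assumption)+

abbreviation \<xi>M :: "'a field" where "\<xi>M p \<equiv> tan_part A B g f p (\<xi> (f p))"

lemma decomposition:
  "\<forall>p. tangent_space A p = {a + b + c + d | a b c d. a \<in> D p \<and> b \<in> D1 p \<and> c \<in> D2 p \<and> d \<in> span {\<xi>M p}}"
  and D_D1: "\<forall>p. \<forall>u\<in>D p. \<forall>w\<in>D1 p. gM p u w = 0"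
  and D_D2: "\<forall>p. \<forall>u\<in>D p. \<forall>w\<in>D2 p. gM p u w = 0"
  and D1_D2: "\<forall>p. \<forall>u\<in>D1 p. \<forall>w\<in>D2 p. gM p u w = 0"
  and D_\<xi>: "\<forall>p. \<forall>u\<in>D p. \<forall>w\<in>span {\<xi>M p}. gM p u w = 0"
  and D1_\<xi>: "\<forall>p. \<forall>u\<in>D1 p. \<forall>w\<in>span {\<xi>M p}. gM p u w = 0"
  and D2_\<xi>: "\<forall>p. \<forall>u\<in>D2 p. \<forall>w\<in>span {\<xi>M p}. gM p u w = 0"
  using submanifold_facts by - (elim conjE, assumption)+

sublocale map_into_manifold A B nab f
  using smooth_manifold_A smooth_manifold_B levi_civita immersion
  by unfold_locales (auto simp: levi_civita_def isometric_immersion_def)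

sublocale iA: inner_on_subspace "tangent_space A p" "gM p" for p
  by (rule A.riemannian_inner[OF metric_A])

sublocale iB: inner_on_subspace "tangent_space B q" "g q" for q
  by (rule B.riemannian_inner[OF metric_B])

abbreviation df :: "'a \<Rightarrow> 'a tvec \<Rightarrow> 'b tvec" where "df \<equiv> differential B f"
abbreviation T :: "'a \<Rightarrow> 'a tvec \<Rightarrow> 'a tvec" where "T \<equiv> T_tensor A B g \<phi> f"
abbreviation along :: "'a \<Rightarrow> 'a tvec \<Rightarrow> ('a \<Rightarrow> 'b tvec) \<Rightarrow> 'b tvec" where "along \<equiv> connection_along B nab f"

lemma inj: "inj_on (df p) (tangent_space A p)"
  and isometry: "v \<in> tangent_space A p \<Longrightarrow> w \<in> tangent_space A p \<Longrightarrow> gM p v w = g (f p) (df p v) (df p w)"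
  using immersion by (simp_all add: isometric_immersion_def)

lemmas df_tangent = differential_tangent_space
lemmas tan_tangent = tan_part_tangent[OF metric_B inj]
lemmas tan_eqI = tan_part_eqI[OF metric_B inj]

text \<open>The discarded normal part is orthogonal to every \<open>df p v\<close>.\<close>

lemma tan_orthogonal:
  "w \<in> tangent_space B (f p) \<Longrightarrow> v \<in> tangent_space A p \<Longrightarrow>
    g (f p) (df p (tan_part A B g f p w)) (df p v) = g (f p) w (df p v)"
  using tan_part_normal[OF metric_B inj, of w p] df_tangent[OF tan_tangent, of w p]
    iB.diff_left[of w "f p" "df p (tan_part A B g f p w)" "df p v"] df_tangent[of v p]
  by (simp add: normal_space_def)

lemma zero_normal: "0 \<in> normal_space A B g f p"
  using subspace_0[OF B.tangent_subspace] iB.zero_left[OF df_tangent]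
  unfolding normal_space_def by blast

lemma D_subspace: "subspace (D p)" "D p \<subseteq> tangent_space A p"
  and D1_subspace: "subspace (D1 p)" "D1 p \<subseteq> tangent_space A p"
  and D2_subspace: "subspace (D2 p)" "D2 p \<subseteq> tangent_space A p"
  using distributions A.distribution_subspace by metis+

text \<open>Tangency of \<xi> provides a preimage with zero remainder; as 0 is normal, uniqueness
  makes that preimage the tangential part.\<close>

lemma \<xi>M: "\<xi>M p \<in> tangent_space A p" "df p (\<xi>M p) = \<xi> (f p)"
proof -
  obtain v where v: "v \<in> tangent_space A p" "\<xi> (f p) = df p v" using \<xi>_tangent by blast
  have "\<xi>M p = v" by (rule tan_eqI[OF v(1)]) (simp add: v(2) zero_normal)
  then show "\<xi>M p \<in> tangent_space A p" "df p (\<xi>M p) = \<xi> (f p)" using v by auto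
qed

lemma \<eta>_df: "v \<in> tangent_space A p \<Longrightarrow> \<eta> (f p) (df p v) = gM p v (\<xi>M p)"
  using \<eta>_eq[OF df_tangent] isometry[OF _ \<xi>M(1)] \<xi>M(2) by simp

text \<open>By invariance of \<open>D\<close> the vector \<open>\<phi> (f p) (df p v)\<close> is
  already the image of a vector of \<open>D p\<close>, so there is no normal part to remove.\<close>

lemma T_invariant:
  assumes "v \<in> D p"
  shows "T p v \<in> D p" "df p (T p v) = \<phi> (f p) (df p v)"
proof -
  have "\<phi> (f p) (df p v) \<in> df p ` D p" using D_invariant assms by blast
  then obtain u where u: "u \<in> D p" "\<phi> (f p) (df p v) = df p u" by blast
  have "T p v = u"
    unfolding T_tensor_def by (rule tan_eqI) (use u D_subspace(2) zero_normal in auto)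
  then show "T p v \<in> D p" "df p (T p v) = \<phi> (f p) (df p v)" using u by auto
qed

lemma \<phi>_tangent: "v \<in> tangent_space B q \<Longrightarrow> \<phi> q v \<in> tangent_space B q"
  by (rule endo_tensor_linear(2)[OF endo])

lemma \<phi>_add: "v \<in> tangent_space B q \<Longrightarrow> w \<in> tangent_space B q \<Longrightarrow> \<phi> q (v + w) = \<phi> q v + \<phi> q w"
  and \<phi>_scale: "v \<in> tangent_space B q \<Longrightarrow> \<phi> q (r *\<^sub>R v) = r *\<^sub>R \<phi> q v"
  using endo_tensor_linear(1)[OF endo, of q] by (auto simp: linear_on_subspace_def)

lemma \<phi>_diff: "v \<in> tangent_space B q \<Longrightarrow> w \<in> tangent_space B q \<Longrightarrow> \<phi> q (v - w) = \<phi> q v - \<phi> q w"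
  using \<phi>_add[of v q "-1 *\<^sub>R w"] \<phi>_scale[of w q "-1"] subspace_scale[OF B.tangent_subspace, of w q "-1"] by simp

lemma \<eta>_scale: "v \<in> tangent_space B q \<Longrightarrow> \<eta> q (r *\<^sub>R v) = r * \<eta> q v"
  and \<eta>_add: "v \<in> tangent_space B q \<Longrightarrow> w \<in> tangent_space B q \<Longrightarrow> \<eta> q (v + w) = \<eta> q v + \<eta> q w"
  using form by (auto simp: one_form_def linear_on_subspace_def)

lemma \<xi>_in: "\<xi> q \<in> tangent_space B q"
  by (rule B.vector_field_tangent[OF \<xi>_field UNIV_I])

text \<open>Compatibility of the metric gives
  \<open>g (\<phi> v) w = g (\<phi> (\<phi> v)) (\<phi> w)\<close>, because \<eta> vanishes on
  \<open>\<phi> v\<close>. Expanding the square of \<phi> leaves \<open>- v\<close> and a multiple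
  of \<xi>, and \<xi> is orthogonal to \<open>\<phi> w\<close>.\<close>

lemma \<phi>_skew:
  assumes v: "v \<in> tangent_space B q" and w: "w \<in> tangent_space B q"
  shows "g q (\<phi> q v) w = - g q v (\<phi> q w)"
proof -
  have \<phi>v: "\<phi> q v \<in> tangent_space B q" and \<phi>w: "\<phi> q w \<in> tangent_space B q"
    using v w by (auto intro: \<phi>_tangent)
  have s: "\<eta> q v *\<^sub>R \<xi> q \<in> tangent_space B q" by (rule subspace_scale[OF B.tangent_subspace \<xi>_in])
  have "g q (\<phi> q v) w = g q (\<phi> q (\<phi> q v)) (\<phi> q w)"
    using g_\<phi>\<phi>[OF \<phi>v w] \<eta>_\<phi>[OF v] by simp
  also have "\<phi> q (\<phi> q v) = \<eta> q v *\<^sub>R \<xi> q - v" using \<phi>\<phi>[OF v] by simp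
  also have "g q (\<eta> q v *\<^sub>R \<xi> q - v) (\<phi> q w) = \<eta> q v * g q (\<xi> q) (\<phi> q w) - g q v (\<phi> q w)"
    using iB.diff_left[OF s v \<phi>w] iB.scale_left[OF \<xi>_in \<phi>w] by simp
  also have "g q (\<xi> q) (\<phi> q w) = 0"
    using iB.sym[OF \<xi>_in \<phi>w] \<eta>_eq[OF \<phi>w] \<eta>_\<phi>[OF w] by simp
  finally show ?thesis by simp
qed

lemma along_\<phi>:
  "v \<in> tangent_space A p \<Longrightarrow> field_along A B f p V \<Longrightarrow>
    along p v (\<lambda>q. \<phi> (f q) (V q)) = \<phi> (f p) (along p v V)"
  by (rule connection_along_parallel_endo[OF endo parallel])

lemma section_D: "X \<in> sections A D \<Longrightarrow> vector_field A UNIV X"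
  "X \<in> sections A D \<Longrightarrow> X p \<in> D p" "X \<in> sections A D \<Longrightarrow> X p \<in> tangent_space A p"
  using D_subspace(2) by (auto simp: sections_def)

lemma D_\<eta>: "v \<in> D p \<Longrightarrow> \<eta> (f p) (df p v) = 0"
proof -
  assume v: "v \<in> D p"
  have "\<xi>M p \<in> span {\<xi>M p}" by (rule span_base) simp
  then have "gM p v (\<xi>M p) = 0" using D_\<xi> v by blast
  then show ?thesis using \<eta>_df[OF subsetD[OF D_subspace(2) v]] by simp
qed

text \<open>Since \<^term>\<open>\<phi>\<close> squares to minus the identity on \<^term>\<open>D\<close>, parallelism of \<^term>\<open>\<phi>\<close> alone
  forces the \<^term>\<open>\<xi>\<close>-component of the derivative to vanish.\<close>

lemma \<eta>_along:
  assumes v: "v \<in> tangent_space A p" and Y: "Y \<in> sections A D"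
  shows "\<eta> (f p) (along p v (\<lambda>q. df q (Y q))) = 0"
proof -
  let ?L = "along p v (\<lambda>q. df q (Y q))"
  have V: "field_along A B f p (\<lambda>q. df q (Y q))"
    by (rule field_along_differential[OF section_D(1)[OF Y]])
  have L: "?L \<in> tangent_space B (f p)" by (rule connection_along_tangent[OF v])
  have "\<phi> (f q) (\<phi> (f q) (df q (Y q))) = - df q (Y q)" for q
    using \<phi>\<phi>[OF df_tangent[OF section_D(3)[OF Y]]] D_\<eta>[OF section_D(2)[OF Y]] by simp
  \<comment> \<open>Parallelism is used twice: for the field \<open>df Y\<close> and for its image
    under \<phi>, which is again a smooth field along \<open>f\<close>.\<close>
  then have "\<phi> (f p) (\<phi> (f p) ?L) = along p v (\<lambda>q. - df q (Y q))"
    using along_\<phi>[OF v V] along_\<phi>[OF v field_along_endo[OF endo V]] by simp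
  also have "\<dots> = - ?L" by (rule connection_along_minus[OF v V])
  finally have "\<eta> (f p) ?L *\<^sub>R \<xi> (f p) = 0" using \<phi>\<phi>[OF L] by simp
  \<comment> \<open>Applying \<eta> recovers the coefficient, since it takes the value 1 on
    \<xi>.\<close>
  then have "\<eta> (f p) (\<eta> (f p) ?L *\<^sub>R \<xi> (f p)) = \<eta> (f p) (0 *\<^sub>R \<xi> (f p))" by (simp only: scaleR_zero_left)
  then show ?thesis by (simp only: \<eta>_scale[OF \<xi>_in] \<eta>_\<xi> mult_1_right mult_zero_left)
qed

section \<open>The bracket of two sections of the invariant distribution\<close>

lemma along_bracket:
  assumes "X \<in> sections A D" "Y \<in> sections A D"
  shows "along p (X p) (\<lambda>q. df q (Y q)) - along p (Y p) (\<lambda>q. df q (X q)) = df p (lie_bracket A X Y p)"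
  using assms by (intro connection_along_torsion_free[OF torsion_free] section_D(1))

lemma bracket_tangent:
  "X \<in> sections A D \<Longrightarrow> Y \<in> sections A D \<Longrightarrow> lie_bracket A X Y p \<in> tangent_space A p"
  by (intro A.lie_bracket_tangent[OF open_UNIV UNIV_I] section_D(1))

text \<open>The image of the bracket is a difference of two covariant derivatives of sections of
  \<open>D\<close>, and \<eta> vanishes on each of them.\<close>

lemma bracket_\<xi>:
  assumes X: "X \<in> sections A D" and Y: "Y \<in> sections A D"
  shows "gM p (lie_bracket A X Y p) (\<xi>M p) = 0"
proof -
  let ?a = "along p (X p) (\<lambda>q. df q (Y q))" and ?b = "along p (Y p) (\<lambda>q. df q (X q))"
  have t: "?a \<in> tangent_space B (f p)" "?b \<in> tangent_space B (f p)"
    using X Y by (auto intro: connection_along_tangent section_D(3))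
  have "\<eta> (f p) (df p (lie_bracket A X Y p)) = \<eta> (f p) (?a + - 1 *\<^sub>R ?b)"
    using along_bracket[OF X Y, of p] by simp
  also have "\<dots> = \<eta> (f p) ?a + - 1 * \<eta> (f p) ?b"
    by (simp only: \<eta>_add[OF t(1) subspace_scale[OF B.tangent_subspace t(2)]] \<eta>_scale[OF t(2)])
  also have "\<dots> = 0" using \<eta>_along[OF section_D(3)[OF X] Y] \<eta>_along[OF section_D(3)[OF Y] X] by simp
  finally show ?thesis using \<eta>_df[OF bracket_tangent[OF X Y]] by simp
qed

text \<open>Orthogonality of \<open>D1\<close> and \<open>D2\<close> makes the summands of
  \<open>z\<close> its two projections. Consequently \<open>\<phi> Q Z + \<phi> R Z\<close> in the
  condition is just \<open>\<phi> Z\<close>.\<close>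

lemma D1_D2_projection:
  assumes z: "z \<in> sum_distribution D1 D2 p"
  shows "orth_proj gM D1 p z + orth_proj gM D2 p z = z"
    and "orth_proj gM D1 p z \<in> tangent_space A p" "orth_proj gM D2 p z \<in> tangent_space A p"
proof -
  obtain b c where bc: "b \<in> D1 p" "c \<in> D2 p" "z = b + c" using z by (auto simp: sum_distribution_def)
  have t: "b \<in> tangent_space A p" "c \<in> tangent_space A p"
    using bc D1_subspace(2) D2_subspace(2) by auto
  then have zt: "z \<in> tangent_space A p" using bc subspace_add[OF A.tangent_subspace] by blast
  have "orth_proj gM D1 p z = b"
  proof (rule A.orth_proj_eqI[where D = D1 and p = p, OF metric_A D1_subspace zt bc(1)])
    fix u assume "u \<in> D1 p"
    then have "gM p u c = 0" "u \<in> tangent_space A p" using D1_D2 bc(2) D1_subspace(2)[of p] by auto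
    then show "gM p (z - b) u = 0" using iA.sym[OF t(2)] bc(3) by simp
  qed
  moreover have "orth_proj gM D2 p z = c"
    by (rule A.orth_proj_eqI[where D = D2 and p = p, OF metric_A D2_subspace zt bc(2)]) (use D1_D2 bc in auto)
  ultimately show "orth_proj gM D1 p z + orth_proj gM D2 p z = z"
    "orth_proj gM D1 p z \<in> tangent_space A p" "orth_proj gM D2 p z \<in> tangent_space A p"
    using bc t by auto
qed

text \<open>The equivalence is pointwise in \<open>z\<close>, for fixed sections \<open>X\<close>
  and \<open>Y\<close>. With \<open>w\<close> the image of the bracket under \<phi> and
  \<open>u\<close> its tangential part, the sides become \<open>- g (df u) (\<phi> z)\<close> and
  \<open>g w (\<phi> z) - g (df u) (\<phi> z)\<close>, so equality means
  \<open>g w (\<phi> z) = 0\<close>.\<close>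

lemma integrability_condition:
  assumes X: "X \<in> sections A D" and Y: "Y \<in> sections A D" and z: "z \<in> sum_distribution D1 D2 p"
  defines "nabM \<equiv> induced_connection A B g nab f"
    and "h \<equiv> second_fundamental_form A B g nab f"
  shows "gM p (T p (nabM X (\<lambda>q. T q (Y q)) p - nabM Y (\<lambda>q. T q (X q)) p)) z =
       g (f p) (h X (\<lambda>q. T q (Y q)) p - h Y (\<lambda>q. T q (X q)) p)
         (\<phi> (f p) (df p (orth_proj gM D1 p z)) + \<phi> (f p) (df p (orth_proj gM D2 p z))) \<longleftrightarrow>
     gM p (lie_bracket A X Y p) z = 0"
proof -
  let ?tan = "tan_part A B g f p"
  define a where "a = along p (X p) (\<lambda>q. df q (T q (Y q)))"
  define b where "b = along p (Y p) (\<lambda>q. df q (T q (X q)))"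
  define w where "w = \<phi> (f p) (df p (lie_bracket A X Y p))"
  note bt = bracket_tangent[OF X Y, of p]
  have zt: "z \<in> tangent_space A p"
    using D1_D2_projection[OF z] subspace_add[OF A.tangent_subspace] by metis
  have zd: "df p z \<in> tangent_space B (f p)" and bd: "df p (lie_bracket A X Y p) \<in> tangent_space B (f p)"
    using zt bt by (auto intro: df_tangent)
  have Xt: "X p \<in> tangent_space A p" and Yt: "Y p \<in> tangent_space A p" using X Y by (auto intro: section_D(3))
  have ab: "a \<in> tangent_space B (f p)" "b \<in> tangent_space B (f p)"
    unfolding a_def b_def by (intro connection_along_tangent Xt Yt)+
  have wt: "w \<in> tangent_space B (f p)" unfolding w_def by (rule \<phi>_tangent[OF bd])
  \<comment> \<open>The field \<open>T Y\<close> is pushed forward to \<open>\<phi> (df Y)\<close>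
    with no normal part, so parallelism applies to it.\<close>
  have "a = \<phi> (f p) (along p (X p) (\<lambda>q. df q (Y q)))" "b = \<phi> (f p) (along p (Y p) (\<lambda>q. df q (X q)))"
    unfolding a_def b_def T_invariant(2)[OF section_D(2)[OF Y]] T_invariant(2)[OF section_D(2)[OF X]]
    by (intro along_\<phi> Xt Yt field_along_differential section_D(1) X Y)+
  then have abw: "a - b = w"
    unfolding w_def along_bracket[OF X Y, symmetric]
    using \<phi>_diff connection_along_tangent[OF Xt] connection_along_tangent[OF Yt] by simp
  define u where "u = ?tan w"
  have ut: "u \<in> tangent_space A p" unfolding u_def by (rule tan_tangent[OF wt])
  then have ud: "df p u \<in> tangent_space B (f p)" by (rule df_tangent)
  have tan_diff: "nabM X (\<lambda>q. T q (Y q)) p - nabM Y (\<lambda>q. T q (X q)) p = u"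
    unfolding nabM_def induced_connection_def u_def abw[symmetric] tan_part_diff[OF metric_B inj ab]
    by (simp only: a_def b_def)
  have "h X (\<lambda>q. T q (Y q)) p - h Y (\<lambda>q. T q (X q)) p = (a - df p (?tan a)) - (b - df p (?tan b))"
    unfolding h_def second_fundamental_form_def nor_part_def a_def b_def ..
  also have "\<dots> = w - df p u"
    unfolding u_def abw[symmetric] tan_part_diff[OF metric_B inj ab] differential_diff by simp
  finally have h_diff: "h X (\<lambda>q. T q (Y q)) p - h Y (\<lambda>q. T q (X q)) p = w - df p u" .
  have \<phi>z: "\<phi> (f p) (df p (orth_proj gM D1 p z)) + \<phi> (f p) (df p (orth_proj gM D2 p z)) = \<phi> (f p) (df p z)"
    using \<phi>_add[OF df_tangent df_tangent] D1_D2_projection[OF z] by (metis differential_add)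
  have \<phi>zt: "\<phi> (f p) (df p z) \<in> tangent_space B (f p)" by (rule \<phi>_tangent[OF zd])
  have "gM p (T p u) z = g (f p) (df p (T p u)) (df p z)"
    unfolding T_tensor_def by (rule isometry[OF tan_tangent[OF \<phi>_tangent[OF ud]] zt])
  also have "\<dots> = g (f p) (\<phi> (f p) (df p u)) (df p z)"
    unfolding T_tensor_def by (rule tan_orthogonal[OF \<phi>_tangent[OF ud] zt])
  also have "\<dots> = - g (f p) (df p u) (\<phi> (f p) (df p z))" by (rule \<phi>_skew[OF ud zd])
  finally have lhs: "gM p (T p u) z = - g (f p) (df p u) (\<phi> (f p) (df p z))" .
  have rhs: "g (f p) (w - df p u) (\<phi> (f p) (df p z)) =
      g (f p) w (\<phi> (f p) (df p z)) - g (f p) (df p u) (\<phi> (f p) (df p z))"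
    by (rule iB.diff_left[OF wt ud \<phi>zt])
  \<comment> \<open>This removes the correction term in the compatibility of \<phi> with the metric,
    so \<phi> preserves the inner product of the bracket with \<open>z\<close>.\<close>
  have "\<eta> (f p) (df p (lie_bracket A X Y p)) = 0"
    using \<eta>_df[OF bt] bracket_\<xi>[OF X Y] by simp
  then have "g (f p) w (\<phi> (f p) (df p z)) = gM p (lie_bracket A X Y p) z"
    unfolding w_def using g_\<phi>\<phi>[OF bd zd] isometry[OF bt zt] by simp
  then show ?thesis
    unfolding tan_diff h_diff \<phi>z lhs rhs by simp
qed

text \<open>The test field is the part of \<^term>\<open>lie_bracket A X Y\<close> orthogonal to \<^term>\<open>D\<close>, so no
  bump functions are needed to globalise a test vector.\<close>

lemma bracket_in_D:
  assumes X: "X \<in> sections A D" and Y: "Y \<in> sections A D"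
    and orth: "\<And>Z p. Z \<in> sections A (sum_distribution D1 D2) \<Longrightarrow> gM p (lie_bracket A X Y p) (Z p) = 0"
  shows "lie_bracket A X Y \<in> sections A D"
proof -
  let ?V = "lie_bracket A X Y"
  obtain k where k: "distribution A k D" using distributions(1) by blast
  have V: "vector_field A UNIV ?V"
    by (intro A.lie_bracket_vector_field[OF open_UNIV] section_D(1) X Y)
  define P where "P p = orth_proj gM D p (?V p)" for p
  define Z where "Z p = ?V p - P p" for p
  have P: "vector_field A UNIV P" unfolding P_def by (rule A.orth_proj_smooth[OF metric_A k V])
  have Z: "vector_field A UNIV Z" unfolding Z_def by (rule A.vector_field_diff[OF open_UNIV V P])
  have PZ: "P p \<in> D p \<and> Z p \<in> sum_distribution D1 D2 p" for p
  proof -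
    have vt: "?V p \<in> tangent_space A p" by (rule bracket_tangent[OF X Y])
    then obtain a b c d where dec: "?V p = a + b + c + d" "a \<in> D p" "b \<in> D1 p" "c \<in> D2 p" "d \<in> span {\<xi>M p}"
      using decomposition by blast
    have t: "a \<in> tangent_space A p" "b \<in> tangent_space A p" "c \<in> tangent_space A p" "d \<in> tangent_space A p"
      using subsetD[OF D_subspace(2) dec(2)] subsetD[OF D1_subspace(2) dec(3)] subsetD[OF D2_subspace(2) dec(4)]
        subsetD[OF span_minimal[OF _ A.tangent_subspace] dec(5)] \<xi>M(1) by auto
    have bct: "b + c \<in> tangent_space A p" "a + b + c \<in> tangent_space A p" "a + b \<in> tangent_space A p"
      using t by (auto intro: subspace_add[OF A.tangent_subspace])
    obtain r where r: "d = r *\<^sub>R \<xi>M p" using dec(5) by (auto simp: span_singleton)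
    \<comment> \<open>The \<xi>-component \<open>d\<close> has to be excluded, or else the remainder
      \<open>Z\<close> would not be a section of the sum of \<open>D1\<close> and \<open>D2\<close>.
      It vanishes because the bracket is orthogonal to \<xi>.\<close>
    have "gM p (?V p) d = 0" using bracket_\<xi>[OF X Y] iA.scale_right[OF vt \<xi>M(1)] r by simp
    moreover have "gM p (?V p) d = gM p d d"
      unfolding dec(1) using dec D_\<xi> D1_\<xi> D2_\<xi> t bct by (simp add: iA.add_left)
    ultimately have d: "d = 0" using iA.eq_0_iff[OF t(4)] by simp
    have "P p = a"
      unfolding P_def
    proof (rule A.orth_proj_eqI[where D = D and p = p, OF metric_A D_subspace vt dec(2)])
      fix u assume u: "u \<in> D p"
      then have ut: "u \<in> tangent_space A p" using D_subspace(2) by blast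
      have "gM p b u = 0" "gM p c u = 0"
        using iA.sym[OF t(2) ut] iA.sym[OF t(3) ut] D_D1 D_D2 u dec by auto
      then show "gM p (?V p - a) u = 0"
        using iA.add_left[OF t(2,3) ut] by (simp add: dec(1) d add_ac)
    qed
    then show ?thesis using dec d by (auto simp: Z_def sum_distribution_def add_ac)
  qed
  have "?V p \<in> D p" for p
  proof -
    have t: "Z p \<in> tangent_space A p" "P p \<in> tangent_space A p" "?V p \<in> tangent_space A p"
      using A.vector_field_tangent[OF Z] A.vector_field_tangent[OF P] bracket_tangent[OF X Y] by auto
    have "Z \<in> sections A (sum_distribution D1 D2)" using Z PZ by (simp add: sections_def)
    then have 1: "gM p (?V p) (Z p) = 0" by (rule orth)
    obtain b c where bc: "b \<in> D1 p" "c \<in> D2 p" "Z p = b + c" using PZ[of p] by (auto simp: sum_distribution_def)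
    have "gM p (P p) (Z p) = 0"
      using iA.add_right[OF t(2)] bc PZ D_D1 D_D2 D1_subspace(2) D2_subspace(2) by (simp add: subset_iff)
    \<comment> \<open>\<open>Z\<close> is the bracket minus \<open>P\<close>, and both are
      orthogonal to \<open>Z\<close>: the bracket by the assumption tested on \<open>Z\<close>
      itself, \<open>P\<close> as a section of \<open>D\<close>.\<close>
    then have "gM p (Z p) (Z p) = 0" using 1 iA.diff_left[OF t(3,2,1)] by (simp add: Z_def)
    then have "Z p = 0" using iA.eq_0_iff[OF t(1)] by simp
    then show ?thesis using PZ[of p] by (simp add: Z_def)
  qed
  then show ?thesis using V by (simp add: sections_def)
qed

lemma D_orthogonal_sum:
  assumes "v \<in> D p" "z \<in> sum_distribution D1 D2 p"
  shows "gM p v z = 0"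
proof -
  obtain b c where "b \<in> D1 p" "c \<in> D2 p" "z = b + c" using assms(2) by (auto simp: sum_distribution_def)
  then show ?thesis
    using assms(1) D_D1 D_D2 iA.add_right[of v p b c] D_subspace(2) D1_subspace(2) D2_subspace(2)
    by (simp add: subset_iff)
qed

text \<open>Orthogonality is tested on the same global sections \<open>Z\<close> over which the
  condition of the theorem ranges, so the pointwise equivalence can be applied under the
  quantifiers.\<close>

lemma integrable_iff_bracket_orthogonal:
  "integrable_distribution A D \<longleftrightarrow>
    (\<forall>X\<in>sections A D. \<forall>Y\<in>sections A D. \<forall>Z\<in>sections A (sum_distribution D1 D2). \<forall>p.
       gM p (lie_bracket A X Y p) (Z p) = 0)"
proof
  assume "integrable_distribution A D"
  then show "\<forall>X\<in>sections A D. \<forall>Y\<in>sections A D. \<forall>Z\<in>sections A (sum_distribution D1 D2). \<forall>p.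
       gM p (lie_bracket A X Y p) (Z p) = 0"
    unfolding integrable_distribution_def by (simp add: sections_def D_orthogonal_sum)
next
  assume "\<forall>X\<in>sections A D. \<forall>Y\<in>sections A D. \<forall>Z\<in>sections A (sum_distribution D1 D2). \<forall>p.
       gM p (lie_bracket A X Y p) (Z p) = 0"
  then show "integrable_distribution A D"
    unfolding integrable_distribution_def by (intro ballI bracket_in_D) simp_all
qed

end

theorem theorem4p1:
  fixes A :: "('a::{t2_space, second_countable_topology}, 'e::euclidean_space) chart set"
    and gM :: "'a metric"
    and B :: "('b::{t2_space, second_countable_topology}, 'd::euclidean_space) chart set"
    and \<phi> :: "'b \<Rightarrow> 'b tvec \<Rightarrow> 'b tvec"
    and \<xi> :: "'b field"
    and \<eta> :: "'b \<Rightarrow> 'b tvec \<Rightarrow> real"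
    and g :: "'b metric"
    and nab :: "'b connection"
    and f :: "'a \<Rightarrow> 'b"
    and D D1 D2 :: "'a \<Rightarrow> 'a tvec set"
    and \<theta>1 \<theta>2 :: real
  assumes ambient: "cosymplectic_manifold B \<phi> \<xi> \<eta> g nab"
    and submanifold: "proper_quasi_bi_slant A gM B \<phi> \<xi> g f D D1 D2 \<theta>1 \<theta>2"
  defines "T \<equiv> T_tensor A B g \<phi> f"
    and "Q \<equiv> orth_proj gM D1"
    and "R \<equiv> orth_proj gM D2"
    and "nabM \<equiv> induced_connection A B g nab f"
    and "h \<equiv> second_fundamental_form A B g nab f"
    and "df \<equiv> differential B f"
  shows "integrable_distribution A D \<longleftrightarrow>
    (\<forall>X\<in>sections A D. \<forall>Y\<in>sections A D. \<forall>Z\<in>sections A (sum_distribution D1 D2). \<forall>p.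
       gM p (T p (nabM X (\<lambda>q. T q (Y q)) p - nabM Y (\<lambda>q. T q (X q)) p)) (Z p) =
       g (f p) (h X (\<lambda>q. T q (Y q)) p - h Y (\<lambda>q. T q (X q)) p)
         (\<phi> (f p) (df p (Q p (Z p))) + \<phi> (f p) (df p (R p (Z p)))))"
proof -
  interpret quasi_bi_slant_in_cosymplectic A gM B \<phi> \<xi> \<eta> g nab f D D1 D2 \<theta>1 \<theta>2
    using ambient submanifold by unfold_locales (simp_all add: proper_quasi_bi_slant_def)
  have "Z p \<in> sum_distribution D1 D2 p" if "Z \<in> sections A (sum_distribution D1 D2)" for Z p
    using that by (simp add: sections_def)
  then show ?thesis
    unfolding integrable_iff_bracket_orthogonal T_def Q_def R_def nabM_def h_def df_def
    by (intro ball_cong refl all_cong) (simp add: integrability_condition)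
qed

end
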